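(* Let $T>0$, $p\in[1,\infty)$, $p'\in(p,\infty)$, and let $b:[0,T]\times\mathbb{R}^d\times\mathcal{P}_p(\mathbb{R}^d)\to\mathbb{R}^d$ be a measurable function for which there is a constant $K_b$ such that $|b(t,x,\mu)-b(t,x',\mu')|^p\le K_b(|x-x'|^p+\mathcal{W}_{\mathbb{R}^d,p}(\mu,\mu')^p)$ for all $t\in[0,T]$, $x,x'\in\mathbb{R}^d$, $\mu,\mu'\in\mathcal{P}_p(\mathbb{R}^d)$. Let $(\bar\Omega,\bar{\mathcal{A}},\bar{\mathbb{P}})$ be a probability space. On this space consider independent families $(\zeta^i)_{i\ge1}\subset L^{p'}(\bar\Omega,\mathbb{R}^d)$ and $(W^i)_{i\ge1}\subset L^{p'}(\bar\Omega,C_T)$, each consisting of i.i.d. random variables. Let $\bar\zeta$ be distributed as $\zeta^1$ and let $\bar W$ be distributed as $W^1$ and independent of $\bar\zeta$. Moreover, let $B\in L^p(\bar\Omega,C_T)$ be a random variable independent from the others. Then for every $N$ there exists a solution $X^{(N)}=(X^{i,N})_{1\le i\le N}\in L^p(\bar\Omega,(C_T)^N)$ to $$dX^{i,N}_t=b\Big(t,X^{i,N}_t,\tfrac1N\sum_{j=1}^N\delta_{X^{j,N}_t}\Big)dt+dW^i_t+dB_t,\qquad X^{i,N}_0=\zeta^i,\qquad i=1,\dots,N,$$ and a solution $\bar X\in L^p(\bar\Omega,C_T)$ to $$d\bar X_t=b(t,\bar X_t,\mathcal{L}(\bar X_t\mid B))\,dt+d\bar W_t+dB_t,\qquad\bar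 X_0=\bar\zeta.$$ Moreover, $$\mathcal{W}_{C_T,p}\big(L^N(X^{(N)}),\mathcal{L}(\bar X\mid B)\big)\to0\quad\bar{\mathbb{P}}\text{-a.s. as }N\to\infty.$$
   Context: $C_T:=C([0,T],\mathbb{R}^d)$ with the supremum norm. $\mathcal{P}_p(E)$ is the set of Borel probability measures with finite $p$-th moment and $\mathcal{W}_{E,p}$ the $p$-Wasserstein metric. $L^N(y^{(N)}):=\frac1N\sum_{i=1}^N\delta_{y^i}$. $\mathcal{L}(Y\mid B)$ denotes the (regular) conditional law of $Y$ given $B$. Solutions are pathwise: the integrated equations ($X^{i,N}_t=\zeta^i+\int_0^tb(s,X^{i,N}_s,L^N(X^{(N)}_s))\,ds+W^i_t+B_t$, resp. $\bar X_t=\bar\zeta+\int_0^tb(s,\bar X_s,\mathcal{L}(\bar X_s\mid B))\,ds+\bar W_t+B_t$, for all $t\in[0,T]$) hold $\bar{\mathbb{P}}$-a.s. $L^q(\bar\Omega,E)$ denotes $E$-valued random variables with finite $q$-th moment.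
   Formalization: Added assumption: t ↦ b(t,0,δ_0) is Lebesgue integrable on [0,T]. Without it the claim fails (b(t,x,μ)=1/t with all data zero has no solution), and the existence of any solution already forces it. *)

theory Defs
  imports "HOL-Probability.Probability"
begin

section \<open>The path space\<close>

text \<open>
  The space of continuous paths from \<open>[0,T]\<close> to \<open>\<real>\<^sup>d\<close> depends on the real number \<open>T\<close>, so it is
  realised as a subset of the type of bounded continuous functions on the real line: a path is
  extended to the left of \<open>0\<close> and to the right of \<open>T\<close> by its boundary values. Every continuous
  function on \<open>[0,T]\<close> has exactly one such extension, and the norm and metric of the function type
  become the supremum norm and metric over \<open>[0,T]\<close> (see the two lemmas below).
\<close>

type_synonym 'd path = "real \<Rightarrow>\<^sub>C (real ^ 'd)"

definition path_space :: "real \<Rightarrow> ('d::finite) path set" where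
  "path_space T = {f. \<forall>t. apply_bcontfun f t = apply_bcontfun f (max 0 (min T t))}"

definition path_borel :: "real \<Rightarrow> ('d::finite) path measure" where
  "path_borel T = restrict_space borel (path_space T)"

lemma path_space_ex1:
  fixes f :: "real \<Rightarrow> real ^ ('d::finite)"
  assumes "T > 0" and "continuous_on {0..T} f"
  shows "\<exists>!g. g \<in> path_space T \<and> (\<forall>t\<in>{0..T}. apply_bcontfun g t = f t)"
proof (rule ex_ex1I)
  let ?h = "\<lambda>t. f (max 0 (min T t))"
  have c: "continuous_on UNIV ?h"
    by (rule continuous_on_compose2[OF assms(2)]) (use assms(1) in \<open>auto intro!: continuous_intros\<close>)
  have "bounded (f ` {0..T})"
    using assms(2) by (intro compact_imp_bounded compact_continuous_image) auto
  then have "bounded (range ?h)"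
    by (rule bounded_subset) (use assms(1) in auto)
  then have "?h \<in> bcontfun" using c by (simp add: bcontfun_def)
  then have "apply_bcontfun (Bcontfun ?h) = ?h" by (rule Bcontfun_inverse)
  then show "\<exists>g. g \<in> path_space T \<and> (\<forall>t\<in>{0..T}. apply_bcontfun g t = f t)"
    using assms(1) by (intro exI[of _ "Bcontfun ?h"]) (auto simp: path_space_def)
next
  fix g h :: "'d path"
  assume g: "g \<in> path_space T \<and> (\<forall>t\<in>{0..T}. apply_bcontfun g t = f t)"
    and h: "h \<in> path_space T \<and> (\<forall>t\<in>{0..T}. apply_bcontfun h t = f t)"
  show "g = h"
  proof (rule bcontfun_eqI)
    fix t
    have "max 0 (min T t) \<in> {0..T}" using assms(1) by auto
    then show "apply_bcontfun g t = apply_bcontfun h t"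
      using g h unfolding path_space_def by (metis (mono_tags, lifting) mem_Collect_eq)
  qed
qed

lemma dist_path_space:
  fixes f g :: "('d::finite) path"
  assumes "T > 0" "f \<in> path_space T" "g \<in> path_space T"
  shows "dist f g = (SUP t\<in>{0..T}. dist (apply_bcontfun f t) (apply_bcontfun g t))"
proof -
  have "dist (apply_bcontfun f t) (apply_bcontfun g t) =
      dist (apply_bcontfun f (max 0 (min T t))) (apply_bcontfun g (max 0 (min T t)))" for t
    using assms(2,3) unfolding path_space_def by (metis (mono_tags, lifting) mem_Collect_eq)
  then have "range (\<lambda>t. dist (apply_bcontfun f t) (apply_bcontfun g t)) =
      (\<lambda>t. dist (apply_bcontfun f t) (apply_bcontfun g t)) ` {0..T}"
    using assms(1) by (fastforce simp: image_iff)
  then show ?thesis by (simp add: dist_bcontfun_def)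
qed


section \<open>Moments, Wasserstein distance, empirical measures\<close>

text \<open>Here \<open>E\<close> stands for the state space with its Borel sets, i.e.\ \<open>borel\<close> or \<open>path_borel T\<close>.\<close>

definition Lq_space ::
  "'w measure \<Rightarrow> real \<Rightarrow> ('a::real_normed_vector) measure \<Rightarrow> ('w \<Rightarrow> 'a) set" where
  "Lq_space M q E = {X \<in> measurable M E. integrable M (\<lambda>\<omega>. norm (X \<omega>) powr q)}"

definition prob_moment ::
  "real \<Rightarrow> ('a::real_normed_vector) measure \<Rightarrow> 'a measure set" where
  "prob_moment p E = {\<mu> \<in> space (prob_algebra E). integrable \<mu> (\<lambda>x. norm x powr p)}"

definition couplings :: "'a measure \<Rightarrow> 'a measure \<Rightarrow> ('a \<times> 'a) measure set" where
  "couplings \<mu> \<nu> =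
     {\<gamma>. sets \<gamma> = sets (\<mu> \<Otimes>\<^sub>M \<nu>) \<and> distr \<gamma> \<mu> fst = \<mu> \<and> distr \<gamma> \<nu> snd = \<nu>}"

text \<open>
  The distance takes values in the extended reals so that it is infinite, and not zero, if no
  coupling has finite cost. It is finite on \<open>prob_moment p E\<close>.
\<close>

definition wasserstein ::
  "real \<Rightarrow> ('a::metric_space) measure \<Rightarrow> 'a measure \<Rightarrow> ennreal" where
  "wasserstein p \<mu> \<nu> =
     (INF \<gamma>\<in>{\<gamma> \<in> couplings \<mu> \<nu>. integrable \<gamma> (\<lambda>(x, y). dist x y powr p)}.
        ennreal ((\<integral>(x, y). dist x y powr p \<partial>\<gamma>) powr (1 / p)))"

text \<open>The Borel sets of the space of probability measures metrised by the Wasserstein distance.\<close>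

definition wasserstein_open ::
  "real \<Rightarrow> ('a::real_normed_vector) measure \<Rightarrow> 'a measure set \<Rightarrow> bool" where
  "wasserstein_open p E U \<longleftrightarrow> U \<subseteq> prob_moment p E \<and>
     (\<forall>\<mu>\<in>U. \<exists>\<epsilon>>0. \<forall>\<nu>\<in>prob_moment p E. wasserstein p \<mu> \<nu> < ennreal \<epsilon> \<longrightarrow> \<nu> \<in> U)"

definition wasserstein_borel ::
  "real \<Rightarrow> ('a::real_normed_vector) measure \<Rightarrow> 'a measure measure" where
  "wasserstein_borel p E = sigma (prob_moment p E) {U. wasserstein_open p E U}"

definition empirical_measure :: "'a measure \<Rightarrow> nat \<Rightarrow> (nat \<Rightarrow> 'a) \<Rightarrow> 'a measure" where
  "empirical_measure E N y =
     measure_of (space E) (sets E)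
       (\<lambda>A. (\<Sum>i\<in>{1..N}. emeasure (return E (y i)) A) / of_nat N)"


section \<open>Independence and conditional laws\<close>

text \<open>
  The library notion \<open>indep_var\<close> requires both random variables to take values in the same type.
\<close>

definition indep_rv ::
  "'w measure \<Rightarrow> 'a measure \<Rightarrow> ('w \<Rightarrow> 'a) \<Rightarrow> 'b measure \<Rightarrow> ('w \<Rightarrow> 'b) \<Rightarrow> bool" where
  "indep_rv M E X F Y \<longleftrightarrow>
     prob_space.indep_set M (sets (vimage_algebra (space M) X E))
       (sets (vimage_algebra (space M) Y F))"

text \<open>\<open>\<kappa>\<close> is a version of the regular conditional law of \<open>Y\<close> given \<open>B\<close>.\<close>

definition regular_conditional_law ::
  "'w measure \<Rightarrow> 'a measure \<Rightarrow> ('w \<Rightarrow> 'a) \<Rightarrow> 'b measure \<Rightarrow> ('w \<Rightarrow> 'b) \<Rightarrow>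
    ('w \<Rightarrow> 'a measure) \<Rightarrow> bool" where
  "regular_conditional_law M E Y F B \<kappa> \<longleftrightarrow>
     \<kappa> \<in> measurable (vimage_algebra (space M) B F) (prob_algebra E) \<and>
     (\<forall>A\<in>sets E. AE \<omega> in M. measure (\<kappa> \<omega>) A =
        real_cond_exp M (vimage_algebra (space M) B F) (\<lambda>\<omega>. indicator A (Y \<omega>)) \<omega>)"


section \<open>Solutions\<close>

text \<open>
  \<open>x\<close> has drift \<open>v\<close>, initial value \<open>x\<^sub>0\<close> and driving path \<open>w\<close>. The Bochner integral of a
  non-integrable function is \<open>0\<close> by convention, so integrability is required explicitly.
\<close>

definition integral_equation ::
  "real \<Rightarrow> (real \<Rightarrow> real ^ 'd) \<Rightarrow> real ^ 'd \<Rightarrow> ('d::finite) path \<Rightarrow> 'd path \<Rightarrow> bool" where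
  "integral_equation T v x\<^sub>0 w x \<longleftrightarrow>
     set_integrable lborel {0..T} v \<and>
     (\<forall>t\<in>{0..T}. apply_bcontfun x t =
        x\<^sub>0 + (LINT s:{0..t}|lborel. v s) + apply_bcontfun w t)"

text \<open>The process with components \<open>X i\<close>, \<open>1 \<le> i \<le> N\<close>, solves the \<open>N\<close>-particle system.\<close>

definition particle_solution ::
  "'w measure \<Rightarrow> real \<Rightarrow> (real \<Rightarrow> real ^ 'd \<Rightarrow> (real ^ 'd) measure \<Rightarrow> real ^ 'd) \<Rightarrow>
    (nat \<Rightarrow> 'w \<Rightarrow> real ^ 'd) \<Rightarrow> (nat \<Rightarrow> 'w \<Rightarrow> 'd path) \<Rightarrow> ('w \<Rightarrow> 'd path) \<Rightarrow>
    nat \<Rightarrow> (nat \<Rightarrow> 'w \<Rightarrow> ('d::finite) path) \<Rightarrow> bool" where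
  "particle_solution M T b \<zeta> W B N X \<longleftrightarrow>
     (AE \<omega> in M. \<forall>i\<in>{1..N}.
        integral_equation T
          (\<lambda>s. b s (apply_bcontfun (X i \<omega>) s)
             (empirical_measure borel N (\<lambda>j. apply_bcontfun (X j \<omega>) s)))
          (\<zeta> i \<omega>) (W i \<omega> + B \<omega>) (X i \<omega>))"

text \<open>
  \<open>\<kappa>\<close> is meant to be the regular conditional law of the path \<open>X\<close> given \<open>B\<close>; its image under the
  evaluation at time \<open>s\<close> is then a regular conditional law of \<open>X\<^sub>s\<close> given \<open>B\<close>, chosen consistently
  for all \<open>s\<close>.
\<close>

definition mean_field_solution ::
  "'w measure \<Rightarrow> real \<Rightarrow> (real \<Rightarrow> real ^ 'd \<Rightarrow> (real ^ 'd) measure \<Rightarrow> real ^ 'd) \<Rightarrow>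
    ('w \<Rightarrow> real ^ 'd) \<Rightarrow> ('w \<Rightarrow> 'd path) \<Rightarrow> ('w \<Rightarrow> 'd path) \<Rightarrow>
    ('w \<Rightarrow> 'd path measure) \<Rightarrow> ('w \<Rightarrow> ('d::finite) path) \<Rightarrow> bool" where
  "mean_field_solution M T b \<zeta> W B \<kappa> X \<longleftrightarrow>
     (AE \<omega> in M.
        integral_equation T
          (\<lambda>s. b s (apply_bcontfun (X \<omega>) s)
             (distr (\<kappa> \<omega>) borel (\<lambda>f. apply_bcontfun f s)))
          (\<zeta> \<omega>) (W \<omega> + B \<omega>) (X \<omega>))"

end

theory Submission
  imports Defs
begin

text \<open>
  The initial value is absorbed into the driving path: with \<open>y = \<zeta> + W + B\<close> both equations read
  \<open>x = y + \<integral> b(s, x\<^sub>s, \<mu>\<^sub>s) ds\<close>. For every law \<open>m\<close> on path space with finite \<open>p\<close>-th moment, Picard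
  iteration gives a Lipschitz map \<open>X\<^sub>m\<close> on paths that solves this equation for every \<open>y\<close>, with \<open>\<mu>\<close>
  the flow of marginals of the image of \<open>m\<close> under \<open>X\<^sub>m\<close>. The particle system is the case where \<open>m\<close> is
  the empirical measure of the driving paths. The mean field equation is the case where \<open>m\<close> is the
  law of \<open>\<zeta> + W + \<beta>\<close>, evaluated at \<open>\<beta> = B\<close>. By a Gronwall argument, a coupling of two driving laws
  of cost \<open>c\<close> yields a coupling of the solution laws of cost at most a constant times \<open>c\<close>, which
  also gives the measurability of the solutions in their data. As a common translation by \<open>\<beta>\<close> does
  not change the cost, convergence reduces to the law of large numbers in Wasserstein distance for
  the i.i.d. paths \<open>\<zeta>\<^sup>i + W\<^sup>i\<close>.
\<close>

section \<open>Path space: separability and measurability\<close>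

text \<open>The unknown of the fixed-point problem is a map on paths and not a process. Its
  Lipschitz constant \<open>exp (L * T)\<close> does not depend on the driving law, because two
  driving paths see the same flow of marginals; this constant supplies measurability, moments and
  integrability of the drift at once. Random variables enter only by substitution into this
  deterministic map. In particular the conditional law given \<open>B\<close> is explicit:
  \<open>B\<close> is independent of \<open>\<zeta>bar\<close> and \<open>Wbar\<close> jointly, so
  it may be frozen at \<open>\<beta>\<close>.

  Suprema are weighted by exponentials, which gives contractions over all of \<open>[0,T]\<close> at
  once. The law of large numbers rests on explicit couplings: finitely many small cells, whose
  masses converge by Hoeffding's inequality, and a tail controlled through \<open>p < p'\<close>.
  Its result is kept as a coupling and not as a distance, since a coupling of driving laws is itself
  the probability space on which the two solutions are compared.\<close>

lemma space_path_borel [simp]: "space (path_borel T) = path_space T"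
  by (simp add: path_borel_def space_restrict_space)

lemma path_spaceI:
  assumes "\<And>t. apply_bcontfun f t = apply_bcontfun f (max 0 (min T t))"
  shows "f \<in> path_space T"
  using assms by (auto simp: path_space_def)

lemma path_space_clamp:
  "f \<in> path_space T \<Longrightarrow> apply_bcontfun f t = apply_bcontfun f (max 0 (min T t))"
  unfolding path_space_def by blast

lemma const_bcontfun_in_path_space [simp]: "const_bcontfun c \<in> path_space T"
  by (rule path_spaceI) (simp add: const_bcontfun.rep_eq)

lemma zero_in_path_space [simp]: "0 \<in> path_space T"
  by (rule path_spaceI) simp

lemma add_in_path_space [intro, simp]:
  "f \<in> path_space T \<Longrightarrow> g \<in> path_space T \<Longrightarrow> f + g \<in> path_space T"
  using path_space_clamp[of f T] path_space_clamp[of g T]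
  by (intro path_spaceI) (auto simp: plus_bcontfun.rep_eq)

text \<open>Uniform convergence is in particular pointwise, and the clamping identity is pointwise.
  Closedness keeps the Picard limit, which exists in the ambient complete space of bounded
  continuous functions, among the paths.\<close>

lemma closed_path_space: "closed (path_space T :: ('d::finite) path set)"
proof (unfold closed_sequential_limits, intro allI impI, elim conjE)
  fix x :: "nat \<Rightarrow> 'd path" and l
  assume x: "\<forall>n. x n \<in> path_space T" "x \<longlonglongrightarrow> l"
  have *: "(\<lambda>n. apply_bcontfun (x n) t) \<longlonglongrightarrow> apply_bcontfun l t" for t
    by (rule metric_tendsto_imp_tendsto[OF x(2)]) (simp add: dist_bounded)
  show "l \<in> path_space T"
  proof (rule path_spaceI)
    fix t
    have "(\<lambda>n. apply_bcontfun (x n) (max 0 (min T t))) \<longlonglongrightarrow> apply_bcontfun l (max 0 (min T t))"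
      using *[of "max 0 (min T t)"] .
    moreover have "(\<lambda>n. apply_bcontfun (x n) t) = (\<lambda>n. apply_bcontfun (x n) (max 0 (min T t)))"
      by (rule ext) (rule path_space_clamp, use x(1) in blast)
    ultimately show "apply_bcontfun l t = apply_bcontfun l (max 0 (min T t))"
      using *[of t] LIMSEQ_unique by metis
  qed
qed

text \<open>A path is frozen outside \<open>[0,T]\<close>, so a bound on \<open>[0,T]\<close> is a
  bound in the ambient norm. The supremum estimates below end with this lemma.\<close>

lemma dist_path_le:
  assumes "T > 0" "f \<in> path_space T" "g \<in> path_space T"
    and "\<And>t. t \<in> {0..T} \<Longrightarrow> norm (apply_bcontfun f t - apply_bcontfun g t) \<le> c"
  shows "dist f g \<le> c"
proof (rule dist_bound)
  fix t
  have "max 0 (min T t) \<in> {0..T}" using assms(1) by auto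
  then show "dist (apply_bcontfun f t) (apply_bcontfun g t) \<le> c"
    using assms(4) path_space_clamp[OF assms(2)] path_space_clamp[OF assms(3)]
    by (metis dist_norm)
qed

lemma norm_diff_apply_le:
  fixes f g :: "('d::finite) path"
  shows "norm (apply_bcontfun f t - apply_bcontfun g t) \<le> dist f g"
  by (metis dist_norm dist_bounded)

lemma norm_apply_le: "norm (apply_bcontfun f t) \<le> norm (f :: ('d::finite) path)"
  by (rule norm_bounded)

text \<open>
  A path is determined up to a small error by a step function with values in a countable dense set;
  choosing one path for each admissible step function gives a countable dense set of paths.
\<close>

lemma path_space_separable:
  assumes T: "T > 0"
  obtains D :: "('d::finite) path set"
  where "countable D" "D \<subseteq> path_space T"
    "\<And>f e. f \<in> path_space T \<Longrightarrow> e > 0 \<Longrightarrow> \<exists>d\<in>D. dist d f < e"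
proof -
  obtain Q :: "(real ^ 'd) set" where Q: "countable Q" "\<And>X. open X \<Longrightarrow> X \<noteq> {} \<Longrightarrow> \<exists>q\<in>Q. q \<in> X"
    using countable_dense_setE by metis
  define P where "P = (\<lambda>(n::nat, k::nat, qs) (g::'d path). g \<in> path_space T \<and>
    (\<forall>i<n. \<forall>t. t \<in> {T * real i / real n .. T * real (Suc i) / real n} \<longrightarrow>
      dist (apply_bcontfun g t) (qs ! i) \<le> 1 / real (Suc k)))"
  define I where "I = {a \<in> UNIV \<times> UNIV \<times> lists Q. \<exists>g. P a g}"
  define D where "D = (\<lambda>a. SOME g. P a g) ` I"
  have sel: "P a (SOME g. P a g)" if "a \<in> I" for a
    using that someI_ex[of "P a"] by (auto simp: I_def)
  have "countable I"
    unfolding I_def by (rule countable_subset[of _ "UNIV \<times> UNIV \<times> lists Q"])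
      (auto intro!: countable_SIGMA countable_lists Q)
  then have 1: "countable D" by (simp add: D_def)
  have 2: "D \<subseteq> path_space T"
    using sel by (auto simp: D_def P_def split: prod.splits)
  have 3: "\<exists>d\<in>D. dist d f < e" if f: "f \<in> path_space T" and e: "e > 0" for f :: "'d path" and e
  proof -
    obtain k where k: "2 / real (Suc k) < e"
    proof -
      obtain k where "inverse (real (Suc k)) < e / 2"
        using reals_Archimedean[of "e/2"] e by auto
      then have "2 / real (Suc k) < e" by (simp add: field_simps)
      then show thesis by (rule that)
    qed
    \<comment> \<open>Half of \<open>1 / real (Suc k)\<close>: one half for the oscillation of
      \<open>f\<close> on a subinterval, the other for replacing its value at the left end by an
      element of \<open>Q\<close>.\<close>
    define r where "r = 1 / (2 * real (Suc k))"
    have r: "r > 0" by (simp add: r_def)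
    have "uniformly_continuous_on {0..T} (apply_bcontfun f)"
      by (intro compact_uniformly_continuous continuous_intros) auto
    then obtain \<delta> where \<delta>: "\<delta> > 0" "\<And>s t. s \<in> {0..T} \<Longrightarrow> t \<in> {0..T} \<Longrightarrow> dist s t < \<delta> \<Longrightarrow>
        dist (apply_bcontfun f s) (apply_bcontfun f t) < r"
      using r unfolding uniformly_continuous_on_def by metis
    obtain n where n: "T / \<delta> < real n" using reals_Archimedean2 by blast
    have n0: "n > 0" using n T \<delta>(1) by (metis divide_pos_pos gr0I of_nat_0 order.asym)
    have step: "T / real n < \<delta>" using n n0 \<delta>(1) by (simp add: field_simps)
    have "\<exists>q\<in>Q. q \<in> ball (apply_bcontfun f (T * real i / real n)) r" for i
      using r by (intro Q(2)) auto
    then obtain q where q: "\<And>i. q i \<in> Q"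
        "\<And>i. dist (apply_bcontfun f (T * real i / real n)) (q i) < r"
      unfolding mem_ball by metis
    let ?a = "(n, k, map q [0..<n])"
    have "P ?a f"
      unfolding P_def prod.case
    proof (intro conjI allI impI f)
      fix i t assume i: "i < n" and t: "t \<in> {T * real i / real n .. T * real (Suc i) / real n}"
      have le: "T * real (Suc i) / real n \<le> T"
        using mult_left_mono[of "real (Suc i)" "real n" T] i n0 T by (simp add: divide_le_eq)
      have ge: "0 \<le> T * real i / real n" using T by simp
      have "T * real (Suc i) / real n - T * real i / real n = T / real n"
        by (simp add: distrib_left add_divide_distrib)
      then have "dist (T * real i / real n) t < \<delta>" using t step by (auto simp: dist_real_def)
      then have "dist (apply_bcontfun f (T * real i / real n)) (apply_bcontfun f t) < r"
        using t le ge by (intro \<delta>(2)) auto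
      then have "dist (apply_bcontfun f t) (q i) < r + r"
        using q(2)[of i] dist_triangle[of "apply_bcontfun f t" "q i" "apply_bcontfun f (T * real i / real n)"]
        by (simp add: dist_commute)
      also have "r + r = 1 / real (Suc k)" by (simp add: r_def field_simps)
      finally show "dist (apply_bcontfun f t) (map q [0..<n] ! i) \<le> 1 / real (Suc k)"
        using i by simp
    qed
    then have aI: "?a \<in> I" using q(1) by (auto simp: I_def)
    define d where "d = (SOME g. P ?a g)"
    have d: "P ?a d" "d \<in> D" using sel[OF aI] aI by (auto simp: d_def D_def)
    have dS: "d \<in> path_space T" using d 2 by auto
    have "dist d f \<le> 2 / real (Suc k)"
    proof (rule dist_path_le[OF T dS f])
      fix t assume t: "t \<in> {0..T}"
      \<comment> \<open>The floor of \<open>t * real n / T\<close> is the index sought except at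
        \<open>t = T\<close>, where it would be \<open>n\<close>; the last closed subinterval
        contains that point.\<close>
      obtain i where i: "i < n" "t \<in> {T * real i / real n .. T * real (Suc i) / real n}"
      proof (cases "t = T")
        case True
        then show thesis using n0 T by (intro that[of "n - 1"]) (auto simp: field_simps of_nat_diff)
      next
        case False
        define i where "i = nat \<lfloor>t * real n / T\<rfloor>"
        have x: "0 \<le> t * real n / T" "t * real n / T < real n" using t False T n0
          by (auto simp: field_simps)
        have "real i \<le> t * real n / T" "t * real n / T < real i + 1" "i < n"
          using x unfolding i_def by linarith+
        then show thesis using T n0 by (intro that[of i]) (auto simp: field_simps)
      qed
      have a: "dist (apply_bcontfun d t) (map q [0..<n] ! i) \<le> 1 / real (Suc k)"
          "dist (apply_bcontfun f t) (map q [0..<n] ! i) \<le> 1 / real (Suc k)"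
        using d(1) \<open>P ?a f\<close> i unfolding P_def prod.case by blast+
      have "dist (apply_bcontfun d t) (apply_bcontfun f t) \<le> 1 / real (Suc k) + 1 / real (Suc k)"
        using add_mono[OF a] by (rule order_trans[OF dist_triangle2])
      then show "norm (apply_bcontfun d t - apply_bcontfun f t) \<le> 2 / real (Suc k)"
        by (simp add: dist_norm)
    qed
    with k d(2) show ?thesis by (intro bexI[of _ d]) auto
  qed
  show thesis by (rule that[OF 1 2 3])
qed

text \<open>Choose the first element of an enumeration of \<open>D\<close> at distance less than
  \<open>e\<close>; its index is measurable because each comparison is. The point of the discrete
  target space is that every function of \<open>Z\<close>, continuous or not, is then
  measurable.\<close>

lemma measurable_dense_approx:
  fixes Y :: "'w \<Rightarrow> 'a::metric_space"
  assumes D: "countable D" "D \<subseteq> S" "\<And>y e. y \<in> S \<Longrightarrow> e > 0 \<Longrightarrow> \<exists>d\<in>D. dist d y < e"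
    and Y: "Y \<in> measurable M (restrict_space borel S)" and e: "e > 0"
  obtains Z where "Z \<in> measurable M (count_space D)" "\<And>\<omega>. \<omega> \<in> space M \<Longrightarrow> dist (Z \<omega>) (Y \<omega>) < e"
proof (cases "space M = {}")
  case True
  then show thesis by (intro that[of undefined]) (auto simp: measurable_def)
next
  case False
  have YS: "Y \<omega> \<in> S" if "\<omega> \<in> space M" for \<omega>
    using measurable_space[OF Y that] by (simp add: space_restrict_space)
  have Y'[measurable]: "Y \<in> borel_measurable M"
    using Y by (simp add: measurable_restrict_space2_iff)
  have "D \<noteq> {}" using D(3)[OF YS e] False by auto
  then have rng: "range (from_nat_into D) = D" using D(1) by (rule range_from_nat_into)
  define k where "k \<omega> = (LEAST n. dist (from_nat_into D n) (Y \<omega>) < e)" for \<omega>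
  have k: "dist (from_nat_into D (k \<omega>)) (Y \<omega>) < e" if "\<omega> \<in> space M" for \<omega>
  proof -
    have "\<exists>n. dist (from_nat_into D n) (Y \<omega>) < e"
      using D(3)[OF YS[OF that] e] rng by (metis imageE)
    then show ?thesis unfolding k_def by (rule LeastI_ex)
  qed
  have k_meas [measurable]: "k \<in> measurable M (count_space UNIV)"
    unfolding k_def
  proof (rule measurable_Least)
    fix i show "Measurable.pred M (\<lambda>\<omega>. dist (from_nat_into D i) (Y \<omega>) < e)"
      unfolding pred_def using measurable_compose[OF Y', of "\<lambda>y. dist (from_nat_into D i) y" borel]
      by (measurable, auto intro!: borel_measurable_continuous_onI continuous_intros)
  qed
  have "from_nat_into D \<in> measurable (count_space UNIV) (count_space D)"
    using rng by (auto simp: measurable_count_space_eq1)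
  from measurable_compose[OF k_meas this] k show thesis
    by (intro that[of "\<lambda>\<omega>. from_nat_into D (k \<omega>)"]) auto
qed

text \<open>
  Path spaces sit in a nonseparable type, so the library results on the Borel sets of products of
  second countable spaces do not apply; functions of countably-valued approximations do the job.
\<close>

lemma borel_measurable_seq_continuous_family:
  fixes Y :: "'i \<Rightarrow> 'w \<Rightarrow> 'a::metric_space" and f :: "('i \<Rightarrow> 'a) \<Rightarrow> 'c::metric_space"
  assumes D: "countable D" "D \<subseteq> S" "\<And>y e. y \<in> S \<Longrightarrow> e > 0 \<Longrightarrow> \<exists>d\<in>D. dist d y < e"
    and I: "finite I" and Y: "\<And>i. i \<in> I \<Longrightarrow> Y i \<in> measurable M (restrict_space borel S)"
    and f: "\<And>u y. (\<And>n i. i \<in> I \<Longrightarrow> u n i \<in> S) \<Longrightarrow> (\<And>i. i \<in> I \<Longrightarrow> y i \<in> S) \<Longrightarrow>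
      (\<And>i. i \<in> I \<Longrightarrow> (\<lambda>n. u n i) \<longlonglongrightarrow> y i) \<Longrightarrow> (\<lambda>n. f (u n)) \<longlonglongrightarrow> f y"
  shows "(\<lambda>\<omega>. f (\<lambda>i. Y i \<omega>)) \<in> borel_measurable M"
proof -
  have "\<exists>Z. Z \<in> measurable M (count_space D) \<and> (\<forall>\<omega>\<in>space M. dist (Z \<omega>) (Y i \<omega>) < 1 / real (Suc n))"
    if "i \<in> I" for i n
    by (rule measurable_dense_approx[OF D Y[OF that], of "1 / real (Suc n)"]) auto
  then obtain Z where Z: "\<And>i n. i \<in> I \<Longrightarrow> Z i n \<in> measurable M (count_space D)"
    "\<And>i n \<omega>. i \<in> I \<Longrightarrow> \<omega> \<in> space M \<Longrightarrow> dist (Z i n \<omega>) (Y i \<omega>) < 1 / real (Suc n)"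
    by metis
  have ZD: "Z i n \<omega> \<in> D" if "i \<in> I" "\<omega> \<in> space M" for i n \<omega>
    using measurable_space[OF Z(1)[OF that(1)] that(2)] by simp
  have YS: "Y i \<omega> \<in> S" if "i \<in> I" "\<omega> \<in> space M" for i \<omega>
    using measurable_space[OF Y[OF that(1)] that(2)] by (simp add: space_restrict_space)
  have cnt: "countable (PiE I (\<lambda>_. D))" using I D(1) by (intro countable_PiE) auto
  show ?thesis
  proof (rule borel_measurable_LIMSEQ_metric)
    fix n
    \<comment> \<open>A finite tuple of countably-valued maps is countably-valued. Hence it is
      measurable into a discrete space, on which every function is measurable.\<close>
    have "(\<lambda>\<omega>. \<lambda>i\<in>I. Z i n \<omega>) \<in> measurable M (count_space (PiE I (\<lambda>_. D)))"
    proof (rule measurable_count_space_eq_countable[OF cnt, THEN iffD2], intro conjI ballI)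
      show "(\<lambda>\<omega>. \<lambda>i\<in>I. Z i n \<omega>) \<in> space M \<rightarrow> PiE I (\<lambda>_. D)" using ZD by auto
      fix a assume a: "a \<in> PiE I (\<lambda>_. D)"
      have "(\<lambda>\<omega>. \<lambda>i\<in>I. Z i n \<omega>) -` {a} \<inter> space M = {\<omega>\<in>space M. \<forall>i\<in>I. Z i n \<omega> = a i}"
        using a by (auto simp: fun_eq_iff PiE_def extensional_def)
      also have "\<dots> \<in> sets M"
      proof (intro sets.sets_Collect_finite_All I)
        fix i assume i: "i \<in> I"
        have "Z i n -` {a i} \<inter> space M \<in> sets M"
          using a i by (intro measurable_sets[OF Z(1)]) auto
        also have "Z i n -` {a i} \<inter> space M = {\<omega>\<in>space M. Z i n \<omega> = a i}" by auto
        finally show "{\<omega>\<in>space M. Z i n \<omega> = a i} \<in> sets M" .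
      qed
      finally show "(\<lambda>\<omega>. \<lambda>i\<in>I. Z i n \<omega>) -` {a} \<inter> space M \<in> sets M" .
    qed
    then show "(\<lambda>\<omega>. f (\<lambda>i\<in>I. Z i n \<omega>)) \<in> borel_measurable M"
      by (rule measurable_compose) simp
  next
    fix \<omega> assume \<omega>: "\<omega> \<in> space M"
    show "(\<lambda>n. f (\<lambda>i\<in>I. Z i n \<omega>)) \<longlonglongrightarrow> f (\<lambda>i. Y i \<omega>)"
    proof (rule f)
      fix i assume i: "i \<in> I"
      have "(\<lambda>n. dist (Z i n \<omega>) (Y i \<omega>)) \<longlonglongrightarrow> 0"
      proof (rule Lim_null_comparison[OF always_eventually lim_inverse_n'[THEN LIMSEQ_Suc]], rule allI)
        fix n show "norm (dist (Z i n \<omega>) (Y i \<omega>)) \<le> 1 / real (Suc n)"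
          using Z(2)[OF i \<omega>, of n] by simp
      qed
      then show "(\<lambda>n. (\<lambda>i\<in>I. Z i n \<omega>) i) \<longlonglongrightarrow> Y i \<omega>"
        using i by (simp add: tendsto_dist_iff[symmetric])
    qed (use ZD YS \<omega> D(2) in auto)
  qed
qed

lemma measurable_path_seq_continuous_family:
  fixes Y :: "'i \<Rightarrow> 'w \<Rightarrow> ('d::finite) path" and f :: "('i \<Rightarrow> 'd path) \<Rightarrow> 'c::metric_space"
  assumes "T > 0" "finite I" "\<And>i. i \<in> I \<Longrightarrow> Y i \<in> measurable M (path_borel T)"
    and "\<And>u y. (\<And>n i. i \<in> I \<Longrightarrow> u n i \<in> path_space T) \<Longrightarrow> (\<And>i. i \<in> I \<Longrightarrow> y i \<in> path_space T) \<Longrightarrow>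
      (\<And>i. i \<in> I \<Longrightarrow> (\<lambda>n. u n i) \<longlonglongrightarrow> y i) \<Longrightarrow> (\<lambda>n. f (u n)) \<longlonglongrightarrow> f y"
  shows "(\<lambda>\<omega>. f (\<lambda>i. Y i \<omega>)) \<in> borel_measurable M"
proof -
  obtain D :: "'d path set" where D: "countable D" "D \<subseteq> path_space T"
    "\<And>f e. f \<in> path_space T \<Longrightarrow> e > 0 \<Longrightarrow> \<exists>d\<in>D. dist d f < e"
    using path_space_separable[OF assms(1)] by metis
  show ?thesis
    by (rule borel_measurable_seq_continuous_family[OF D assms(2)])
      (use assms(3,4) in \<open>auto simp: path_borel_def\<close>)
qed

lemma measurable_path_borelI:
  assumes "f \<in> borel_measurable M" "\<And>\<omega>. \<omega> \<in> space M \<Longrightarrow> f \<omega> \<in> path_space T"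
  shows "f \<in> measurable M (path_borel T)"
  using assms by (auto simp: path_borel_def intro!: measurable_restrict_space2)

lemma measurable_path_borelD:
  "f \<in> measurable M (path_borel T) \<Longrightarrow> f \<in> borel_measurable M"
  by (simp add: path_borel_def measurable_restrict_space2_iff)

lemma measurable_path_add:
  fixes f g :: "'w \<Rightarrow> ('d::finite) path"
  assumes T: "T > 0" and f: "f \<in> measurable M (path_borel T)" and g: "g \<in> measurable M (path_borel T)"
  shows "(\<lambda>\<omega>. f \<omega> + g \<omega>) \<in> measurable M (path_borel T)"
proof (rule measurable_path_borelI)
  have "(\<lambda>\<omega>. (\<lambda>h. h True + h False) (\<lambda>i. (if i then f else g) \<omega>)) \<in> borel_measurable M"
    by (rule measurable_path_seq_continuous_family[OF T, where I = UNIV])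
      (use f g in \<open>auto intro!: tendsto_add\<close>)
  then show "(\<lambda>\<omega>. f \<omega> + g \<omega>) \<in> borel_measurable M" by simp
next
  fix \<omega> assume "\<omega> \<in> space M"
  then show "f \<omega> + g \<omega> \<in> path_space T"
    using measurable_space[OF f] measurable_space[OF g] by simp
qed

lemma measurable_path_dist:
  fixes f g :: "'w \<Rightarrow> ('d::finite) path"
  assumes T: "T > 0" and f: "f \<in> measurable M (path_borel T)" and g: "g \<in> measurable M (path_borel T)"
  shows "(\<lambda>\<omega>. dist (f \<omega>) (g \<omega>)) \<in> borel_measurable M"
proof -
  have "(\<lambda>\<omega>. (\<lambda>h. dist (h True) (h False)) (\<lambda>i. (if i then f else g) \<omega>)) \<in> borel_measurable M"
    by (rule measurable_path_seq_continuous_family[OF T, where I = UNIV])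
      (use f g in \<open>auto intro!: tendsto_dist\<close>)
  then show ?thesis by simp
qed

lemma measurable_path_norm:
  assumes "f \<in> measurable M (path_borel T)"
  shows "(\<lambda>\<omega>. norm (f \<omega> :: ('d::finite) path)) \<in> borel_measurable M"
  using measurable_path_borelD[OF assms] by measurable

lemma measurable_path_continuous:
  fixes f :: "('d::finite) path \<Rightarrow> 'c::topological_space"
  assumes "continuous_on (path_space T) f"
  shows "f \<in> borel_measurable (path_borel T)"
  unfolding path_borel_def by (rule borel_measurable_continuous_on_restrict[OF assms])

lemma measurable_path_apply:
  "(\<lambda>f. apply_bcontfun f t) \<in> borel_measurable (path_borel T :: ('d::finite) path measure)"
proof (rule measurable_path_continuous, unfold continuous_on_iff, intro ballI allI impI)
  fix f :: "'d path" and e :: real assume "e > 0"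
  then show "\<exists>d>0. \<forall>g\<in>path_space T. dist g f < d \<longrightarrow> dist (apply_bcontfun g t) (apply_bcontfun f t) < e"
    by (intro exI[of _ e]) (auto intro: le_less_trans[OF dist_bounded])
qed

section \<open>Powers and integrability of \<open>p\<close>-th moments\<close>

lemma powr_add_le:
  fixes a b p :: real
  assumes "0 \<le> a" "0 \<le> b" "0 \<le> p"
  shows "(a + b) powr p \<le> 2 powr p * (a powr p + b powr p)"
proof -
  have "(a + b) powr p \<le> (2 * max a b) powr p" using assms by (intro powr_mono2) auto
  also have "\<dots> = 2 powr p * max a b powr p" using assms by (simp add: powr_mult)
  also have "max a b powr p \<le> a powr p + b powr p" by (simp add: max_def)
  finally show ?thesis by simp
qed

lemma powr_le_one_plus_powr:
  fixes a :: real
  assumes "0 \<le> a" "0 \<le> q" "q \<le> q'"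
  shows "a powr q \<le> 1 + a powr q'"
proof (cases "a \<le> 1")
  case True
  then have "a powr q \<le> 1 powr q" using assms by (intro powr_mono2) auto
  then show ?thesis by (simp add: add_increasing2)
next
  case False
  then have "a powr q \<le> a powr q'" using assms(3) by (intro powr_mono) auto
  then show ?thesis by linarith
qed

lemma le_powr_inverseI:
  fixes a b p :: real
  assumes "0 \<le> a" "a powr p \<le> b" "0 < p"
  shows "a \<le> b powr (1 / p)"
proof -
  have "(a powr p) powr (1 / p) \<le> b powr (1 / p)" using assms by (intro powr_mono2) auto
  then show ?thesis using assms by (simp add: powr_powr)
qed

lemma powr_inverse_le:
  fixes a b p :: real
  assumes "0 \<le> a" "0 \<le> b" "a \<le> b powr p" "0 < p"
  shows "a powr (1 / p) \<le> b"
proof -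
  have "a powr (1 / p) \<le> (b powr p) powr (1 / p)" using assms by (intro powr_mono2) auto
  then show ?thesis using assms by (simp add: powr_powr)
qed

lemma Lq_space_lower:
  assumes X: "X \<in> Lq_space M q' E" and norm: "norm \<in> borel_measurable E"
    and q: "0 \<le> q" "q \<le> q'" and M: "finite_measure M"
  shows "X \<in> Lq_space M q E"
proof -
  interpret finite_measure M by fact
  have meas: "X \<in> measurable M E" using X by (simp add: Lq_space_def)
  have "integrable M (\<lambda>\<omega>. 1 + norm (X \<omega>) powr q')" using X by (auto simp: Lq_space_def)
  then have "integrable M (\<lambda>\<omega>. norm (X \<omega>) powr q)"
    by (rule Bochner_Integration.integrable_bound)
      (use powr_le_one_plus_powr[OF norm_ge_zero q] measurable_compose[OF meas norm] in auto)
  with meas show ?thesis by (simp add: Lq_space_def)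
qed

lemma integrable_powr_le:
  fixes f g :: "'w \<Rightarrow> real"
  assumes "integrable M (\<lambda>\<omega>. g \<omega> powr p)" "f \<in> borel_measurable M" "0 \<le> p"
    and "\<And>\<omega>. \<omega> \<in> space M \<Longrightarrow> 0 \<le> f \<omega>" "\<And>\<omega>. \<omega> \<in> space M \<Longrightarrow> f \<omega> \<le> g \<omega>"
  shows "integrable M (\<lambda>\<omega>. f \<omega> powr p)"
  by (rule Bochner_Integration.integrable_bound[OF assms(1)])
    (use assms(2-) in \<open>auto intro!: AE_I2 powr_mono2\<close>)

lemma integrable_powr_add:
  fixes f g :: "'w \<Rightarrow> real"
  assumes "integrable M (\<lambda>\<omega>. f \<omega> powr p)" "integrable M (\<lambda>\<omega>. g \<omega> powr p)"
    and "f \<in> borel_measurable M" "g \<in> borel_measurable M" "0 \<le> p"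
    and "\<And>\<omega>. \<omega> \<in> space M \<Longrightarrow> 0 \<le> f \<omega>" "\<And>\<omega>. \<omega> \<in> space M \<Longrightarrow> 0 \<le> g \<omega>"
  shows "integrable M (\<lambda>\<omega>. (f \<omega> + g \<omega>) powr p)"
proof (rule Bochner_Integration.integrable_bound)
  show "integrable M (\<lambda>\<omega>. 2 powr p * (f \<omega> powr p + g \<omega> powr p))"
    using assms(1,2) by auto
  show "AE \<omega> in M. norm ((f \<omega> + g \<omega>) powr p) \<le> norm (2 powr p * (f \<omega> powr p + g \<omega> powr p))"
    using powr_add_le assms(5-) by (intro AE_I2) auto
qed (use assms(3,4) in measurable)

lemma integrable_cmult_powr:
  fixes f :: "'w \<Rightarrow> real"
  assumes "integrable M (\<lambda>\<omega>. f \<omega> powr p)" "0 \<le> c" "\<And>\<omega>. \<omega> \<in> space M \<Longrightarrow> 0 \<le> f \<omega>"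
  shows "integrable M (\<lambda>\<omega>. (c * f \<omega>) powr p)"
proof -
  have "integrable M (\<lambda>\<omega>. c powr p * f \<omega> powr p)" using assms(1) by simp
  moreover have "(c * f \<omega>) powr p = c powr p * f \<omega> powr p" if "\<omega> \<in> space M" for \<omega>
    using assms(2,3) that by (simp add: powr_mult)
  ultimately show ?thesis by (simp cong: Bochner_Integration.integrable_cong)
qed

section \<open>Wasserstein distance of two laws on a common probability space\<close>

text \<open>The joint law of \<open>f\<close> and \<open>g\<close> is one of the couplings, so its
  cost bounds the infimum. Later upper bounds on Wasserstein distances are obtained by realising
  both laws on one space \<open>\<Gamma>\<close>.\<close>

lemma wasserstein_distr_le:
  assumes f: "f \<in> measurable \<Gamma> E" and g: "g \<in> measurable \<Gamma> E"
    and d: "(\<lambda>(x, y). dist x y) \<in> borel_measurable (E \<Otimes>\<^sub>M E)"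
    and int: "integrable \<Gamma> (\<lambda>\<omega>. dist (f \<omega>) (g \<omega>) powr p)"
  shows "wasserstein p (distr \<Gamma> E f) (distr \<Gamma> E g)
    \<le> ennreal ((\<integral>\<omega>. dist (f \<omega>) (g \<omega>) powr p \<partial>\<Gamma>) powr (1 / p))"
proof -
  have fg: "(\<lambda>\<omega>. (f \<omega>, g \<omega>)) \<in> measurable \<Gamma> (E \<Otimes>\<^sub>M E)" using f g by measurable
  have "(\<lambda>z. (case z of (x, y) \<Rightarrow> dist x y) powr p) \<in> borel_measurable (E \<Otimes>\<^sub>M E)"
    using d by measurable
  then have dp: "(\<lambda>(x, y). dist x y powr p) \<in> borel_measurable (E \<Otimes>\<^sub>M E)"
    by (simp add: case_prod_beta')
  let ?\<gamma> = "distr \<Gamma> (E \<Otimes>\<^sub>M E) (\<lambda>\<omega>. (f \<omega>, g \<omega>))"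
  \<comment> \<open>\<open>couplings\<close> pushes forward onto the marginal itself instead of onto
    \<open>E\<close>; only the sets of the target matter, so the two agree.\<close>
  have "distr ?\<gamma> (distr \<Gamma> E f) fst = distr ?\<gamma> E fst" by (rule distr_cong) auto
  also have "\<dots> = distr \<Gamma> E f" by (subst distr_distr[OF _ fg]) (auto simp: comp_def)
  finally have 1: "distr ?\<gamma> (distr \<Gamma> E f) fst = distr \<Gamma> E f" .
  have "distr ?\<gamma> (distr \<Gamma> E g) snd = distr ?\<gamma> E snd" by (rule distr_cong) auto
  also have "\<dots> = distr \<Gamma> E g" by (subst distr_distr[OF _ fg]) (auto simp: comp_def)
  finally have 2: "distr ?\<gamma> (distr \<Gamma> E g) snd = distr \<Gamma> E g" .
  have "sets ?\<gamma> = sets (distr \<Gamma> E f \<Otimes>\<^sub>M distr \<Gamma> E g)"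
    by simp
  with 1 2 have mem: "?\<gamma> \<in> couplings (distr \<Gamma> E f) (distr \<Gamma> E g)" by (simp add: couplings_def)
  have "integrable ?\<gamma> (\<lambda>(x, y). dist x y powr p)"
    using int by (subst integrable_distr_eq[OF fg dp]) simp
  moreover have "(\<integral>(x, y). dist x y powr p \<partial>?\<gamma>) = (\<integral>\<omega>. dist (f \<omega>) (g \<omega>) powr p \<partial>\<Gamma>)"
    by (subst integral_distr[OF fg dp]) simp
  ultimately show ?thesis
    unfolding wasserstein_def using mem by (intro INF_lower2[of ?\<gamma>]) auto
qed

lemma enn2real_wasserstein_distr_le:
  assumes "f \<in> measurable \<Gamma> E" "g \<in> measurable \<Gamma> E"
    and "(\<lambda>(x, y). dist x y) \<in> borel_measurable (E \<Otimes>\<^sub>M E)"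
    and "integrable \<Gamma> (\<lambda>\<omega>. dist (f \<omega>) (g \<omega>) powr p)"
  shows "enn2real (wasserstein p (distr \<Gamma> E f) (distr \<Gamma> E g))
    \<le> (\<integral>\<omega>. dist (f \<omega>) (g \<omega>) powr p \<partial>\<Gamma>) powr (1 / p)"
  using enn2real_mono[OF wasserstein_distr_le[OF assms]] by simp

lemma dist_measurable_euclidean:
  "(\<lambda>(x, y). dist x y) \<in> borel_measurable (borel \<Otimes>\<^sub>M (borel :: 'a::euclidean_space measure))"
  by measurable

lemma dist_measurable_path:
  assumes "T > 0"
  shows "(\<lambda>(x, y). dist x y) \<in> borel_measurable (path_borel T \<Otimes>\<^sub>M (path_borel T :: ('d::finite) path measure))"
  unfolding case_prod_beta' by (rule measurable_path_dist[OF assms]) auto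

lemma distr_in_prob_moment:
  assumes \<Gamma>: "prob_space \<Gamma>" and f: "f \<in> measurable \<Gamma> E" and n: "norm \<in> borel_measurable E"
    and int: "integrable \<Gamma> (\<lambda>\<omega>. norm (f \<omega>) powr p)"
  shows "distr \<Gamma> E f \<in> prob_moment p E"
proof -
  have "(\<lambda>x. norm x powr p) \<in> borel_measurable E" using n by measurable
  then show ?thesis
    using prob_space.prob_space_distr[OF \<Gamma> f] int
    by (simp add: prob_moment_def space_prob_algebra integrable_distr_eq[OF f])
qed

text \<open>On the real line sequential continuity is enough for preimages of
  \<open>wasserstein_open\<close> sets to be open. The proof works directly with the neighbourhoods
  in the definition of these sets.\<close>

lemma measurable_wasserstein_borelI:
  fixes g :: "real \<Rightarrow> ('a::real_normed_vector) measure"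
  assumes mem: "\<And>s. g s \<in> prob_moment p E"
    and cont: "\<And>s u. u \<longlonglongrightarrow> s \<Longrightarrow> (\<lambda>n. wasserstein p (g s) (g (u n))) \<longlonglongrightarrow> 0"
  shows "g \<in> measurable borel (wasserstein_borel p E)"
  unfolding wasserstein_borel_def
proof (rule measurable_measure_of)
  show "{U. wasserstein_open p E U} \<subseteq> Pow (prob_moment p E)"
    by (auto simp: wasserstein_open_def)
  show "g \<in> space borel \<rightarrow> prob_moment p E" using mem by auto
  fix U assume "U \<in> {U. wasserstein_open p E U}"
  then have U: "wasserstein_open p E U" by simp
  have "open (g -` U)"
    unfolding open_closed closed_sequential_limits
  proof (intro allI impI, elim conjE, rule ccontr)
    fix u s assume u: "\<forall>n. u n \<in> - (g -` U)" "u \<longlonglongrightarrow> s" and "s \<notin> - (g -` U)"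
    then obtain e :: real where "e > 0"
      and e: "\<And>\<nu>. \<nu> \<in> prob_moment p E \<Longrightarrow> wasserstein p (g s) \<nu> < ennreal e \<Longrightarrow> \<nu> \<in> U"
      using U unfolding wasserstein_open_def by auto
    have "\<forall>\<^sub>F n in sequentially. wasserstein p (g s) (g (u n)) < ennreal e"
      using \<open>e > 0\<close> by (intro order_tendstoD(2)[OF cont[OF u(2)]]) simp
    then obtain n where "wasserstein p (g s) (g (u n)) < ennreal e"
      by (auto simp: eventually_sequentially)
    with e[OF mem] u(1) show False by auto
  qed
  then show "g -` U \<inter> space borel \<in> sets borel" by simp
qed

section \<open>Flow of the time marginals of a random path\<close>

definition marginal :: "'w measure \<Rightarrow> ('w \<Rightarrow> ('d::finite) path) \<Rightarrow> real \<Rightarrow> (real ^ 'd) measure" where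
  "marginal \<Gamma> F s = distr \<Gamma> borel (\<lambda>\<omega>. apply_bcontfun (F \<omega>) s)"

lemma measurable_path_eval:
  "F \<in> measurable M (path_borel T) \<Longrightarrow> (\<lambda>\<omega>. apply_bcontfun (F \<omega>) s) \<in> borel_measurable M"
  by (rule measurable_compose[OF _ measurable_path_apply])

lemma integrable_path_eval:
  assumes "0 \<le> p" and F: "F \<in> measurable \<Gamma> (path_borel T)" "integrable \<Gamma> (\<lambda>\<omega>. norm (F \<omega>) powr p)"
  shows "integrable \<Gamma> (\<lambda>\<omega>. norm (apply_bcontfun (F \<omega>) s) powr p)"
  by (rule integrable_powr_le[OF F(2)])
    (use assms(1) measurable_path_eval[OF F(1)] in \<open>auto simp: norm_apply_le\<close>)

lemma marginal_in_prob_moment: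
  assumes "prob_space \<Gamma>" "0 \<le> p" "F \<in> measurable \<Gamma> (path_borel T)"
    and "integrable \<Gamma> (\<lambda>\<omega>. norm (F \<omega>) powr p)"
  shows "marginal \<Gamma> F s \<in> prob_moment p borel"
  unfolding marginal_def
  by (rule distr_in_prob_moment[OF assms(1) measurable_path_eval[OF assms(3)] _
        integrable_path_eval[OF assms(2-4)]]) simp

lemma enn2real_wasserstein_marginal_le:
  fixes F G :: "'w \<Rightarrow> ('d::finite) path"
  assumes p: "0 < p" and F: "F \<in> measurable \<Gamma> (path_borel T)" and G: "G \<in> measurable \<Gamma> (path_borel T)"
    and g: "integrable \<Gamma> (\<lambda>\<omega>. g \<omega> powr p)"
    and le: "\<And>\<omega>. \<omega> \<in> space \<Gamma> \<Longrightarrow> norm (apply_bcontfun (F \<omega>) s - apply_bcontfun (G \<omega>) s) \<le> g \<omega>"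
  shows "enn2real (wasserstein p (marginal \<Gamma> F s) (marginal \<Gamma> G s)) \<le> (\<integral>\<omega>. g \<omega> powr p \<partial>\<Gamma>) powr (1 / p)"
proof -
  have m: "(\<lambda>\<omega>. apply_bcontfun (F \<omega>) s) \<in> borel_measurable \<Gamma>"
    "(\<lambda>\<omega>. apply_bcontfun (G \<omega>) s) \<in> borel_measurable \<Gamma>"
    using F G by (auto intro: measurable_path_eval)
  have int: "integrable \<Gamma> (\<lambda>\<omega>. dist (apply_bcontfun (F \<omega>) s) (apply_bcontfun (G \<omega>) s) powr p)"
    by (rule integrable_powr_le[OF g]) (use p m le in \<open>auto simp: dist_norm\<close>)
  have "(\<integral>\<omega>. dist (apply_bcontfun (F \<omega>) s) (apply_bcontfun (G \<omega>) s) powr p \<partial>\<Gamma>)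
      \<le> (\<integral>\<omega>. g \<omega> powr p \<partial>\<Gamma>)"
    using p le by (intro integral_mono[OF int g] powr_mono2) (auto simp: dist_norm)
  then have "(\<integral>\<omega>. dist (apply_bcontfun (F \<omega>) s) (apply_bcontfun (G \<omega>) s) powr p \<partial>\<Gamma>) powr (1 / p)
      \<le> (\<integral>\<omega>. g \<omega> powr p \<partial>\<Gamma>) powr (1 / p)"
    using p by (intro powr_mono2) auto
  with enn2real_wasserstein_distr_le[OF m dist_measurable_euclidean int] show ?thesis
    unfolding marginal_def by linarith
qed

text \<open>Paths are continuous and their evaluations are dominated by
  \<open>norm (F \<omega>)\<close>, so dominated convergence makes the flow continuous in the
  Wasserstein distance. This is what makes the drift a measurable function of time.\<close>

lemma marginal_measurable:
  fixes F :: "'w \<Rightarrow> ('d::finite) path"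
  assumes \<Gamma>: "prob_space \<Gamma>" and p: "0 < p" and F: "F \<in> measurable \<Gamma> (path_borel T)"
    and int: "integrable \<Gamma> (\<lambda>\<omega>. norm (F \<omega>) powr p)"
  shows "marginal \<Gamma> F \<in> measurable borel (wasserstein_borel p borel)"
proof (rule measurable_wasserstein_borelI)
  show "marginal \<Gamma> F s \<in> prob_moment p borel" for s
    by (rule marginal_in_prob_moment[OF \<Gamma> _ F int]) (use p in simp)
next
  fix s :: real and u assume u: "u \<longlonglongrightarrow> s"
  have m [measurable]: "(\<lambda>\<omega>. apply_bcontfun (F \<omega>) t) \<in> borel_measurable \<Gamma>" for t
    by (rule measurable_path_eval[OF F])
  have bd: "dist (apply_bcontfun (F \<omega>) s) (apply_bcontfun (F \<omega>) t) \<le> 2 * norm (F \<omega>)" for \<omega> t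
    using norm_triangle_le_diff[OF order_trans[OF add_mono[OF norm_apply_le[of "F \<omega>" s] norm_apply_le[of "F \<omega>" t]]]]
    by (simp add: dist_norm)
  have int2: "integrable \<Gamma> (\<lambda>\<omega>. (2 * norm (F \<omega>)) powr p)"
    by (rule integrable_cmult_powr[OF int]) auto
  have i: "integrable \<Gamma> (\<lambda>\<omega>. dist (apply_bcontfun (F \<omega>) s) (apply_bcontfun (F \<omega>) t) powr p)" for t
    by (rule integrable_powr_le[OF int2]) (use p bd in auto)
  have "(\<lambda>n. \<integral>\<omega>. dist (apply_bcontfun (F \<omega>) s) (apply_bcontfun (F \<omega>) (u n)) powr p \<partial>\<Gamma>)
      \<longlonglongrightarrow> (\<integral>\<omega>. 0 \<partial>\<Gamma>)"
  proof (rule integral_dominated_convergence[OF _ _ int2])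
    show "AE \<omega> in \<Gamma>. (\<lambda>n. dist (apply_bcontfun (F \<omega>) s) (apply_bcontfun (F \<omega>) (u n)) powr p) \<longlonglongrightarrow> 0"
    proof (rule AE_I2)
      fix \<omega>
      have "continuous (at s) (apply_bcontfun (F \<omega>))"
        by (rule continuous_on_eq_continuous_at[OF open_UNIV, THEN iffD1, rule_format,
              OF continuous_on_apply_bcontfun UNIV_I])
      then have "(\<lambda>n. apply_bcontfun (F \<omega>) (u n)) \<longlonglongrightarrow> apply_bcontfun (F \<omega>) s"
        by (rule isCont_tendsto_compose[OF _ u])
      from tendsto_dist[OF tendsto_const[of "apply_bcontfun (F \<omega>) s"] this]
      have "(\<lambda>n. dist (apply_bcontfun (F \<omega>) s) (apply_bcontfun (F \<omega>) (u n))) \<longlonglongrightarrow> 0"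
        by simp
      from tendsto_powr'[OF this tendsto_const[of p]] p
      show "(\<lambda>n. dist (apply_bcontfun (F \<omega>) s) (apply_bcontfun (F \<omega>) (u n)) powr p) \<longlonglongrightarrow> 0"
        by simp
    qed
    show "AE \<omega> in \<Gamma>. norm (dist (apply_bcontfun (F \<omega>) s) (apply_bcontfun (F \<omega>) (u n)) powr p)
        \<le> (2 * norm (F \<omega>)) powr p" for n
      using bd p by (intro AE_I2) (auto intro!: powr_mono2)
  qed measurable
  from tendsto_powr'[OF this tendsto_const[of "1 / p"]] p
  have "(\<lambda>n. (\<integral>\<omega>. dist (apply_bcontfun (F \<omega>) s) (apply_bcontfun (F \<omega>) (u n)) powr p \<partial>\<Gamma>) powr (1 / p))
      \<longlonglongrightarrow> 0" by simp
  from tendsto_ennrealI[OF this] have lim: "(\<lambda>n. ennreal ((\<integral>\<omega>. dist (apply_bcontfun (F \<omega>) s) (apply_bcontfun (F \<omega>) (u n)) powr p \<partial>\<Gamma>) powr (1 / p)))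
      \<longlonglongrightarrow> 0"
    by simp
  show "(\<lambda>n. wasserstein p (marginal \<Gamma> F s) (marginal \<Gamma> F (u n))) \<longlonglongrightarrow> 0"
    unfolding marginal_def
    by (rule tendsto_sandwich[OF _ _ tendsto_const lim])
      (auto intro!: always_eventually wasserstein_distr_le[OF m m dist_measurable_euclidean i])
qed

section \<open>Empirical measures\<close>

text \<open>An empirical measure is the law of \<open>y\<close> at a uniformly chosen index, so
  results about laws of random paths apply to it with the index set as probability space. For
  \<open>N \<ge> 1\<close> the weighted sum in the definition agrees with this law on all measurable
  sets; hence \<open>measure_of\<close> does not fall back to its default value.\<close>

lemma empirical_measure_eq_distr:
  assumes N: "N \<ge> 1" and y: "\<And>i. i \<in> {1..N} \<Longrightarrow> y i \<in> space E"
  shows "empirical_measure E N y = distr (uniform_count_measure {1..N}) E y"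
proof -
  let ?U = "uniform_count_measure {1..N}"
  have m: "y \<in> measurable ?U E"
    using y by (auto simp: measurable_def space_uniform_count_measure sets_uniform_count_measure)
  have eq: "(\<Sum>i\<in>{1..N}. emeasure (return E (y i)) A) / of_nat N = emeasure (distr ?U E y) A"
    if A: "A \<in> sets E" for A
  proof -
    have "emeasure (distr ?U E y) A = ennreal (card (y -` A \<inter> {1..N}) / N)"
      using A m by (subst emeasure_distr) (auto simp: space_uniform_count_measure emeasure_uniform_count_measure)
    also have "\<dots> = of_nat (card (y -` A \<inter> {1..N})) / of_nat N"
      using N by (simp add: divide_ennreal[symmetric] ennreal_of_nat_eq_real_of_nat)
    also have "of_nat (card (y -` A \<inter> {1..N})) = (\<Sum>i\<in>{1..N}. emeasure (return E (y i)) A)"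
      using A y by (simp add: indicator_def sum.If_cases Int_def vimage_def conj_commute)
    finally show ?thesis by simp
  qed
  show ?thesis
  proof (rule measure_eqI)
    show "sets (empirical_measure E N y) = sets (distr ?U E y)"
      by (simp add: empirical_measure_def)
    fix A assume "A \<in> sets (empirical_measure E N y)"
    then have A: "A \<in> sets E" by (simp add: empirical_measure_def)
    have "empirical_measure E N y = measure_of (space E) (sets E) (emeasure (distr ?U E y))"
      unfolding empirical_measure_def
    proof (rule measure_of_eq[OF sets.space_closed])
      fix A assume "A \<in> sigma_sets (space E) (sets E)"
      then have "A \<in> sets E" by (simp add: sets.sigma_sets_eq)
      then show "(\<Sum>i\<in>{1..N}. emeasure (return E (y i)) A) / of_nat N = emeasure (distr ?U E y) A"
        by (rule eq)
    qed
    also have "\<dots> = distr ?U E y"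
      using measure_of_of_measure[of "distr ?U E y"] by simp
    finally show "emeasure (empirical_measure E N y) A = emeasure (distr ?U E y) A" by simp
  qed
qed

lemma prob_space_uniform_count_Icc: "N \<ge> 1 \<Longrightarrow> prob_space (uniform_count_measure {1..N::nat})"
  by (rule prob_space_uniform_count_measure) auto

lemma measurable_uniform_count_Icc:
  "(\<And>i. i \<in> {1..N::nat} \<Longrightarrow> y i \<in> space E) \<Longrightarrow> y \<in> measurable (uniform_count_measure {1..N}) E"
  by (auto simp: measurable_def space_uniform_count_measure sets_uniform_count_measure)

lemma integrable_uniform_count_Icc:
  fixes f :: "nat \<Rightarrow> real"
  shows "integrable (uniform_count_measure {1..N}) f"
  by (simp add: uniform_count_measure_def integrable_point_measure_finite)

lemma integral_distr_uniform_count: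
  fixes f :: "'a \<Rightarrow> real" and y :: "nat \<Rightarrow> 'a"
  assumes "\<And>i. i \<in> {1..N} \<Longrightarrow> y i \<in> space E" "f \<in> borel_measurable E"
  shows "(\<integral>x. f x \<partial>distr (uniform_count_measure {1..N}) E y) = (\<Sum>i\<in>{1..N}. f (y i)) / N"
    and "integrable (distr (uniform_count_measure {1..N}) E y) f"
proof -
  have y: "y \<in> measurable (uniform_count_measure {1..N}) E"
    by (rule measurable_uniform_count_Icc) (rule assms(1))
  show "(\<integral>x. f x \<partial>distr (uniform_count_measure {1..N}) E y) = (\<Sum>i\<in>{1..N}. f (y i)) / N"
    using integral_distr[OF y assms(2)] by (simp add: integral_uniform_count_measure)
  show "integrable (distr (uniform_count_measure {1..N}) E y) f"
    by (simp only: integrable_distr_eq[OF y assms(2)] integrable_uniform_count_Icc)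
qed

section \<open>Integrals as paths\<close>

text \<open>Freezing the upper limit of integration outside \<open>[0,T]\<close> makes the integral
  an element of \<open>path_space T\<close>, so that it can be added to a driving path.\<close>

definition int_path :: "real \<Rightarrow> (real \<Rightarrow> real ^ ('d::finite)) \<Rightarrow> 'd path" where
  "int_path T v = Bcontfun (\<lambda>t. LINT s:{0..max 0 (min T t)}|lborel. v s)"

lemma int_path_apply:
  fixes v :: "real \<Rightarrow> real ^ ('d::finite)"
  assumes T: "T > 0" and v: "set_integrable lborel {0..T} v"
  shows "apply_bcontfun (int_path T v) t = (LINT s:{0..max 0 (min T t)}|lborel. v s)"
proof -
  let ?h = "\<lambda>t. LINT s:{0..max 0 (min T t)}|lborel. v s"
  let ?k = "\<lambda>t. integral {0..t} v"
  have sub: "set_integrable lborel {0..max 0 (min T t)} v" for t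
    by (rule set_integrable_subset[OF v]) (use T in auto)
  have h: "?h t = ?k (max 0 (min T t))" for t
    by (rule set_borel_integral_eq_integral(2)[OF sub])
  have k: "continuous_on {0..T} ?k"
    by (rule indefinite_integral_continuous_1[OF set_borel_integral_eq_integral(1)[OF v]])
  have "continuous_on UNIV ?h"
    unfolding h by (rule continuous_on_compose2[OF k]) (use T in \<open>auto intro!: continuous_intros\<close>)
  moreover have "bounded (range ?h)"
  proof (rule bounded_subset)
    show "bounded (?k ` {0..T})"
      using k by (intro compact_imp_bounded compact_continuous_image) auto
    show "range ?h \<subseteq> ?k ` {0..T}" unfolding h using T by auto
  qed
  ultimately have "?h \<in> bcontfun" by (simp add: bcontfun_def)
  then show ?thesis unfolding int_path_def by (simp add: Bcontfun_inverse)
qed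

lemma int_path_in_path_space:
  assumes "T > 0" "set_integrable lborel {0..T} v"
  shows "int_path T v \<in> path_space T"
  by (rule path_spaceI) (use assms in \<open>simp add: int_path_apply\<close>)

lemma norm_int_path_diff_le:
  fixes v v' :: "real \<Rightarrow> real ^ ('d::finite)"
  assumes T: "T > 0" and v: "set_integrable lborel {0..T} v" "set_integrable lborel {0..T} v'"
    and g: "continuous_on {0..T} g" and le: "\<And>s. s \<in> {0..T} \<Longrightarrow> norm (v s - v' s) \<le> g s"
    and G: "\<And>s. s \<in> {0..T} \<Longrightarrow> (G has_real_derivative g s) (at s within {0..T})"
    and t: "t \<in> {0..T}"
  shows "norm (apply_bcontfun (int_path T v) t - apply_bcontfun (int_path T v') t) \<le> G t - G 0"
proof -
  have t': "max 0 (min T t) = t" using t by auto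
  have sub: "set_integrable lborel {0..t} v" "set_integrable lborel {0..t} v'"
    by (rule set_integrable_subset[OF v(1)] set_integrable_subset[OF v(2)]; use t in auto)+
  have gi: "set_integrable lborel {0..t} g"
    by (rule borel_integrable_atLeastAtMost') (use g t in \<open>auto intro: continuous_on_subset\<close>)
  have "norm (apply_bcontfun (int_path T v) t - apply_bcontfun (int_path T v') t)
      = norm (LINT s:{0..t}|lborel. v s - v' s)"
    using sub by (simp add: int_path_apply[OF T] v t')
  also have "\<dots> \<le> (LINT s:{0..t}|lborel. norm (v s - v' s))"
    by (intro set_integral_norm_bound set_integral_diff sub)
  also have "\<dots> \<le> (LINT s:{0..t}|lborel. g s)"
    using sub gi t by (intro set_integral_mono set_integrable_norm set_integral_diff le) auto
  also have "\<dots> = integral {0..t} g" by (rule set_borel_integral_eq_integral(2)[OF gi])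
  also have "\<dots> = G t - G 0"
  proof (rule integral_unique, rule fundamental_theorem_of_calculus)
    show "0 \<le> t" using t by simp
    fix s assume s: "s \<in> {0..t}"
    then have "(G has_real_derivative g s) (at s within {0..t})"
      using t by (intro DERIV_subset[OF G]) auto
    then show "(G has_vector_derivative g s) (at s within {0..t})"
      by (simp add: has_real_derivative_iff_has_vector_derivative)
  qed
  finally show ?thesis .
qed

text \<open>Integration gains the factor \<open>1 / l\<close> against the weight
  \<open>exp (l * s)\<close>. A large \<open>l\<close> thus turns the integral operator into a
  contraction on all of \<open>[0,T]\<close>. The \<open>- 1\<close> is kept because it absorbs the
  term \<open>dist y y'\<close> when the Lipschitz bound of the iterates is propagated.\<close>

lemma norm_int_path_diff_exp_le:
  fixes v v' :: "real \<Rightarrow> real ^ ('d::finite)"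
  assumes T: "T > 0" and v: "set_integrable lborel {0..T} v" "set_integrable lborel {0..T} v'"
    and l: "l > 0" and le: "\<And>s. s \<in> {0..T} \<Longrightarrow> norm (v s - v' s) \<le> C * exp (l * s)"
    and t: "t \<in> {0..T}"
  shows "norm (apply_bcontfun (int_path T v) t - apply_bcontfun (int_path T v') t)
    \<le> C / l * (exp (l * t) - 1)"
proof -
  have "norm (apply_bcontfun (int_path T v) t - apply_bcontfun (int_path T v') t)
      \<le> C / l * exp (l * t) - C / l * exp (l * 0)"
    by (rule norm_int_path_diff_le[OF T v _ le _ t])
      (use l in \<open>auto intro!: continuous_intros derivative_eq_intros\<close>)
  then show ?thesis by (simp add: algebra_simps)
qed

section \<open>Existence of the solution map by Picard iteration\<close>

lemma geometric_limit:
  fixes f :: "nat \<Rightarrow> 'a::complete_space"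
  assumes a: "\<And>n. dist (f (Suc n)) (f n) \<le> a * (1/2) ^ n"
  obtains l where "f \<longlonglongrightarrow> l" "\<And>n. dist (f n) l \<le> 2 * a * (1/2) ^ n"
proof -
  have a0: "0 \<le> a" using order_trans[OF zero_le_dist a[of 0]] by simp
  \<comment> \<open>The subtracted term is the part of the geometric series still to come; with it
    the induction step closes without loss.\<close>
  have *: "dist (f n) (f (n + k)) \<le> 2 * a * (1/2) ^ n - 2 * a * (1/2) ^ (n + k)" for n k
  proof (induction k)
    case (Suc k)
    have "dist (f n) (f (n + Suc k)) \<le> dist (f n) (f (n + k)) + dist (f (Suc (n + k))) (f (n + k))"
      using dist_triangle2[of "f n" "f (n + Suc k)" "f (n + k)"] by simp
    also have "\<dots> \<le> (2 * a * (1/2) ^ n - 2 * a * (1/2) ^ (n + k)) + a * (1/2) ^ (n + k)"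
      by (intro add_mono Suc a)
    also have "\<dots> = 2 * a * (1/2) ^ n - 2 * a * (1/2) ^ (n + Suc k)" by simp
    finally show ?case .
  qed simp
  have **: "dist (f n) (f m) \<le> 2 * a * (1/2) ^ n" if "n \<le> m" for n m
  proof -
    have "0 \<le> 2 * a * (1/2) ^ m" using a0 by simp
    with *[of n "m - n"] that show ?thesis by simp
  qed
  have lim0: "(\<lambda>n. 2 * a * (1/2) ^ n) \<longlonglongrightarrow> 0"
    using tendsto_mult[OF tendsto_const[of "2 * a"] LIMSEQ_power_zero[of "1/2 :: real"]] by simp
  have "Cauchy f"
    unfolding Cauchy_altdef
  proof (intro allI impI)
    fix e :: real assume "e > 0"
    with lim0 have "\<forall>\<^sub>F n in sequentially. 2 * a * (1/2) ^ n < e" by (rule order_tendstoD)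
    then obtain N where N: "\<And>n. n \<ge> N \<Longrightarrow> 2 * a * (1/2) ^ n < e"
      by (auto simp: eventually_sequentially)
    show "\<exists>M. \<forall>m\<ge>M. \<forall>n>m. dist (f m) (f n) < e"
      by (intro exI[of _ N] allI impI) (use N ** in \<open>meson le_less_trans less_imp_le\<close>)
  qed
  then obtain l where l: "f \<longlonglongrightarrow> l" using Cauchy_convergent_iff convergent_def by blast
  have "dist (f n) l \<le> 2 * a * (1/2) ^ n" for n
    by (rule LIMSEQ_le_const2[OF tendsto_dist[OF tendsto_const l]]) (use ** in auto)
  with l show thesis by (rule that)
qed

lemma Lp_norm_cmult:
  fixes g :: "'w \<Rightarrow> real"
  assumes "0 \<le> c" "\<And>\<omega>. \<omega> \<in> space M \<Longrightarrow> 0 \<le> g \<omega>" "0 < p"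
  shows "(\<integral>\<omega>. (c * g \<omega>) powr p \<partial>M) powr (1 / p) = c * (\<integral>\<omega>. g \<omega> powr p \<partial>M) powr (1 / p)"
proof -
  have "(\<integral>\<omega>. (c * g \<omega>) powr p \<partial>M) = (\<integral>\<omega>. c powr p * g \<omega> powr p \<partial>M)"
    using assms by (intro Bochner_Integration.integral_cong) (auto simp: powr_mult)
  also have "\<dots> = c powr p * (\<integral>\<omega>. g \<omega> powr p \<partial>M)" by simp
  finally show ?thesis using assms by (simp add: powr_mult powr_powr)
qed

definition lipschitz_path_map :: "real \<Rightarrow> real \<Rightarrow> (('d::finite) path \<Rightarrow> 'd path) \<Rightarrow> bool" where
  "lipschitz_path_map T C F \<longleftrightarrow> (\<forall>y\<in>path_space T. F y \<in> path_space T) \<and>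
     (\<forall>y\<in>path_space T. \<forall>y'\<in>path_space T. dist (F y) (F y') \<le> C * dist y y')"

lemma lipschitz_path_map_measurable:
  assumes "lipschitz_path_map T C F"
  shows "F \<in> measurable (path_borel T) (path_borel T)"
proof (rule measurable_path_borelI)
  \<comment> \<open>\<open>lipschitz_on\<close> requires a nonnegative constant, whereas
    \<open>C\<close> is unrestricted; hence the absolute value.\<close>
  have "\<bar>C\<bar> * d \<ge> C * d" if "d \<ge> 0" for d using that by (simp add: mult_right_mono)
  then have "(\<bar>C\<bar>)-lipschitz_on (path_space T) F"
    using assms unfolding lipschitz_path_map_def
    by (intro lipschitz_onI) (meson order_trans zero_le_dist, simp)
  then show "F \<in> borel_measurable (path_borel T)"
    by (intro measurable_path_continuous) (rule lipschitz_on_continuous_on)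
qed (use assms in \<open>auto simp: lipschitz_path_map_def\<close>)

lemma Lq_path_add:
  fixes X Y :: "'w \<Rightarrow> ('d::finite) path"
  assumes "T > 0" "0 \<le> p" "X \<in> Lq_space M p (path_borel T)" "Y \<in> Lq_space M p (path_borel T)"
  shows "(\<lambda>\<omega>. X \<omega> + Y \<omega>) \<in> Lq_space M p (path_borel T)"
proof -
  have m: "X \<in> measurable M (path_borel T)" "Y \<in> measurable M (path_borel T)"
    using assms by (auto simp: Lq_space_def)
  have "integrable M (\<lambda>\<omega>. (norm (X \<omega>) + norm (Y \<omega>)) powr p)"
    using assms m by (intro integrable_powr_add) (auto simp: Lq_space_def intro: measurable_path_norm)
  then have "integrable M (\<lambda>\<omega>. norm (X \<omega> + Y \<omega>) powr p)"
    using measurable_path_norm[OF measurable_path_add[OF assms(1) m]] assms(2)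
    by (rule integrable_powr_le) (auto intro: norm_triangle_ineq)
  with measurable_path_add[OF assms(1) m] show ?thesis by (simp add: Lq_space_def)
qed

lemma Lq_path_const:
  "finite_measure M \<Longrightarrow> y \<in> path_space T \<Longrightarrow> (\<lambda>_. y) \<in> Lq_space M p (path_borel T)"
  by (auto simp: Lq_space_def finite_measure.integrable_const)

text \<open>A Lipschitz map grows at most linearly, with \<open>norm (F 0)\<close> as the constant
  term, and therefore preserves finite moments.\<close>

lemma Lq_path_compose:
  fixes F :: "('d::finite) path \<Rightarrow> 'd path"
  assumes M: "finite_measure M" and p: "0 \<le> p" and F: "lipschitz_path_map T C F"
    and Y: "Y \<in> Lq_space M p (path_borel T)"
  shows "(\<lambda>\<omega>. F (Y \<omega>)) \<in> Lq_space M p (path_borel T)"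
proof -
  interpret finite_measure M by fact
  have Ym: "Y \<in> measurable M (path_borel T)" using Y by (simp add: Lq_space_def)
  have m: "(\<lambda>\<omega>. F (Y \<omega>)) \<in> measurable M (path_borel T)"
    by (rule measurable_compose[OF Ym lipschitz_path_map_measurable[OF F]])
  have YS: "Y \<omega> \<in> path_space T" if "\<omega> \<in> space M" for \<omega>
    using measurable_space[OF Ym that] by simp
  have bd: "norm (F (Y \<omega>)) \<le> norm (F 0) + \<bar>C\<bar> * norm (Y \<omega>)" if "\<omega> \<in> space M" for \<omega>
  proof -
    have "dist (F (Y \<omega>)) (F 0) \<le> C * dist (Y \<omega>) 0"
      using F YS[OF that] unfolding lipschitz_path_map_def by (meson zero_in_path_space)
    also have "\<dots> \<le> \<bar>C\<bar> * norm (Y \<omega>)" by (simp add: mult_right_mono)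
    finally show ?thesis using norm_triangle_sub[of "F (Y \<omega>)" "F 0"] by (simp add: dist_norm)
  qed
  have nY: "(\<lambda>\<omega>. norm (Y \<omega>)) \<in> borel_measurable M" by (rule measurable_path_norm[OF Ym])
  have "integrable M (\<lambda>\<omega>. (norm (F 0) + \<bar>C\<bar> * norm (Y \<omega>)) powr p)"
    using Y p nY by (intro integrable_powr_add integrable_cmult_powr) (auto simp: Lq_space_def)
  from integrable_powr_le[OF this measurable_path_norm[OF m] p] bd m show ?thesis
    by (simp add: Lq_space_def)
qed

lemma marginal_distr:
  assumes Y: "Y \<in> measurable \<Gamma> (path_borel T)" and F: "F \<in> measurable (path_borel T) (path_borel T)"
  shows "marginal (distr \<Gamma> (path_borel T) Y) F = marginal \<Gamma> (\<lambda>\<omega>. F (Y \<omega>))"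
  unfolding marginal_def
  by (rule ext, subst distr_distr[OF measurable_path_eval[OF F] Y]) (simp add: comp_def)

text \<open>The Lipschitz condition is in linear form, which suits exponential weights; it follows
  from the condition on \<open>p\<close>-th powers with another constant. As it says nothing about
  the size of \<open>b\<close> in time, integrability is assumed at the origin and the Dirac mass
  there, and \<open>b_lip\<close> carries it to every path and every flow of marginals with finite
  moment.\<close>

locale mean_field_drift =
  fixes T p L :: real and b :: "real \<Rightarrow> real ^ ('d::finite) \<Rightarrow> (real ^ 'd) measure \<Rightarrow> real ^ 'd"
  assumes T: "T > 0" and p: "1 \<le> p" and L: "L > 0"
    and b_meas: "(\<lambda>(t, x, \<mu>). b t x \<mu>) \<in> borel_measurable
          (restrict_space borel {0..T} \<Otimes>\<^sub>M borel \<Otimes>\<^sub>M wasserstein_borel p borel)"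
    and b_lip: "\<And>t x x' \<mu> \<mu>'. t \<in> {0..T} \<Longrightarrow> \<mu> \<in> prob_moment p borel \<Longrightarrow>
          \<mu>' \<in> prob_moment p borel \<Longrightarrow>
          norm (b t x \<mu> - b t x' \<mu>') \<le> L * (norm (x - x') + enn2real (wasserstein p \<mu> \<mu>'))"
    and b_int: "set_integrable lborel {0..T} (\<lambda>t. b t 0 (return borel 0))"
begin

abbreviation "PS \<equiv> path_space T :: 'd path set"
abbreviation "PB \<equiv> path_borel T :: 'd path measure"

text \<open>Only the law of \<open>F\<close> under \<open>\<Gamma>\<close> matters, but the space is
  kept as a parameter: it may be the driving law, the uniform measure on indices or a
  coupling.\<close>

definition drift :: "'w measure \<Rightarrow> ('w \<Rightarrow> 'd path) \<Rightarrow> 'd path \<Rightarrow> real \<Rightarrow> real ^ 'd" where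
  "drift \<Gamma> F x s = b s (apply_bcontfun x s) (marginal \<Gamma> F s)"

lemma p0: "0 < p" using p by simp

lemma drift_diff_le:
  assumes \<Gamma>: "prob_space \<Gamma>" and F: "F \<in> Lq_space \<Gamma> p PB" and G: "G \<in> Lq_space \<Gamma> p PB"
    and g: "integrable \<Gamma> (\<lambda>\<omega>. g \<omega> powr p)"
    and le: "\<And>\<omega>. \<omega> \<in> space \<Gamma> \<Longrightarrow> norm (apply_bcontfun (F \<omega>) s - apply_bcontfun (G \<omega>) s) \<le> g \<omega>"
    and s: "s \<in> {0..T}"
  shows "norm (drift \<Gamma> F x s - drift \<Gamma> G y s)
    \<le> L * (norm (apply_bcontfun x s - apply_bcontfun y s) + (\<integral>\<omega>. g \<omega> powr p \<partial>\<Gamma>) powr (1 / p))"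
proof -
  have F': "F \<in> measurable \<Gamma> PB" "integrable \<Gamma> (\<lambda>\<omega>. norm (F \<omega>) powr p)"
    and G': "G \<in> measurable \<Gamma> PB" "integrable \<Gamma> (\<lambda>\<omega>. norm (G \<omega>) powr p)"
    using F G by (auto simp: Lq_space_def)
  have "norm (drift \<Gamma> F x s - drift \<Gamma> G y s) \<le> L * (norm (apply_bcontfun x s - apply_bcontfun y s)
      + enn2real (wasserstein p (marginal \<Gamma> F s) (marginal \<Gamma> G s)))"
    unfolding drift_def using p0
    by (intro b_lip[OF s] marginal_in_prob_moment[OF \<Gamma> _ F'] marginal_in_prob_moment[OF \<Gamma> _ G']) auto
  also have "\<dots> \<le> L * (norm (apply_bcontfun x s - apply_bcontfun y s) + (\<integral>\<omega>. g \<omega> powr p \<partial>\<Gamma>) powr (1 / p))"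
    using L enn2real_wasserstein_marginal_le[OF p0 F'(1) G'(1) g le] by simp
  finally show ?thesis .
qed

lemma drift_zero:
  assumes "prob_space \<Gamma>"
  shows "drift \<Gamma> (\<lambda>_. 0) 0 = (\<lambda>s. b s 0 (return borel 0))"
  unfolding drift_def marginal_def using prob_space.distr_const[OF assms, of "0::real^'d" borel] by simp

lemma drift_diff_zero_le:
  assumes \<Gamma>: "prob_space \<Gamma>" and F: "F \<in> Lq_space \<Gamma> p PB" and s: "s \<in> {0..T}"
  shows "norm (drift \<Gamma> F x s - b s 0 (return borel 0))
    \<le> L * (norm x + (\<integral>\<omega>. norm (F \<omega>) powr p \<partial>\<Gamma>) powr (1 / p))"
proof -
  have z: "(\<lambda>_. 0) \<in> Lq_space \<Gamma> p PB"
    using \<Gamma> by (intro Lq_path_const) (auto simp: prob_space_def)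
  have "norm (drift \<Gamma> F x s - drift \<Gamma> (\<lambda>_. 0) 0 s)
      \<le> L * (norm (apply_bcontfun x s - apply_bcontfun 0 s) + (\<integral>\<omega>. norm (F \<omega>) powr p \<partial>\<Gamma>) powr (1 / p))"
    by (rule drift_diff_le[OF \<Gamma> F z _ _ s]) (use F in \<open>auto simp: Lq_space_def norm_apply_le\<close>)
  also have "\<dots> \<le> L * (norm x + (\<integral>\<omega>. norm (F \<omega>) powr p \<partial>\<Gamma>) powr (1 / p))"
    using L norm_apply_le[of x s] by simp
  finally show ?thesis by (simp add: drift_zero[OF \<Gamma>])
qed

text \<open>Measurability in time comes from composing \<open>b\<close> with the path and the
  Wasserstein-measurable flow of marginals; the dominating function is the drift at the origin plus
  the constant \<open>L * (norm x + A)\<close>.\<close>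

lemma drift_integrable:
  assumes \<Gamma>: "prob_space \<Gamma>" and F: "F \<in> Lq_space \<Gamma> p PB"
  shows "set_integrable lborel {0..T} (drift \<Gamma> F x)"
proof -
  define A where "A = (\<integral>\<omega>. norm (F \<omega>) powr p \<partial>\<Gamma>) powr (1 / p)"
  let ?R = "restrict_space borel {0..T} :: real measure"
  have F': "F \<in> measurable \<Gamma> PB" "integrable \<Gamma> (\<lambda>\<omega>. norm (F \<omega>) powr p)"
    using F by (auto simp: Lq_space_def)
  have [measurable]: "marginal \<Gamma> F \<in> measurable ?R (wasserstein_borel p borel)"
    by (rule measurable_restrict_space1[OF marginal_measurable[OF \<Gamma> p0 F']])
  have [measurable]: "apply_bcontfun x \<in> borel_measurable ?R"
    by (intro measurable_restrict_space1 borel_measurable_continuous_onI continuous_on_apply_bcontfun)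
  have [measurable]: "(\<lambda>s. s) \<in> measurable ?R ?R" by simp
  have "(\<lambda>s. (s, apply_bcontfun x s, marginal \<Gamma> F s)) \<in>
      measurable ?R (?R \<Otimes>\<^sub>M borel \<Otimes>\<^sub>M wasserstein_borel p borel)"
    by measurable
  from measurable_compose[OF this b_meas] have "drift \<Gamma> F x \<in> borel_measurable ?R"
    by (simp add: drift_def[abs_def])
  then have m: "(\<lambda>s. indicator {0..T} s *\<^sub>R drift \<Gamma> F x s) \<in> borel_measurable lborel"
    by (simp add: borel_measurable_restrict_space_iff)
  have i: "set_integrable lborel {0..T} (\<lambda>t. norm (b t 0 (return borel 0)) + L * (norm x + A))"
    by (intro set_integral_add set_integrable_norm b_int borel_integrable_atLeastAtMost') simp
  show ?thesis
    unfolding set_integrable_def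
  proof (rule Bochner_Integration.integrable_bound[OF i[unfolded set_integrable_def] m], rule AE_I2)
    fix s :: real
    have "norm (drift \<Gamma> F x s) \<le> norm (b s 0 (return borel 0)) + L * (norm x + A)" if "s \<in> {0..T}"
      using norm_triangle_sub[of "drift \<Gamma> F x s" "b s 0 (return borel 0)"]
        drift_diff_zero_le[OF \<Gamma> F that, of x] unfolding A_def by linarith
    then show "norm (indicator {0..T} s *\<^sub>R drift \<Gamma> F x s)
        \<le> norm (indicator {0..T} s *\<^sub>R (norm (b s 0 (return borel 0)) + L * (norm x + A)))"
      by (auto simp: indicator_def)
  qed
qed

text \<open>\<open>F\<close> enters twice: \<open>F y\<close> is the position, and the law of
  \<open>F\<close> under \<open>m\<close> is the measure argument. The second occurrence links all
  driving paths, so the iteration has to run on maps.\<close>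

definition picard :: "'d path measure \<Rightarrow> ('d path \<Rightarrow> 'd path) \<Rightarrow> 'd path \<Rightarrow> 'd path" where
  "picard m F y = y + int_path T (drift m F (F y))"

text \<open>The Lipschitz condition is part of the notion because it makes \<open>F\<close>
  measurable with finite moment under \<open>m\<close>, as the estimates on the drift
  require.\<close>

definition solution_map :: "'d path measure \<Rightarrow> ('d path \<Rightarrow> 'd path) \<Rightarrow> bool" where
  "solution_map m F \<longleftrightarrow> lipschitz_path_map T (exp (L * T)) F \<and> (\<forall>y\<in>PS. F y = picard m F y)"

lemma prob_momentD:
  assumes "m \<in> prob_moment p PB"
  shows "prob_space m" "finite_measure m" "sets m = sets PB" "space m = PS" "integrable m (\<lambda>y. norm y powr p)"
    "(\<lambda>y. y) \<in> Lq_space m p PB"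
proof -
  show 1: "prob_space m" "sets m = sets PB" "integrable m (\<lambda>y. norm y powr p)"
    using assms by (auto simp: prob_moment_def space_prob_algebra)
  then show "finite_measure m" by (simp add: prob_space_def)
  show "space m = PS" using sets_eq_imp_space_eq[OF 1(2)] by simp
  show "(\<lambda>y. y) \<in> Lq_space m p PB" using 1 by (simp add: Lq_space_def measurable_ident_sets)
qed

lemma Lq_prob_moment:
  assumes "prob_space \<Gamma>" "Y \<in> Lq_space \<Gamma> p PB"
  shows "distr \<Gamma> PB Y \<in> prob_moment p PB"
  using assms measurable_path_norm[of "\<lambda>y. y" PB T]
  by (intro distr_in_prob_moment) (auto simp: Lq_space_def)

text \<open>Two estimates with different weights are combined. In \<open>y\<close> the iterates are
  uniformly Lipschitz. In \<open>n\<close> their differences contract by \<open>1/2\<close> for the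
  norm weighted by \<open>exp (- (l * t))\<close> in time and by \<open>1 / (1 + norm y)\<close> in
  space; the latter weight is needed because the driving paths are unbounded, and
  \<open>1 + norm y\<close> has a finite \<open>p\<close>-th moment under \<open>m\<close>.\<close>

lemma exists_solution_map:
  assumes m: "m \<in> prob_moment p PB"
  shows "\<exists>F. solution_map m F"
proof -
  note m = prob_momentD[OF m]
  have p0': "0 \<le> p" using p by simp
  have eT: "exp (1 * t) - 1 \<le> exp T" if "t \<in> {0..T}" for t :: real
  proof -
    have "exp t \<le> exp T" using that by simp
    then show ?thesis by (simp del: exp_le_cancel_iff)
  qed
  define f where "f n = ((picard m) ^^ n) (\<lambda>y. y)" for n
  have fSuc: "f (Suc n) y = y + int_path T (drift m (f n) (f n y))" for n y
    by (simp add: f_def picard_def)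
  \<comment> \<open>\<open>A\<close> is the \<open>L^p\<close> norm of the weight under
    \<open>m\<close>: a pointwise bound by a multiple of \<open>1 + norm y\<close> contributes that
    multiple of \<open>A\<close> to the law term.\<close>
  define A where "A = (\<integral>y. (1 + norm y) powr p \<partial>m) powr (1 / p)"
  have int1: "integrable m (\<lambda>y. (1 + norm y) powr p)"
    using m measurable_path_norm[of "\<lambda>y. y" m T] p finite_measure.integrable_const[OF m(2)]
    by (intro integrable_powr_add) (auto simp: Lq_space_def)
  have A: "A \<ge> 0" by (simp add: A_def)
  have Lp: "F \<in> Lq_space m p PB" if "lipschitz_path_map T C F" for F C
    using Lq_path_compose[OF m(2) p0' that m(6)] by simp
  \<comment> \<open>The second claim stays pointwise in time because it is integrated in the next
    step. The third gives the finite moment that makes the next drift integrable.\<close>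
  have lip: "\<forall>y\<in>PS. f n y \<in> PS" "\<forall>y\<in>PS. \<forall>y'\<in>PS. \<forall>t\<in>{0..T}.
      norm (apply_bcontfun (f n y) t - apply_bcontfun (f n y') t) \<le> dist y y' * exp (L * t)"
    "lipschitz_path_map T (exp (L * T)) (f n)" for n
  proof (induction n)
    case 0
    { case 1 show ?case by (simp add: f_def)
    next
      case 2
      have "norm (apply_bcontfun y t - apply_bcontfun y' t) \<le> dist y y' * exp (L * t)"
        if "t \<in> {0..T}" for y y' :: "'d path" and t
        using norm_diff_apply_le[of y t y'] mult_left_mono[of 1 "exp (L * t)" "dist y y'"] L that by simp
      then show ?case by (simp add: f_def)
    next
      case 3
      have "dist y y' \<le> exp (L * T) * dist y y'" for y y' :: "'d path"
        using mult_right_mono[of 1 "exp (L * T)" "dist y y'"] L T by simp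
      then show ?case by (simp add: f_def lipschitz_path_map_def)
    }
  next
    case (Suc n)
    have i: "set_integrable lborel {0..T} (drift m (f n) x)" for x
      by (rule drift_integrable[OF m(1) Lp[OF Suc(3)]])
    { case 1
      show ?case using int_path_in_path_space[OF T i] by (auto simp: fSuc)
    } note 1 = this
    { case 2
      show ?case
      proof (intro ballI)
        fix y y' t assume y: "y \<in> PS" "y' \<in> PS" and t: "t \<in> {0..T}"
        have d: "norm (drift m (f n) (f n y) s - drift m (f n) (f n y') s) \<le> L * dist y y' * exp (L * s)"
          if "s \<in> {0..T}" for s
        proof -
          \<comment> \<open>The law is the same on both sides, so \<open>g\<close> is zero and only
            the path term survives.\<close>
          have "norm (drift m (f n) (f n y) s - drift m (f n) (f n y') s)
              \<le> L * (norm (apply_bcontfun (f n y) s - apply_bcontfun (f n y') s) + (\<integral>\<omega>. 0 powr p \<partial>m) powr (1 / p))"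
            by (rule drift_diff_le[OF m(1) Lp[OF Suc(3)] Lp[OF Suc(3)] _ _ that]) auto
          also have "\<dots> \<le> L * (dist y y' * exp (L * s))" using Suc(2) y that L by simp
          finally show ?thesis by (simp add: mult.assoc)
        qed
        have "norm (apply_bcontfun (int_path T (drift m (f n) (f n y))) t
            - apply_bcontfun (int_path T (drift m (f n) (f n y'))) t)
            \<le> L * dist y y' / L * (exp (L * t) - 1)"
          by (rule norm_int_path_diff_exp_le[OF T i i L d t])
        then show "norm (apply_bcontfun (f (Suc n) y) t - apply_bcontfun (f (Suc n) y') t)
            \<le> dist y y' * exp (L * t)"
          using norm_diff_apply_le[of y t y'] L
            norm_triangle_ineq[of "apply_bcontfun y t - apply_bcontfun y' t"
              "apply_bcontfun (int_path T (drift m (f n) (f n y))) t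
               - apply_bcontfun (int_path T (drift m (f n) (f n y'))) t"]
          by (simp add: fSuc plus_bcontfun.rep_eq algebra_simps)
      qed
    } note 2 = this
    { case 3
      show ?case
        unfolding lipschitz_path_map_def
      proof (intro conjI ballI)
        fix y y' assume y: "y \<in> PS" "y' \<in> PS"
        show "f (Suc n) y \<in> PS" using 1 y by blast
        show "dist (f (Suc n) y) (f (Suc n) y') \<le> exp (L * T) * dist y y'"
        proof (rule dist_path_le[OF T])
          show "f (Suc n) y \<in> PS" "f (Suc n) y' \<in> PS" using 1 y by blast+
          fix t assume t: "t \<in> {0..T}"
          have "norm (apply_bcontfun (f (Suc n) y) t - apply_bcontfun (f (Suc n) y') t) \<le> dist y y' * exp (L * t)"
            using 2 y t by blast
          also have "\<dots> \<le> dist y y' * exp (L * T)" using t L by (intro mult_left_mono) auto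
          finally show "norm (apply_bcontfun (f (Suc n) y) t - apply_bcontfun (f (Suc n) y') t)
              \<le> exp (L * T) * dist y y'" by (simp add: mult.commute)
        qed
      qed
    }
  qed
  note Lpf = Lp[OF lip(3)]
  have i: "set_integrable lborel {0..T} (drift m (f n) x)" for n x
    by (rule drift_integrable[OF m(1) Lpf])
  \<comment> \<open>\<open>C\<close> bounds the first Picard step relative to
    \<open>1 + norm y\<close>: the integral of the drift at the origin plus the deviation from
    it.\<close>
  define C where "C = norm (int_path T (\<lambda>s. b s 0 (return borel 0))) + L * (1 + A) * exp T"
  have C: "C \<ge> 0" using L A by (simp add: C_def)
  \<comment> \<open>The path term and the law term together have the factor
    \<open>L * (1 + A)\<close>; dividing by \<open>l\<close> leaves the ratio
    \<open>1/2\<close>.\<close>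
  define l where "l = 2 * L * (1 + A)"
  have l: "l > 0" using L A by (simp add: l_def)
  have conv: "norm (apply_bcontfun (f (Suc n) y) t - apply_bcontfun (f n y) t)
      \<le> C * (1 + norm y) * (1/2) ^ n * exp (l * t)" if "y \<in> PS" "t \<in> {0..T}" for n y t
    using that
  proof (induction n arbitrary: y t)
    case 0
    have A': "(\<integral>\<omega>. norm \<omega> powr p \<partial>m) powr (1 / p) \<le> A"
      unfolding A_def using p m(5)
      by (intro powr_mono2 integral_mono int1) (auto intro!: powr_mono2)
    have d: "norm (drift m (\<lambda>y. y) y s - b s 0 (return borel 0)) \<le> L * (norm y + A) * exp (1 * s)"
      if "s \<in> {0..T}" for s
    proof -
      have "norm (drift m (\<lambda>y. y) y s - b s 0 (return borel 0)) \<le> L * (norm y + A)"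
        using drift_diff_zero_le[OF m(1) m(6) that, of y] A' L by (smt (verit) mult_left_mono)
      also have "\<dots> \<le> L * (norm y + A) * exp (1 * s)"
        using mult_left_mono[of 1 "exp (1 * s)" "L * (norm y + A)"] L A that by simp
      finally show ?thesis .
    qed
    have i0: "set_integrable lborel {0..T} (drift m (\<lambda>y. y) y)" using i[of 0] by (simp add: f_def)
    have "norm (apply_bcontfun (int_path T (drift m (\<lambda>y. y) y)) t
        - apply_bcontfun (int_path T (\<lambda>s. b s 0 (return borel 0))) t)
        \<le> L * (norm y + A) / 1 * (exp (1 * t) - 1)"
      by (rule norm_int_path_diff_exp_le[OF T i0 b_int _ d 0(2)]) simp_all
    also have "\<dots> \<le> L * (norm y + A) * exp T"
      unfolding div_by_1 using L A eT[OF 0(2)] by (intro mult_left_mono) auto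
    also have "\<dots> \<le> L * ((1 + A) * (1 + norm y)) * exp T"
      using L A by (intro mult_right_mono mult_left_mono) (auto simp: algebra_simps)
    finally have "norm (apply_bcontfun (int_path T (drift m (\<lambda>y. y) y)) t)
        \<le> norm (int_path T (\<lambda>s. b s 0 (return borel 0))) + L * ((1 + A) * (1 + norm y)) * exp T"
      using norm_apply_le[of "int_path T (\<lambda>s. b s 0 (return borel 0))" t]
        norm_triangle_sub[of "apply_bcontfun (int_path T (drift m (\<lambda>y. y) y)) t"
          "apply_bcontfun (int_path T (\<lambda>s. b s 0 (return borel 0))) t"]
      by linarith
    also have "\<dots> \<le> C * (1 + norm y)"
      unfolding C_def by (simp add: algebra_simps)
    also have "\<dots> \<le> C * (1 + norm y) * exp (l * t)"
      using mult_left_mono[of 1 "exp (l * t)" "C * (1 + norm y)"] C l 0(2) by simp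
    finally show ?case using fSuc[of 0 y] by (simp add: f_def plus_bcontfun.rep_eq)
  next
    case (Suc n)
    define c where "c = C * (1/2) ^ n"
    have c: "c \<ge> 0" using C by (simp add: c_def)
    have d: "norm (drift m (f (Suc n)) (f (Suc n) y) s - drift m (f n) (f n y) s)
        \<le> (l / 2 * c * (1 + norm y)) * exp (l * s)" if s: "s \<in> {0..T}" for s
    proof -
      let ?e = "c * exp (l * s)"
      have IH: "norm (apply_bcontfun (f (Suc n) y) s - apply_bcontfun (f n y) s) \<le> ?e * (1 + norm y)"
        if "y \<in> PS" for y
        using Suc.IH[OF that s] by (simp add: c_def mult_ac)
      have "norm (drift m (f (Suc n)) (f (Suc n) y) s - drift m (f n) (f n y) s)
        \<le> L * (norm (apply_bcontfun (f (Suc n) y) s - apply_bcontfun (f n y) s)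
            + (\<integral>\<omega>. (?e * (1 + norm \<omega>)) powr p \<partial>m) powr (1 / p))"
        by (rule drift_diff_le[OF m(1) Lpf Lpf _ _ s])
          (use IH c m(4) integrable_cmult_powr[OF int1, of ?e] in auto)
      also have "(\<integral>\<omega>. (?e * (1 + norm \<omega>)) powr p \<partial>m) powr (1 / p) = ?e * A"
        unfolding A_def using c p by (intro Lp_norm_cmult) auto
      also have "L * (norm (apply_bcontfun (f (Suc n) y) s - apply_bcontfun (f n y) s) + ?e * A)
          \<le> L * (?e * (1 + norm y) + ?e * A)"
        using L IH[OF Suc.prems(1)] by simp
      also have "\<dots> = (L * ?e) * (1 + norm y + A)" by (simp add: algebra_simps)
      \<comment> \<open>The law term adds \<open>A\<close> to the weight; the product form restores
        a multiple of \<open>1 + norm y\<close>, at the price of the factor \<open>1 + A\<close> in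
        \<open>l\<close>.\<close>
      also have "\<dots> \<le> (L * ?e) * ((1 + A) * (1 + norm y))"
        using L c A by (intro mult_left_mono) (auto simp: algebra_simps)
      also have "\<dots> = (l / 2 * c * (1 + norm y)) * exp (l * s)" by (simp add: l_def)
      finally show ?thesis .
    qed
    have "norm (apply_bcontfun (int_path T (drift m (f (Suc n)) (f (Suc n) y))) t
        - apply_bcontfun (int_path T (drift m (f n) (f n y))) t)
        \<le> (l / 2 * c * (1 + norm y)) / l * (exp (l * t) - 1)"
      by (rule norm_int_path_diff_exp_le[OF T i i l d Suc.prems(2)])
    also have "\<dots> = c / 2 * (1 + norm y) * (exp (l * t) - 1)" using l by simp
    also have "\<dots> \<le> c / 2 * (1 + norm y) * exp (l * t)" using c by (intro mult_left_mono) auto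
    finally show ?case by (simp add: fSuc[of "Suc n"] fSuc[of n] plus_bcontfun.rep_eq c_def mult_ac)
  qed
  define K where "K = C * exp (l * T)"
  have K: "K \<ge> 0" using C by (simp add: K_def)
  have step: "dist (f (Suc n) y) (f n y) \<le> (K * (1 + norm y)) * (1/2) ^ n" if y: "y \<in> PS" for n y
  proof (rule dist_path_le[OF T])
    show "f (Suc n) y \<in> PS" "f n y \<in> PS" using lip(1) y by blast+
    fix t assume t: "t \<in> {0..T}"
    note conv[OF y t, of n]
    also have "C * (1 + norm y) * (1/2) ^ n * exp (l * t) \<le> C * (1 + norm y) * (1/2) ^ n * exp (l * T)"
      using C l t by (intro mult_left_mono) auto
    finally show "norm (apply_bcontfun (f (Suc n) y) t - apply_bcontfun (f n y) t)
        \<le> K * (1 + norm y) * (1/2) ^ n" by (simp add: K_def mult_ac)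
  qed
  have "\<exists>x. (\<lambda>n. f n y) \<longlonglongrightarrow> x \<and> (\<forall>n. dist (f n y) x \<le> 2 * (K * (1 + norm y)) * (1/2) ^ n)"
    if y: "y \<in> PS" for y
    by (rule geometric_limit[of "\<lambda>n. f n y", OF step[OF y]]) auto
  then obtain F where F: "\<And>y. y \<in> PS \<Longrightarrow> (\<lambda>n. f n y) \<longlonglongrightarrow> F y"
    "\<And>y n. y \<in> PS \<Longrightarrow> dist (f n y) (F y) \<le> 2 * (K * (1 + norm y)) * (1/2) ^ n"
    by metis
  have FS: "F y \<in> PS" if "y \<in> PS" for y
    by (rule closed_sequentially[OF closed_path_space _ F(1)[OF that]]) (use lip(1) that in blast)
  have FL: "lipschitz_path_map T (exp (L * T)) F"
    unfolding lipschitz_path_map_def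
  proof (intro conjI ballI FS)
    fix y y' assume y: "y \<in> PS" "y' \<in> PS"
    show "dist (F y) (F y') \<le> exp (L * T) * dist y y'"
      by (rule LIMSEQ_le_const2[OF tendsto_dist[OF F(1)[OF y(1)] F(1)[OF y(2)]]])
        (use lip(3) y in \<open>auto simp: lipschitz_path_map_def\<close>)
  qed
  have Fi: "set_integrable lborel {0..T} (drift m F x)" for x
    by (rule drift_integrable[OF m(1) Lp[OF FL]])
  \<comment> \<open>\<open>f (Suc n)\<close> is \<open>picard m (f n)\<close>. It converges to
    \<open>F\<close>, and here also to \<open>picard m F\<close>, so the limits agree. The weight
    \<open>exp (1 * s)\<close> only brings the bound into the form of the integral estimate.\<close>
  have "F y = picard m F y" if y: "y \<in> PS" for y
  proof -
    define c where "c n = L * (2 * K * (1 + norm y + A)) * (1/2) ^ n" for n :: nat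
    have c: "c n \<ge> 0" for n using L K A by (simp add: c_def)
    have dle: "dist (f (Suc n) y) (picard m F y) \<le> c n * exp T" for n
    proof (rule dist_path_le[OF T])
      show "f (Suc n) y \<in> PS" using lip(1) y by blast
      show "picard m F y \<in> PS" using int_path_in_path_space[OF T Fi] y by (simp add: picard_def)
      fix t assume t: "t \<in> {0..T}"
      have d: "norm (drift m (f n) (f n y) s - drift m F (F y) s) \<le> c n * exp (1 * s)"
        if s: "s \<in> {0..T}" for s
      proof -
        let ?e = "2 * K * (1/2) ^ n"
        have ae: "norm (apply_bcontfun (f n y) s - apply_bcontfun (F y) s) \<le> ?e * (1 + norm y)"
          if "y \<in> PS" for y
          using order_trans[OF norm_diff_apply_le F(2)[OF that]] by (simp add: algebra_simps)
        have "norm (drift m (f n) (f n y) s - drift m F (F y) s)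
          \<le> L * (norm (apply_bcontfun (f n y) s - apply_bcontfun (F y) s)
              + (\<integral>\<omega>. (?e * (1 + norm \<omega>)) powr p \<partial>m) powr (1 / p))"
          by (rule drift_diff_le[OF m(1) Lpf Lp[OF FL] _ _ s])
            (use ae K m(4) integrable_cmult_powr[OF int1, of ?e] in auto)
        also have "(\<integral>\<omega>. (?e * (1 + norm \<omega>)) powr p \<partial>m) powr (1 / p) = ?e * A"
          unfolding A_def using K p by (intro Lp_norm_cmult) auto
        also have "L * (norm (apply_bcontfun (f n y) s - apply_bcontfun (F y) s) + ?e * A)
            \<le> L * (?e * (1 + norm y) + ?e * A)"
          using L ae[OF y] by simp
        also have "\<dots> = c n" by (simp add: c_def algebra_simps)
        also have "\<dots> \<le> c n * exp (1 * s)"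
          using mult_left_mono[of 1 "exp (1 * s)" "c n"] c s by simp
        finally show ?thesis .
      qed
      have "norm (apply_bcontfun (int_path T (drift m (f n) (f n y))) t
          - apply_bcontfun (int_path T (drift m F (F y))) t) \<le> c n / 1 * (exp (1 * t) - 1)"
        by (rule norm_int_path_diff_exp_le[OF T i Fi _ d t]) simp
      also have "\<dots> \<le> c n * exp T"
        unfolding div_by_1 using c eT[OF t] by (intro mult_left_mono) auto
      finally show "norm (apply_bcontfun (f (Suc n) y) t - apply_bcontfun (picard m F y) t) \<le> c n * exp T"
        by (simp add: fSuc picard_def plus_bcontfun.rep_eq)
    qed
    have "(\<lambda>n. L * (2 * K * (1 + norm y + A)) * (1/2) ^ n * exp T) \<longlonglongrightarrow> 0"
      by (intro tendsto_mult_left_zero tendsto_mult_right_zero LIMSEQ_power_zero) simp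
    then have c_lim: "(\<lambda>n. c n * exp T) \<longlonglongrightarrow> 0" by (simp add: c_def)
    have "(\<lambda>n. dist (f (Suc n) y) (picard m F y)) \<longlonglongrightarrow> 0"
    proof (rule Lim_null_comparison[OF always_eventually c_lim], rule allI)
      fix n show "norm (dist (f (Suc n) y) (picard m F y)) \<le> c n * exp T" using dle[of n] by simp
    qed
    then have "(\<lambda>n. f (Suc n) y) \<longlonglongrightarrow> picard m F y"
      by (subst tendsto_dist_iff)
    with LIMSEQ_Suc[OF F(1)[OF y]] show ?thesis by (rule LIMSEQ_unique)
  qed
  with FL show ?thesis by (auto simp: solution_map_def)
qed

end

section \<open>Stability\<close>

context mean_field_drift
begin

lemma solution_mapD:
  assumes "solution_map m F"
  shows "lipschitz_path_map T (exp (L * T)) F" "y \<in> PS \<Longrightarrow> F y \<in> PS"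
    "y \<in> PS \<Longrightarrow> F y = y + int_path T (drift m F (F y))"
  using assms by (auto simp: solution_map_def picard_def lipschitz_path_map_def)

lemma drift_distr:
  assumes "Y \<in> Lq_space \<Gamma> p PB" "solution_map m F"
  shows "drift (distr \<Gamma> PB Y) F = drift \<Gamma> (\<lambda>\<omega>. F (Y \<omega>))"
proof -
  have "marginal (distr \<Gamma> PB Y) F = marginal \<Gamma> (\<lambda>\<omega>. F (Y \<omega>))"
    by (rule marginal_distr[OF _ lipschitz_path_map_measurable[OF solution_mapD(1)[OF assms(2)]]])
      (use assms(1) in \<open>simp add: Lq_space_def\<close>)
  then show ?thesis by (intro ext) (simp add: drift_def)
qed

text \<open>
  A Gronwall argument: all suprema are weighted by \<open>exp (- 8 L t)\<close>, which makes the Volterra operator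
  of the equation a contraction with constant \<open>1/8\<close>.
\<close>

lemma solution_map_stable:
  assumes \<Gamma>: "prob_space \<Gamma>" and Y: "Y \<in> Lq_space \<Gamma> p PB" and Y': "Y' \<in> Lq_space \<Gamma> p PB"
    and F: "solution_map (distr \<Gamma> PB Y) F" and F': "solution_map (distr \<Gamma> PB Y') F'"
    and y: "y \<in> PS" and y': "y' \<in> PS"
  shows "dist (F y) (F' y') \<le> exp (8 * L * T) *
    (2 * dist y y' + 2 * (\<integral>\<omega>. dist (Y \<omega>) (Y' \<omega>) powr p \<partial>\<Gamma>) powr (1 / p))"
proof -
  interpret \<Gamma>: prob_space \<Gamma> by fact
  have fin: "finite_measure \<Gamma>" by (rule \<Gamma>.finite_measure_axioms)
  have p0': "0 \<le> p" using p by simp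
  define l where "l = 8 * L"
  have l: "l > 0" using L by (simp add: l_def)
  \<comment> \<open>Both solution laws are realised on \<open>\<Gamma>\<close>, so the given pairing
    of the driving paths also pairs the solutions.\<close>
  define G where "G \<omega> = F (Y \<omega>)" for \<omega>
  define G' where "G' \<omega> = F' (Y' \<omega>)" for \<omega>
  have G: "G \<in> Lq_space \<Gamma> p PB" unfolding G_def
    by (rule Lq_path_compose[OF fin p0' solution_mapD(1)[OF F] Y])
  have G': "G' \<in> Lq_space \<Gamma> p PB" unfolding G'_def
    by (rule Lq_path_compose[OF fin p0' solution_mapD(1)[OF F'] Y'])
  have dr: "drift (distr \<Gamma> PB Y) F = drift \<Gamma> G" "drift (distr \<Gamma> PB Y') F' = drift \<Gamma> G'"
    unfolding G_def G'_def by (rule drift_distr[OF Y F] drift_distr[OF Y' F'])+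
  have Ym: "Y \<in> measurable \<Gamma> PB" "Y' \<in> measurable \<Gamma> PB" using Y Y' by (auto simp: Lq_space_def)
  have Gm: "G \<in> measurable \<Gamma> PB" "G' \<in> measurable \<Gamma> PB" using G G' by (auto simp: Lq_space_def)
  have YS: "Y \<omega> \<in> PS" "Y' \<omega> \<in> PS" if "\<omega> \<in> space \<Gamma>" for \<omega>
    using measurable_space[OF Ym(1) that] measurable_space[OF Ym(2) that] by auto
  define n where "n s \<omega> = norm (apply_bcontfun (G \<omega>) s - apply_bcontfun (G' \<omega>) s)" for s \<omega>
  define D where "D s = (\<integral>\<omega>. n s \<omega> powr p \<partial>\<Gamma>) powr (1 / p)" for s
  have nm: "n s \<in> borel_measurable \<Gamma>" for s
    unfolding n_def using measurable_path_eval[OF Gm(1)] measurable_path_eval[OF Gm(2)] by measurable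
  have intGG: "integrable \<Gamma> (\<lambda>\<omega>. (norm (G \<omega>) + norm (G' \<omega>)) powr p)"
    using G G' p measurable_path_norm[OF Gm(1)] measurable_path_norm[OF Gm(2)]
    by (intro integrable_powr_add) (auto simp: Lq_space_def)
  have nle: "n s \<omega> \<le> norm (G \<omega>) + norm (G' \<omega>)" for s \<omega>
    unfolding n_def using norm_triangle_ineq4[of "apply_bcontfun (G \<omega>) s" "apply_bcontfun (G' \<omega>) s"]
      norm_apply_le[of "G \<omega>" s] norm_apply_le[of "G' \<omega>" s] by linarith
  have n0: "0 \<le> n s \<omega>" for s \<omega> by (simp add: n_def)
  have nint: "integrable \<Gamma> (\<lambda>\<omega>. n s \<omega> powr p)" for s
    by (rule integrable_powr_le[OF intGG nm]) (use p nle n0 in auto)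
  \<comment> \<open>A crude bound, whose only purpose is that the weighted supremum
    \<open>\<Delta>\<close> is finite.\<close>
  define DB where "DB = (\<integral>\<omega>. (norm (G \<omega>) + norm (G' \<omega>)) powr p \<partial>\<Gamma>) powr (1 / p)"
  have D0: "0 \<le> D s" for s by (simp add: D_def)
  have DB: "D s \<le> DB" for s
    unfolding D_def DB_def using p nle n0
    by (intro powr_mono2 integral_mono nint intGG) (auto intro!: powr_mono2)
  have e1: "exp (- (l * s)) * a \<le> a" if "0 \<le> a" "s \<in> {0..T}" for a s :: real
    using that l mult_right_mono[of "exp (- (l * s))" 1 a] by simp
  define \<Delta> where "\<Delta> = (SUP s\<in>{0..T}. exp (- (l * s)) * D s)"
  have "bdd_above ((\<lambda>s. exp (- (l * s)) * D s) ` {0..T})"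
    using e1[OF D0] DB by (intro bdd_aboveI2[of _ _ DB]) (meson order_trans)
  then have \<Delta>1: "exp (- (l * s)) * D s \<le> \<Delta>" if "s \<in> {0..T}" for s
    unfolding \<Delta>_def using that by (rule cSUP_upper2[of _ _ s]) auto
  have \<Delta>: "D s \<le> \<Delta> * exp (l * s)" if "s \<in> {0..T}" for s
    using \<Delta>1[OF that] by (simp add: exp_minus field_simps)
  have \<Delta>0: "\<Delta> \<ge> 0" using \<Delta>1[of 0] D0[of 0] T by auto
  \<comment> \<open>\<open>\<Delta>\<close> is still unknown here. The statement is quantified over
    \<open>y\<close> and \<open>y'\<close> afresh because it serves twice: for
    \<open>Y \<omega>\<close> and \<open>Y' \<omega>\<close> to determine \<open>\<Delta>\<close>,
    and for the given paths at the end.\<close>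
  have pw: "norm (apply_bcontfun (F y) t - apply_bcontfun (F' y') t) \<le> exp (l * t) * (2 * dist y y' + \<Delta> / 4)"
    if y: "y \<in> PS" "y' \<in> PS" and t: "t \<in> {0..T}" for y y' t
  proof -
    define M where "M = (SUP s\<in>{0..T}. exp (- (l * s)) * norm (apply_bcontfun (F y) s - apply_bcontfun (F' y') s))"
    have "bdd_above ((\<lambda>s. exp (- (l * s)) * norm (apply_bcontfun (F y) s - apply_bcontfun (F' y') s)) ` {0..T})"
      by (intro bdd_aboveI2[of _ _ "dist (F y) (F' y')"])
        (rule order_trans[OF e1[OF norm_ge_zero] norm_diff_apply_le])
    then have M1: "exp (- (l * s)) * norm (apply_bcontfun (F y) s - apply_bcontfun (F' y') s) \<le> M"
      if "s \<in> {0..T}" for s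
      unfolding M_def using that by (rule cSUP_upper2[of _ _ s]) auto
    have M: "norm (apply_bcontfun (F y) s - apply_bcontfun (F' y') s) \<le> M * exp (l * s)" if "s \<in> {0..T}" for s
      using M1[OF that] by (simp add: exp_minus field_simps)
    have M0: "M \<ge> 0" using order_trans[OF _ M1[of 0]] T by auto
    have d: "norm (drift \<Gamma> G (F y) s - drift \<Gamma> G' (F' y') s) \<le> L * (M + \<Delta>) * exp (l * s)"
      if s: "s \<in> {0..T}" for s
    proof -
      have "norm (drift \<Gamma> G (F y) s - drift \<Gamma> G' (F' y') s)
          \<le> L * (norm (apply_bcontfun (F y) s - apply_bcontfun (F' y') s) + D s)"
        unfolding D_def by (rule drift_diff_le[OF \<Gamma> G G' nint _ s]) (simp add: n_def)
      also have "\<dots> \<le> L * (M * exp (l * s) + \<Delta> * exp (l * s))"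
        using L M[OF s] \<Delta>[OF s] by (intro mult_left_mono add_mono) auto
      finally show ?thesis by (simp add: algebra_simps)
    qed
    have bound: "norm (apply_bcontfun (F y) t - apply_bcontfun (F' y') t)
        \<le> (dist y y' + (M + \<Delta>) / 8) * exp (l * t)" if t: "t \<in> {0..T}" for t
    proof -
      let ?I = "apply_bcontfun (int_path T (drift \<Gamma> G (F y))) t
          - apply_bcontfun (int_path T (drift \<Gamma> G' (F' y'))) t"
      have "norm ?I \<le> L * (M + \<Delta>) / l * (exp (l * t) - 1)"
        by (rule norm_int_path_diff_exp_le[OF T drift_integrable[OF \<Gamma> G] drift_integrable[OF \<Gamma> G'] l d t])
      also have "\<dots> \<le> (M + \<Delta>) / 8 * exp (l * t)"
        using L M0 \<Delta>0 by (simp add: l_def field_simps)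
      finally have I: "norm ?I \<le> (M + \<Delta>) / 8 * exp (l * t)" .
      have d1: "dist y y' \<le> dist y y' * exp (l * t)"
        using mult_left_mono[of 1 "exp (l * t)" "dist y y'"] l t by simp
      have "apply_bcontfun (F y) t - apply_bcontfun (F' y') t = (apply_bcontfun y t - apply_bcontfun y' t) + ?I"
        by (subst solution_mapD(3)[OF F y(1)], subst solution_mapD(3)[OF F' y(2)])
          (simp add: dr plus_bcontfun.rep_eq)
      then have "norm (apply_bcontfun (F y) t - apply_bcontfun (F' y') t)
          \<le> norm (apply_bcontfun y t - apply_bcontfun y' t) + norm ?I"
        using norm_triangle_ineq by metis
      also have "\<dots> \<le> dist y y' * exp (l * t) + (M + \<Delta>) / 8 * exp (l * t)"
        using norm_diff_apply_le[of y t y'] d1 I by linarith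
      finally show ?thesis by (simp add: algebra_simps)
    qed
    have "M \<le> dist y y' + (M + \<Delta>) / 8"
      unfolding M_def
    proof (rule cSUP_least)
      fix s assume "s \<in> {0..T}"
      from bound[OF this] show "exp (- (l * s)) * norm (apply_bcontfun (F y) s - apply_bcontfun (F' y') s)
          \<le> dist y y' + (Sup ((\<lambda>s. exp (- (l * s)) * norm (apply_bcontfun (F y) s - apply_bcontfun (F' y') s)) ` {0..T}) + \<Delta>) / 8"
        unfolding M_def[symmetric] by (simp add: exp_minus field_simps)
    qed (use T in auto)
    \<comment> \<open>Solving for \<open>M\<close> gives the coefficients \<open>8/7\<close> and
      \<open>1/7\<close>, rounded up to \<open>2\<close> and \<open>1/4\<close>.\<close>
    then have "M \<le> 2 * dist y y' + \<Delta> / 4"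
      using M0 by (simp add: field_simps)
    with M[OF t] show ?thesis by (simp add: mult.commute order_trans mult_left_mono)
  qed
  define c where "c = (\<integral>\<omega>. dist (Y \<omega>) (Y' \<omega>) powr p \<partial>\<Gamma>)"
  have c0: "c \<ge> 0" by (simp add: c_def)
  have dm: "(\<lambda>\<omega>. dist (Y \<omega>) (Y' \<omega>)) \<in> borel_measurable \<Gamma>" by (rule measurable_path_dist[OF T Ym])
  have dint: "integrable \<Gamma> (\<lambda>\<omega>. dist (Y \<omega>) (Y' \<omega>) powr p)"
  proof (rule integrable_powr_le)
    show "integrable \<Gamma> (\<lambda>\<omega>. (norm (Y \<omega>) + norm (Y' \<omega>)) powr p)"
      using Y Y' p measurable_path_norm[OF Ym(1)] measurable_path_norm[OF Ym(2)]
      by (intro integrable_powr_add) (auto simp: Lq_space_def)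
  qed (use p dm in \<open>auto simp: dist_norm intro: norm_triangle_ineq4\<close>)
  \<comment> \<open>Passing to \<open>p\<close>-th powers costs a factor \<open>2\<close> inside,
    which turns \<open>\<Delta> / 4\<close> into \<open>\<Delta> / 2\<close>. Since
    \<open>1 \<le> p\<close>, its \<open>p\<close>-th power is at most half of
    \<open>\<Delta> powr p\<close> and can be absorbed on the left; this is the reason for the large
    weight \<open>8 * L\<close>.\<close>
  define R where "R = 4 powr p * c + (\<Delta> / 2) powr p"
  have "exp (- (l * s)) * D s \<le> R powr (1 / p)" if s: "s \<in> {0..T}" for s
  proof -
    have le: "(exp (- (l * s)) * n s \<omega>) powr p \<le> 4 powr p * dist (Y \<omega>) (Y' \<omega>) powr p + (\<Delta> / 2) powr p"
      if "\<omega> \<in> space \<Gamma>" for \<omega>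
    proof -
      have "exp (- (l * s)) * n s \<omega> \<le> 2 * dist (Y \<omega>) (Y' \<omega>) + \<Delta> / 4"
        using pw[OF YS[OF that] s] unfolding n_def G_def G'_def by (simp add: exp_minus field_simps)
      then have "(exp (- (l * s)) * n s \<omega>) powr p \<le> (2 * dist (Y \<omega>) (Y' \<omega>) + \<Delta> / 4) powr p"
        using p n0 by (intro powr_mono2) auto
      also have "\<dots> \<le> 2 powr p * ((2 * dist (Y \<omega>) (Y' \<omega>)) powr p + (\<Delta> / 4) powr p)"
        using \<Delta>0 p by (intro powr_add_le) auto
      also have "\<dots> = (2 * (2 * dist (Y \<omega>) (Y' \<omega>))) powr p + (2 * (\<Delta> / 4)) powr p"
        using \<Delta>0 by (simp only: distrib_left powr_mult)
      also have "\<dots> = 4 powr p * dist (Y \<omega>) (Y' \<omega>) powr p + (\<Delta> / 2) powr p"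
        using powr_mult[of 4 "dist (Y \<omega>) (Y' \<omega>)" p] by simp
      finally show ?thesis .
    qed
    have "exp (- (l * s)) * D s = (\<integral>\<omega>. (exp (- (l * s)) * n s \<omega>) powr p \<partial>\<Gamma>) powr (1 / p)"
      unfolding D_def using p n0 by (intro Lp_norm_cmult[symmetric]) auto
    also have "\<dots> \<le> (\<integral>\<omega>. 4 powr p * dist (Y \<omega>) (Y' \<omega>) powr p + (\<Delta> / 2) powr p \<partial>\<Gamma>) powr (1 / p)"
      using p le n0 dint by (intro powr_mono2 integral_mono integrable_cmult_powr nint) auto
    also have "(\<integral>\<omega>. 4 powr p * dist (Y \<omega>) (Y' \<omega>) powr p + (\<Delta> / 2) powr p \<partial>\<Gamma>) = R"
      using dint by (simp add: R_def c_def \<Gamma>.prob_space)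
    finally show ?thesis .
  qed
  then have "\<Delta> \<le> R powr (1 / p)" unfolding \<Delta>_def using T by (intro cSUP_least) auto
  then have "\<Delta> powr p \<le> (R powr (1 / p)) powr p" using \<Delta>0 p by (intro powr_mono2) auto
  also have "\<dots> = R" using p c0 by (simp add: powr_powr R_def)
  finally have 1: "\<Delta> powr p \<le> 4 powr p * c + (\<Delta> / 2) powr p" by (simp add: R_def)
  have "(\<Delta> / 2) powr p = (1 / 2) powr p * \<Delta> powr p" using \<Delta>0 powr_mult[of "1/2" \<Delta> p] by simp
  also have "(1 / 2 :: real) powr p \<le> (1 / 2) powr 1" using p by (intro powr_mono') auto
  finally have "(\<Delta> / 2) powr p \<le> \<Delta> powr p / 2" by (simp add: mult_right_mono)
  with 1 have "\<Delta> powr p \<le> 2 * (4 powr p * c)" by linarith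
  also have "\<dots> \<le> 2 powr p * (4 powr p * c)"
    using c0 p powr_mono[of 1 p "2::real"] by (intro mult_right_mono) auto
  also have "\<dots> = 8 powr p * c" using powr_mult[of 2 4 p] by simp
  finally have "\<Delta> \<le> (8 powr p * c) powr (1 / p)" using \<Delta>0 p by (intro le_powr_inverseI) auto
  also have "\<dots> = 8 * c powr (1 / p)" using c0 p by (simp add: powr_mult powr_powr)
  \<comment> \<open>So \<open>\<Delta> / 4\<close> is at most \<open>2 * c powr (1 / p)\<close>, the
    second term of the conclusion.\<close>
  finally have \<Delta>8: "\<Delta> \<le> 8 * c powr (1 / p)" .
  show ?thesis
  proof (rule dist_path_le[OF T solution_mapD(2)[OF F y] solution_mapD(2)[OF F' y']])
    fix t assume t: "t \<in> {0..T}"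
    have "norm (apply_bcontfun (F y) t - apply_bcontfun (F' y') t) \<le> exp (l * t) * (2 * dist y y' + \<Delta> / 4)"
      by (rule pw[OF y y' t])
    also have "\<dots> \<le> exp (l * T) * (2 * dist y y' + 2 * c powr (1 / p))"
      using t l \<Delta>8 \<Delta>0 by (intro mult_mono) auto
    finally show "norm (apply_bcontfun (F y) t - apply_bcontfun (F' y') t) \<le> exp (8 * L * T) *
        (2 * dist y y' + 2 * (\<integral>\<omega>. dist (Y \<omega>) (Y' \<omega>) powr p \<partial>\<Gamma>) powr (1 / p))"
      by (simp add: l_def c_def)
  qed
qed

text \<open>The choice is harmless: by the stability lemma with \<open>Y = Y'\<close>, two solution
  maps for the same law in \<open>prob_moment p PB\<close> agree on
  \<open>path_space T\<close>.\<close>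

definition sol :: "'d path measure \<Rightarrow> 'd path \<Rightarrow> 'd path" where
  "sol m = (SOME F. solution_map m F)"

lemma solution_map_sol: "m \<in> prob_moment p PB \<Longrightarrow> solution_map m (sol m)"
  unfolding sol_def by (rule someI_ex[of "solution_map m"]) (rule exists_solution_map)

lemma sol_in_path_space: "m \<in> prob_moment p PB \<Longrightarrow> y \<in> PS \<Longrightarrow> sol m y \<in> PS"
  by (rule solution_mapD(2)[OF solution_map_sol])

lemma sol_measurable: "m \<in> prob_moment p PB \<Longrightarrow> sol m \<in> measurable PB PB"
  by (rule lipschitz_path_map_measurable[OF solution_mapD(1)[OF solution_map_sol]])

lemma sol_Lq:
  "prob_space \<Gamma> \<Longrightarrow> Y \<in> Lq_space \<Gamma> p PB \<Longrightarrow> m \<in> prob_moment p PB \<Longrightarrow> (\<lambda>\<omega>. sol m (Y \<omega>)) \<in> Lq_space \<Gamma> p PB"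
  using p by (intro Lq_path_compose[OF _ _ solution_mapD(1)[OF solution_map_sol]]) (auto simp: prob_space_def)

lemma sol_integral_equation:
  assumes m: "m \<in> prob_moment p PB" and w: "w \<in> PS"
  shows "integral_equation T (drift m (sol m) (sol m (const_bcontfun x0 + w))) x0 w
    (sol m (const_bcontfun x0 + w))"
proof -
  let ?y = "const_bcontfun x0 + w"
  note m' = prob_momentD[OF m]
  have y: "?y \<in> PS" using w by simp
  have i: "set_integrable lborel {0..T} (drift m (sol m) (sol m ?y))"
    by (rule drift_integrable[OF m'(1)]) (rule sol_Lq[OF m'(1) m'(6) m])
  have "apply_bcontfun (sol m ?y) t = x0 + (LINT s:{0..t}|lborel. drift m (sol m) (sol m ?y) s) + apply_bcontfun w t"
    if "t \<in> {0..T}" for t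
    by (subst solution_mapD(3)[OF solution_map_sol[OF m] y])
      (use that in \<open>simp add: plus_bcontfun.rep_eq const_bcontfun.rep_eq int_path_apply[OF T i]\<close>)
  with i show ?thesis by (simp add: integral_equation_def)
qed

lemma sol_stable:
  assumes \<Gamma>: "prob_space \<Gamma>" and Y: "Y \<in> Lq_space \<Gamma> p PB" "Y' \<in> Lq_space \<Gamma> p PB"
    and y: "y \<in> PS" "y' \<in> PS"
  shows "dist (sol (distr \<Gamma> PB Y) y) (sol (distr \<Gamma> PB Y') y') \<le> exp (8 * L * T) *
    (2 * dist y y' + 2 * (\<integral>\<omega>. dist (Y \<omega>) (Y' \<omega>) powr p \<partial>\<Gamma>) powr (1 / p))"
  using assms by (intro solution_map_stable solution_map_sol Lq_prob_moment)

text \<open>The solutions driven by \<open>Y\<close> and \<open>Y'\<close> are both defined on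
  \<open>\<Gamma>\<close>, so their pair is a coupling; integrating the pointwise stability estimate
  gives its cost. The distance of the driving laws occurs in the pointwise estimate as well, so both
  terms contribute a multiple of \<open>c powr (1 / p)\<close>.\<close>

lemma wasserstein_sol_le:
  assumes \<Gamma>: "prob_space \<Gamma>" and Y: "Y \<in> Lq_space \<Gamma> p PB" "Y' \<in> Lq_space \<Gamma> p PB"
  shows "wasserstein p (distr \<Gamma> PB (\<lambda>\<omega>. sol (distr \<Gamma> PB Y) (Y \<omega>))) (distr \<Gamma> PB (\<lambda>\<omega>. sol (distr \<Gamma> PB Y') (Y' \<omega>)))
    \<le> ennreal (exp (8 * L * T) * 8 * (\<integral>\<omega>. dist (Y \<omega>) (Y' \<omega>) powr p \<partial>\<Gamma>) powr (1 / p))"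
proof -
  interpret \<Gamma>: prob_space \<Gamma> by fact
  define c where "c = (\<integral>\<omega>. dist (Y \<omega>) (Y' \<omega>) powr p \<partial>\<Gamma>)"
  let ?E = "exp (8 * L * T)"
  let ?X = "\<lambda>\<omega>. sol (distr \<Gamma> PB Y) (Y \<omega>)" and ?X' = "\<lambda>\<omega>. sol (distr \<Gamma> PB Y') (Y' \<omega>)"
  have Ym: "Y \<in> measurable \<Gamma> PB" "Y' \<in> measurable \<Gamma> PB" using Y by (auto simp: Lq_space_def)
  have YS: "Y \<omega> \<in> PS" "Y' \<omega> \<in> PS" if "\<omega> \<in> space \<Gamma>" for \<omega>
    using measurable_space[OF Ym(1) that] measurable_space[OF Ym(2) that] by auto
  have c0: "c \<ge> 0" by (simp add: c_def)
  have dm: "(\<lambda>\<omega>. dist (Y \<omega>) (Y' \<omega>)) \<in> borel_measurable \<Gamma>" by (rule measurable_path_dist[OF T Ym])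
  have dint: "integrable \<Gamma> (\<lambda>\<omega>. dist (Y \<omega>) (Y' \<omega>) powr p)"
  proof (rule integrable_powr_le)
    show "integrable \<Gamma> (\<lambda>\<omega>. (norm (Y \<omega>) + norm (Y' \<omega>)) powr p)"
      using Y p measurable_path_norm[OF Ym(1)] measurable_path_norm[OF Ym(2)]
      by (intro integrable_powr_add) (auto simp: Lq_space_def)
  qed (use p dm in \<open>auto simp: dist_norm intro: norm_triangle_ineq4\<close>)
  have Xm: "?X \<in> measurable \<Gamma> PB" "?X' \<in> measurable \<Gamma> PB"
    by (rule measurable_compose[OF Ym(1) sol_measurable[OF Lq_prob_moment[OF \<Gamma> Y(1)]]]
        measurable_compose[OF Ym(2) sol_measurable[OF Lq_prob_moment[OF \<Gamma> Y(2)]]])+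
  have le: "dist (?X \<omega>) (?X' \<omega>) powr p \<le> (4 * ?E) powr p * (dist (Y \<omega>) (Y' \<omega>) powr p + c)"
    if "\<omega> \<in> space \<Gamma>" for \<omega>
  proof -
    have "dist (?X \<omega>) (?X' \<omega>) powr p \<le> ((2 * ?E) * (dist (Y \<omega>) (Y' \<omega>) + c powr (1 / p))) powr p"
      using sol_stable[OF \<Gamma> Y YS[OF that]] p
      by (intro powr_mono2) (auto simp: c_def algebra_simps)
    also have "\<dots> = (2 * ?E) powr p * (dist (Y \<omega>) (Y' \<omega>) + c powr (1 / p)) powr p"
      by (subst powr_mult) auto
    also have "\<dots> \<le> (2 * ?E) powr p * (2 powr p * (dist (Y \<omega>) (Y' \<omega>) powr p + (c powr (1 / p)) powr p))"
      using p by (intro mult_left_mono powr_add_le) auto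
    also have "\<dots> = (2 * ?E * 2) powr p * (dist (Y \<omega>) (Y' \<omega>) powr p + c)"
      using p c0 by (simp only: powr_mult mult.assoc) (simp add: powr_powr)
    finally show ?thesis by (simp add: mult.commute)
  qed
  have xint: "integrable \<Gamma> (\<lambda>\<omega>. dist (?X \<omega>) (?X' \<omega>) powr p)"
  proof (rule Bochner_Integration.integrable_bound)
    show "integrable \<Gamma> (\<lambda>\<omega>. (4 * ?E) powr p * (dist (Y \<omega>) (Y' \<omega>) powr p + c))" using dint by simp
    show "(\<lambda>\<omega>. dist (?X \<omega>) (?X' \<omega>) powr p) \<in> borel_measurable \<Gamma>"
      using measurable_path_dist[OF T Xm] by measurable
  qed (use le c0 in \<open>auto intro!: AE_I2\<close>)
  have "(\<integral>\<omega>. dist (?X \<omega>) (?X' \<omega>) powr p \<partial>\<Gamma>) \<le> (\<integral>\<omega>. (4 * ?E) powr p * (dist (Y \<omega>) (Y' \<omega>) powr p + c) \<partial>\<Gamma>)"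
    by (rule integral_mono[OF xint _ le]) (use dint in simp)
  also have "\<dots> = (4 * ?E) powr p * (2 * c)" using dint by (simp add: c_def \<Gamma>.prob_space)
  also have "\<dots> \<le> (4 * ?E) powr p * (2 powr p * c)"
    using c0 p powr_mono[of 1 p "2::real"] by (intro mult_left_mono mult_right_mono) auto
  also have "\<dots> = (4 * ?E * 2 * c powr (1 / p)) powr p"
    using p c0 by (simp only: powr_mult mult.assoc) (simp add: powr_powr)
  finally have "(\<integral>\<omega>. dist (?X \<omega>) (?X' \<omega>) powr p \<partial>\<Gamma>) powr (1 / p) \<le> 4 * ?E * 2 * c powr (1 / p)"
    using p by (intro powr_inverse_le) auto
  then have "ennreal ((\<integral>\<omega>. dist (?X \<omega>) (?X' \<omega>) powr p \<partial>\<Gamma>) powr (1 / p)) \<le> ennreal (?E * 8 * c powr (1 / p))"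
    by (intro ennreal_leI) (simp add: algebra_simps)
  with wasserstein_distr_le[OF Xm dist_measurable_path[OF T] xint] show ?thesis
    unfolding c_def by (rule order_trans)
qed

text \<open>Comparison with the solution driven by the zero path under the Dirac mass at zero. The
  bound depends on \<open>m\<close> only through its \<open>p\<close>-th moment, which matters for
  empirical laws, as these are random.\<close>

lemma norm_sol_le:
  assumes m: "m \<in> prob_moment p PB" and y: "y \<in> PS"
  shows "norm (sol m y) \<le> norm (sol (return PB 0) 0)
    + exp (8 * L * T) * (2 * norm y + 2 * (\<integral>x. norm x powr p \<partial>m) powr (1 / p))"
proof -
  note m' = prob_momentD[OF m]
  have "dist (sol (distr m PB (\<lambda>x. x)) y) (sol (distr m PB (\<lambda>_. 0)) 0) \<le> exp (8 * L * T) *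
      (2 * dist y 0 + 2 * (\<integral>x. dist x 0 powr p \<partial>m) powr (1 / p))"
    by (rule sol_stable[OF m'(1) m'(6) Lq_path_const[OF m'(2)] y]) auto
  moreover have "distr m PB (\<lambda>x. x) = m" by (rule distr_id2[OF m'(3)[symmetric]])
  moreover have "distr m PB (\<lambda>_. 0) = return PB 0" by (rule prob_space.distr_const[OF m'(1)]) simp
  ultimately have "dist (sol m y) (sol (return PB 0) 0)
      \<le> exp (8 * L * T) * (2 * norm y + 2 * (\<integral>x. norm x powr p \<partial>m) powr (1 / p))"
    by simp
  then show ?thesis
    using norm_triangle_sub[of "sol m y" "sol (return PB 0) 0"] by (simp add: dist_norm)
qed

end

section \<open>Driving laws translated by a common path\<close>

text \<open>A crude form of Minkowski's inequality; two factors \<open>2\<close>, from splitting and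
  from recombining \<open>p\<close>-th powers, give the constant \<open>4\<close>.\<close>

lemma Lp_norm_add_const_le:
  fixes f :: "'w \<Rightarrow> real"
  assumes M: "prob_space M" and p: "1 \<le> p" and int: "integrable M (\<lambda>\<omega>. f \<omega> powr p)"
    and m: "f \<in> borel_measurable M" and f0: "\<And>\<omega>. \<omega> \<in> space M \<Longrightarrow> 0 \<le> f \<omega>" and c: "0 \<le> c"
  shows "(\<integral>\<omega>. (f \<omega> + c) powr p \<partial>M) powr (1 / p) \<le> 4 * ((\<integral>\<omega>. f \<omega> powr p \<partial>M) powr (1 / p) + c)"
proof -
  interpret prob_space M by fact
  define A where "A = (\<integral>\<omega>. f \<omega> powr p \<partial>M)"
  define a where "a = A powr (1 / p)"
  have A0: "0 \<le> A" by (simp add: A_def)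
  have a: "0 \<le> a" "A = a powr p" using A0 p by (auto simp: a_def powr_powr)
  have "(\<integral>\<omega>. (f \<omega> + c) powr p \<partial>M) \<le> (\<integral>\<omega>. 2 powr p * (f \<omega> powr p + c powr p) \<partial>M)"
  proof (rule integral_mono)
    show "integrable M (\<lambda>\<omega>. (f \<omega> + c) powr p)"
      by (rule integrable_powr_add[OF int _ m _ _ f0]) (use c p in simp_all)
    show "integrable M (\<lambda>\<omega>. 2 powr p * (f \<omega> powr p + c powr p))" using int by simp
    show "(f \<omega> + c) powr p \<le> 2 powr p * (f \<omega> powr p + c powr p)" if "\<omega> \<in> space M" for \<omega>
      using f0[OF that] c p by (intro powr_add_le) auto
  qed
  also have "\<dots> = 2 powr p * (a powr p + c powr p)"
    using int by (simp add: prob_space A_def[symmetric] a)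
  also have "\<dots> \<le> 2 powr p * (2 * (a + c) powr p)"
  proof (rule mult_left_mono)
    have "a powr p \<le> (a + c) powr p" "c powr p \<le> (a + c) powr p"
      using a(1) c p by (intro powr_mono2; simp)+
    then show "a powr p + c powr p \<le> 2 * (a + c) powr p" by linarith
  qed simp
  also have "\<dots> \<le> 2 powr p * (2 powr p * (a + c) powr p)"
    using p powr_mono[of 1 p "2::real"] by (intro mult_left_mono mult_right_mono) auto
  also have "\<dots> = (2 * 2 * (a + c)) powr p" using a c by (simp only: powr_mult mult.assoc)
  finally show ?thesis
    using a c p unfolding A_def[symmetric] a_def[symmetric] by (intro powr_inverse_le) auto
qed

context mean_field_drift
begin

definition msol :: "'d path measure \<Rightarrow> 'd path \<Rightarrow> 'd path \<Rightarrow> 'd path" where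
  "msol m \<beta> v = sol (distr m PB (\<lambda>v. v + \<beta>)) (v + \<beta>)"

lemma Lq_shift:
  assumes "prob_space \<Gamma>" "Y \<in> Lq_space \<Gamma> p PB" "\<beta> \<in> PS"
  shows "(\<lambda>\<omega>. Y \<omega> + \<beta>) \<in> Lq_space \<Gamma> p PB"
  using assms p T by (intro Lq_path_add Lq_path_const) (auto simp: prob_space_def)

lemma distr_shift:
  assumes Y: "Y \<in> measurable \<Gamma> PB" and \<beta>: "\<beta> \<in> PS"
  shows "distr (distr \<Gamma> PB Y) PB (\<lambda>v. v + \<beta>) = distr \<Gamma> PB (\<lambda>\<omega>. Y \<omega> + \<beta>)"
  using \<beta> by (subst distr_distr[OF measurable_path_add[OF T] Y]) (auto simp: comp_def)

lemma shift_prob_moment: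
  assumes m: "m \<in> prob_moment p PB" and \<beta>: "\<beta> \<in> PS"
  shows "distr m PB (\<lambda>v. v + \<beta>) \<in> prob_moment p PB"
  by (rule Lq_prob_moment[OF prob_momentD(1)[OF m] Lq_shift[OF prob_momentD(1,6)[OF m] \<beta>]])

lemma msol_in_path_space:
  "m \<in> prob_moment p PB \<Longrightarrow> \<beta> \<in> PS \<Longrightarrow> v \<in> PS \<Longrightarrow> msol m \<beta> v \<in> PS"
  unfolding msol_def by (intro sol_in_path_space shift_prob_moment) auto

lemma msol_measurable:
  assumes "m \<in> prob_moment p PB" "\<beta> \<in> PS"
  shows "msol m \<beta> \<in> measurable PB PB"
  unfolding msol_def[abs_def]
  by (rule measurable_compose[OF measurable_path_add[OF T] sol_measurable[OF shift_prob_moment[OF assms]]])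
    (use assms in auto)

text \<open>The translation disappears from the measure argument: solving under the translated law
  and pushing \<open>m\<close> through \<open>msol m \<beta>\<close> give the same marginals. This
  image of \<open>m\<close> becomes the conditional law.\<close>

lemma msol_integral_equation:
  assumes m: "m \<in> prob_moment p PB" and \<beta>: "\<beta> \<in> PS" and w: "w \<in> PS"
    and x: "x = msol m \<beta> (const_bcontfun x0 + w)"
  shows "integral_equation T
    (\<lambda>s. b s (apply_bcontfun x s) (distr (distr m PB (msol m \<beta>)) borel (\<lambda>f. apply_bcontfun f s)))
    x0 (w + \<beta>) x"
proof -
  let ?m = "distr m PB (\<lambda>v. v + \<beta>)"
  note m\<beta> = shift_prob_moment[OF m \<beta>]
  have mm: "f \<in> measurable m PB" if "f \<in> measurable PB PB" for f
    using that by (simp cong: measurable_cong_sets add: prob_momentD(3)[OF m])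
  have add: "(\<lambda>v. v + \<beta>) \<in> measurable m PB" using \<beta> by (intro mm measurable_path_add[OF T]) auto
  have "marginal ?m (sol ?m) s = distr (distr m PB (msol m \<beta>)) borel (\<lambda>f. apply_bcontfun f s)" for s
    unfolding marginal_distr[OF add sol_measurable[OF m\<beta>]] marginal_def
    by (subst distr_distr[OF measurable_path_apply mm[OF msol_measurable[OF m \<beta>]]])
      (simp add: comp_def msol_def)
  then have "drift ?m (sol ?m) x = (\<lambda>s. b s (apply_bcontfun x s)
      (distr (distr m PB (msol m \<beta>)) borel (\<lambda>f. apply_bcontfun f s)))"
    by (simp add: drift_def fun_eq_iff)
  moreover have "x = sol ?m (const_bcontfun x0 + (w + \<beta>))" by (simp add: x msol_def add.assoc)
  ultimately show ?thesis
    using sol_integral_equation[OF m\<beta>, of "w + \<beta>" x0] w \<beta> by simp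
qed

lemma msol_stable:
  assumes \<Gamma>: "prob_space \<Gamma>" and Y: "Y \<in> Lq_space \<Gamma> p PB" "Y' \<in> Lq_space \<Gamma> p PB"
    and "\<beta> \<in> PS" "\<beta>' \<in> PS" "v \<in> PS" "v' \<in> PS"
  shows "dist (msol (distr \<Gamma> PB Y) \<beta> v) (msol (distr \<Gamma> PB Y') \<beta>' v') \<le> exp (8 * L * T) *
    (2 * dist (v + \<beta>) (v' + \<beta>') + 2 * (\<integral>\<omega>. dist (Y \<omega> + \<beta>) (Y' \<omega> + \<beta>') powr p \<partial>\<Gamma>) powr (1 / p))"
proof -
  have m: "Y \<in> measurable \<Gamma> PB" "Y' \<in> measurable \<Gamma> PB" using Y by (auto simp: Lq_space_def)
  show ?thesis
    unfolding msol_def distr_shift[OF m(1) assms(4)] distr_shift[OF m(2) assms(5)]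
    by (rule sol_stable[OF \<Gamma> Lq_shift[OF \<Gamma> Y(1) assms(4)] Lq_shift[OF \<Gamma> Y(2) assms(5)]])
      (use assms in auto)
qed

lemma norm_msol_le:
  assumes m: "m \<in> prob_moment p PB" and \<beta>: "\<beta> \<in> PS" and v: "v \<in> PS"
  shows "norm (msol m \<beta> v) \<le> norm (sol (return PB 0) 0)
    + 10 * exp (8 * L * T) * (norm v + norm \<beta> + (\<integral>x. norm x powr p \<partial>m) powr (1 / p))"
proof -
  note m' = prob_momentD[OF m]
  define A where "A = (\<integral>x. norm x powr p \<partial>m) powr (1 / p)"
  have A: "A \<ge> 0" by (simp add: A_def)
  let ?m = "distr m PB (\<lambda>v. v + \<beta>)"
  have add: "(\<lambda>v. v + \<beta>) \<in> measurable m PB"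
    using Lq_shift[OF m'(1,6) \<beta>] by (simp add: Lq_space_def)
  have nm: "(\<lambda>x. norm x powr p) \<in> borel_measurable PB" "norm \<in> borel_measurable m"
    using measurable_path_norm[of "\<lambda>x. x" PB T] measurable_path_norm[of "\<lambda>x. x" m T] m'(6)
    by (auto simp: Lq_space_def)
  have i: "integrable m (\<lambda>x. norm (x + \<beta>) powr p)"
    using Lq_shift[OF m'(1,6) \<beta>] by (simp add: Lq_space_def)
  have i2: "integrable m (\<lambda>x. (norm x + norm \<beta>) powr p)"
    using m' nm p by (intro integrable_powr_add) (auto intro: finite_measure.integrable_const)
  have "(\<integral>x. norm x powr p \<partial>?m) = (\<integral>x. norm (x + \<beta>) powr p \<partial>m)"
    by (rule integral_distr[OF add nm(1)])
  also have "\<dots> \<le> (\<integral>x. (norm x + norm \<beta>) powr p \<partial>m)"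
    using p by (intro integral_mono i i2 powr_mono2 norm_triangle_ineq) auto
  finally have "(\<integral>x. norm x powr p \<partial>?m) powr (1 / p) \<le> (\<integral>x. (norm x + norm \<beta>) powr p \<partial>m) powr (1 / p)"
    using p by (intro powr_mono2) auto
  also have "\<dots> \<le> 4 * (A + norm \<beta>)"
    unfolding A_def by (rule Lp_norm_add_const_le[OF m'(1) p m'(5) nm(2)]) auto
  finally have 1: "(\<integral>x. norm x powr p \<partial>?m) powr (1 / p) \<le> 4 * (A + norm \<beta>)" .
  have "norm (msol m \<beta> v) \<le> norm (sol (return PB 0) 0)
    + exp (8 * L * T) * (2 * norm (v + \<beta>) + 2 * (\<integral>x. norm x powr p \<partial>?m) powr (1 / p))"
    unfolding msol_def using v \<beta> by (intro norm_sol_le[OF shift_prob_moment[OF m \<beta>]]) auto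
  \<comment> \<open>The integral term contributes \<open>8 * (A + norm \<beta>)\<close> and the
    argument \<open>2 * (norm v + norm \<beta>)\<close>; \<open>10\<close> dominates all
    coefficients.\<close>
  also have "\<dots> \<le> norm (sol (return PB 0) 0) + exp (8 * L * T) * (10 * (norm v + norm \<beta> + A))"
  proof (intro add_left_mono mult_left_mono)
    have "norm (v + \<beta>) \<le> norm v + norm \<beta>" by (rule norm_triangle_ineq)
    with 1 A norm_ge_zero[of v]
    show "2 * norm (v + \<beta>) + 2 * (\<integral>x. norm x powr p \<partial>?m) powr (1 / p) \<le> 10 * (norm v + norm \<beta> + A)"
      unfolding distrib_left by linarith
  qed simp
  finally show ?thesis by (simp add: A_def algebra_simps)
qed

text \<open>\<open>h\<close> stands for the size of the driving law: constant for the mean field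
  equation, random for the empirical law of the particle system.\<close>

lemma Lq_dominated:
  fixes X V B :: "'w \<Rightarrow> 'd path" and h :: "'w \<Rightarrow> real"
  assumes M: "finite_measure M" and X: "X \<in> measurable M PB"
    and V: "V \<in> Lq_space M p PB" and B: "B \<in> Lq_space M p PB"
    and h: "h \<in> borel_measurable M" "integrable M (\<lambda>\<omega>. h \<omega> powr p)" "\<And>\<omega>. 0 \<le> h \<omega>"
    and c: "0 \<le> c" "0 \<le> c'"
    and le: "\<And>\<omega>. \<omega> \<in> space M \<Longrightarrow> norm (X \<omega>) \<le> c + c' * (norm (V \<omega>) + norm (B \<omega>) + h \<omega>)"
  shows "X \<in> Lq_space M p PB"
proof -
  have m: "(\<lambda>\<omega>. norm (V \<omega>)) \<in> borel_measurable M" "(\<lambda>\<omega>. norm (B \<omega>)) \<in> borel_measurable M"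
    using V B by (auto simp: Lq_space_def intro: measurable_path_norm)
  have "integrable M (\<lambda>\<omega>. (c + c' * (norm (V \<omega>) + norm (B \<omega>) + h \<omega>)) powr p)"
    using V B m h c p finite_measure.integrable_const[OF M]
    by (intro integrable_powr_add integrable_cmult_powr) (auto simp: Lq_space_def)
  from integrable_powr_le[OF this measurable_path_norm[OF X]] le X p show ?thesis
    by (auto simp: Lq_space_def)
qed

text \<open>Joint measurability in \<open>\<beta>\<close> and \<open>v\<close> is needed to
  substitute two random paths and to condition; it follows from joint sequential continuity, since
  the stability bound covers a change of both arguments. The type \<open>bool\<close> indexes the
  two.\<close>

lemma msol_compose_measurable:
  assumes m: "m \<in> prob_moment p PB" and B: "B \<in> measurable M PB" and V: "V \<in> measurable M PB"
  shows "(\<lambda>\<omega>. msol m (B \<omega>) (V \<omega>)) \<in> measurable M PB"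
proof (rule measurable_path_borelI)
  note m' = prob_momentD[OF m]
  have id: "distr m PB (\<lambda>x. x) = m" by (rule distr_id2[OF m'(3)[symmetric]])
  have "(\<lambda>\<omega>. (\<lambda>h. msol m (h True) (h False)) (\<lambda>i. (if i then B else V) \<omega>)) \<in> borel_measurable M"
  proof (rule measurable_path_seq_continuous_family[OF T, where I = UNIV
        and f = "\<lambda>h. msol m (h True) (h False)" and Y = "\<lambda>i. if i then B else V"])
    fix u and y :: "bool \<Rightarrow> 'd path"
    assume u: "\<And>n i. i \<in> UNIV \<Longrightarrow> u n i \<in> PS" and y: "\<And>i. i \<in> UNIV \<Longrightarrow> y i \<in> PS"
      and lim: "\<And>i. i \<in> UNIV \<Longrightarrow> (\<lambda>n. u n i) \<longlonglongrightarrow> y i"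
    let ?E = "exp (8 * L * T)"
    have le: "dist (msol m (u n True) (u n False)) (msol m (y True) (y False))
        \<le> ?E * (2 * dist (u n False + u n True) (y False + y True) + 2 * dist (u n True) (y True))" for n
    proof -
      \<comment> \<open>Translating the same law by two paths displaces every point by the same
        distance, so the law term is the distance of the translations.\<close>
      have "(\<integral>x. dist (x + u n True) (x + y True) powr p \<partial>m) powr (1 / p) = dist (u n True) (y True)"
        using p by (simp add: dist_norm prob_space.prob_space[OF m'(1)] powr_powr)
      with msol_stable[OF m'(1) m'(6) m'(6), of "u n True" "y True" "u n False" "y False"] u y
      show ?thesis by (simp add: id)
    qed
    have "(\<lambda>n. dist (u n False + u n True) (y False + y True)) \<longlonglongrightarrow> dist (y False + y True) (y False + y True)"
      by (intro tendsto_dist tendsto_add lim tendsto_const) auto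
    moreover have "(\<lambda>n. dist (u n True) (y True)) \<longlonglongrightarrow> dist (y True) (y True)"
      by (intro tendsto_dist lim tendsto_const) auto
    ultimately have "(\<lambda>n. ?E * (2 * dist (u n False + u n True) (y False + y True) + 2 * dist (u n True) (y True)))
        \<longlonglongrightarrow> ?E * (2 * dist (y False + y True) (y False + y True) + 2 * dist (y True) (y True))"
      using lim by (intro tendsto_intros) auto
    then have E: "(\<lambda>n. ?E * (2 * dist (u n False + u n True) (y False + y True) + 2 * dist (u n True) (y True))) \<longlonglongrightarrow> 0"
      by simp
    have "(\<lambda>n. dist (msol m (u n True) (u n False)) (msol m (y True) (y False))) \<longlonglongrightarrow> 0"
      by (rule Lim_null_comparison[OF always_eventually E]) (use le in simp)
    then show "(\<lambda>n. msol m (u n True) (u n False)) \<longlonglongrightarrow> msol m (y True) (y False)"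
      by (subst tendsto_dist_iff)
  qed (use B V in auto)
  then show "(\<lambda>\<omega>. msol m (B \<omega>) (V \<omega>)) \<in> borel_measurable M" by simp
next
  fix \<omega> assume "\<omega> \<in> space M"
  then show "msol m (B \<omega>) (V \<omega>) \<in> PS"
    using measurable_space[OF B] measurable_space[OF V] by (intro msol_in_path_space[OF m]) auto
qed

lemma msol_compose_Lq:
  assumes m: "m \<in> prob_moment p PB" and M: "finite_measure M"
    and B: "B \<in> Lq_space M p PB" and V: "V \<in> Lq_space M p PB"
  shows "(\<lambda>\<omega>. msol m (B \<omega>) (V \<omega>)) \<in> Lq_space M p PB"
proof -
  have mB: "B \<in> measurable M PB" and mV: "V \<in> measurable M PB" using B V by (auto simp: Lq_space_def)
  show ?thesis
  proof (rule Lq_dominated[OF M msol_compose_measurable[OF m mB mV] V B, of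
        "\<lambda>_. (\<integral>x. norm x powr p \<partial>m) powr (1 / p)" "norm (sol (return PB 0) 0)" "10 * exp (8 * L * T)"])
    fix \<omega> assume "\<omega> \<in> space M"
    then show "norm (msol m (B \<omega>) (V \<omega>)) \<le> norm (sol (return PB 0) 0)
      + 10 * exp (8 * L * T) * (norm (V \<omega>) + norm (B \<omega>) + (\<integral>x. norm x powr p \<partial>m) powr (1 / p))"
      using measurable_space[OF mB] measurable_space[OF mV] by (intro norm_msol_le[OF m]) auto
  qed (auto intro: finite_measure.integrable_const[OF M])
qed

section \<open>The particle system under the uniform measure on indices\<close>

lemma uniform_Lq:
  fixes y :: "nat \<Rightarrow> 'd path"
  assumes "\<And>i. i \<in> {1..N} \<Longrightarrow> y i \<in> PS"
  shows "y \<in> Lq_space (uniform_count_measure {1..N}) p PB"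
  using assms measurable_uniform_count_Icc[of N y PB] integrable_uniform_count_Icc
  by (simp add: Lq_space_def)

lemma uniform_prob_moment:
  fixes y :: "nat \<Rightarrow> 'd path"
  assumes "N \<ge> 1" "\<And>i. i \<in> {1..N} \<Longrightarrow> y i \<in> PS"
  shows "distr (uniform_count_measure {1..N}) PB y \<in> prob_moment p PB"
  by (rule Lq_prob_moment[OF prob_space_uniform_count_Icc[OF assms(1)] uniform_Lq[OF assms(2)]])

definition particle :: "nat \<Rightarrow> (nat \<Rightarrow> 'd path) \<Rightarrow> 'd path \<Rightarrow> nat \<Rightarrow> 'd path" where
  "particle N v \<beta> i = msol (distr (uniform_count_measure {1..N}) PB v) \<beta> (v i)"

lemma particle_in_path_space:
  assumes "N \<ge> 1" "\<And>i. i \<in> {1..N} \<Longrightarrow> v i \<in> PS" "\<beta> \<in> PS" "i \<in> {1..N}"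
  shows "particle N v \<beta> i \<in> PS"
  unfolding particle_def using assms by (intro msol_in_path_space uniform_prob_moment) auto

text \<open>Pushing the empirical law of the driving paths through the solution map yields the
  empirical law of the particles; hence the measure in the drift is the one that the particle system
  asks for.\<close>

lemma empirical_particle:
  assumes N: "N \<ge> 1" and v: "\<And>i. i \<in> {1..N} \<Longrightarrow> v i \<in> PS" and \<beta>: "\<beta> \<in> PS"
  defines "m \<equiv> distr (uniform_count_measure {1..N}) PB v"
  shows "empirical_measure PB N (particle N v \<beta>) = distr m PB (msol m \<beta>)"
proof -
  have vm: "v \<in> measurable (uniform_count_measure {1..N}) PB"
    using v by (intro measurable_uniform_count_Icc) auto
  have m: "m \<in> prob_moment p PB" unfolding m_def by (rule uniform_prob_moment[OF N v])
  have "distr m PB (msol m \<beta>) = distr (uniform_count_measure {1..N}) PB (\<lambda>i. msol m \<beta> (v i))"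
    using distr_distr[OF msol_measurable[OF m \<beta>] vm] by (simp only: m_def comp_def)
  also have "\<dots> = empirical_measure PB N (particle N v \<beta>)"
    using particle_in_path_space[of N v \<beta>, OF N v \<beta>]
    by (subst empirical_measure_eq_distr[OF N]) (auto simp: particle_def[abs_def] m_def)
  finally show ?thesis by simp
qed

lemma particle_integral_equation:
  assumes N: "N \<ge> 1" and w: "\<And>i. i \<in> {1..N} \<Longrightarrow> w i \<in> PS" and \<beta>: "\<beta> \<in> PS" and i: "i \<in> {1..N}"
    and v: "v = (\<lambda>i. const_bcontfun (x0 i) + w i)"
  shows "integral_equation T
    (\<lambda>s. b s (apply_bcontfun (particle N v \<beta> i) s)
      (empirical_measure borel N (\<lambda>j. apply_bcontfun (particle N v \<beta> j) s)))
    (x0 i) (w i + \<beta>) (particle N v \<beta> i)"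
proof -
  have vS: "v i \<in> PS" if "i \<in> {1..N}" for i using w[OF that] by (simp add: v)
  define m where "m = distr (uniform_count_measure {1..N}) PB v"
  have m: "m \<in> prob_moment p PB" unfolding m_def by (rule uniform_prob_moment[OF N vS])
  have pm: "particle N v \<beta> \<in> measurable (uniform_count_measure {1..N}) PB"
    using particle_in_path_space[of N v \<beta>, OF N vS \<beta>] by (intro measurable_uniform_count_Icc) auto
  have "distr (distr m PB (msol m \<beta>)) borel (\<lambda>f. apply_bcontfun f s)
      = empirical_measure borel N (\<lambda>j. apply_bcontfun (particle N v \<beta> j) s)" for s
  proof -
    have "distr m PB (msol m \<beta>) = empirical_measure PB N (particle N v \<beta>)"
      unfolding m_def by (rule empirical_particle[symmetric]) (use N vS \<beta> in auto)
    also have "\<dots> = distr (uniform_count_measure {1..N}) PB (particle N v \<beta>)"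
      using particle_in_path_space[of N v \<beta>] N vS \<beta> by (intro empirical_measure_eq_distr) auto
    finally have "distr m PB (msol m \<beta>) = distr (uniform_count_measure {1..N}) PB (particle N v \<beta>)" .
    then show ?thesis
      using empirical_measure_eq_distr[OF N, of "\<lambda>j. apply_bcontfun (particle N v \<beta> j) s" borel]
      by (simp only: distr_distr[OF measurable_path_apply pm] comp_def space_borel UNIV_I)
  qed
  with msol_integral_equation[OF m \<beta> w[OF i], of "particle N v \<beta> i" "x0 i"]
  show ?thesis by (simp add: particle_def m_def v)
qed

lemma particle_measurable:
  assumes N: "N \<ge> 1" and V: "\<And>i. i \<in> {1..N} \<Longrightarrow> V i \<in> measurable M PB" and B: "B \<in> measurable M PB"
    and i: "i \<in> {1..N}"
  shows "(\<lambda>\<omega>. particle N (\<lambda>j. V j \<omega>) (B \<omega>) i) \<in> measurable M PB"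
proof (rule measurable_path_borelI)
  let ?U = "uniform_count_measure {1..N}"
  note U = prob_space_uniform_count_Icc[OF N]
  \<comment> \<open>The index \<open>0\<close> is free, as particles are numbered from
    \<open>1\<close>; it carries the common path, so that one finite family contains all data. The
    uniform measure on \<open>{1..N}\<close> does not see it.\<close>
  define Y where "Y j = (if j = 0 then B else V j)" for j
  have "(\<lambda>\<omega>. (\<lambda>h. particle N h (h 0) i) (\<lambda>j. Y j \<omega>)) \<in> borel_measurable M"
  proof (rule measurable_path_seq_continuous_family[OF T, where I = "{0..N}"
        and f = "\<lambda>h. particle N h (h 0) i" and Y = Y])
    fix u y
    assume u: "\<And>n i. i \<in> {0..N} \<Longrightarrow> u n i \<in> PS" and y: "\<And>i. i \<in> {0..N} \<Longrightarrow> y i \<in> PS"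
      and lim: "\<And>i. i \<in> {0..N} \<Longrightarrow> (\<lambda>n. u n i) \<longlonglongrightarrow> y i"
    have uL: "u n \<in> Lq_space ?U p PB" for n using u by (intro uniform_Lq) auto
    have yL: "y \<in> Lq_space ?U p PB" using y by (intro uniform_Lq) auto
    let ?E = "exp (8 * L * T)"
    let ?d = "\<lambda>n j. dist (u n j + u n 0) (y j + y 0)"
    have le: "dist (particle N (u n) (u n 0) i) (particle N y (y 0) i)
        \<le> ?E * (2 * ?d n i + 2 * ((\<Sum>j\<in>{1..N}. ?d n j powr p) / N) powr (1 / p))" for n
      using msol_stable[OF U uL[of n] yL, of "u n 0" "y 0" "u n i" "y i"] u y i
      by (simp add: particle_def integral_uniform_count_measure)
    have d: "(\<lambda>n. ?d n j) \<longlonglongrightarrow> 0" if "j \<in> {1..N}" for j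
    proof -
      have "(\<lambda>n. ?d n j) \<longlonglongrightarrow> dist (y j + y 0) (y j + y 0)"
        using that by (intro tendsto_dist tendsto_add lim tendsto_const) auto
      then show ?thesis by simp
    qed
    have dp: "(\<lambda>n. ?d n j powr p) \<longlonglongrightarrow> 0" if "j \<in> {1..N}" for j
      using tendsto_powr'[OF d[OF that] tendsto_const[of p]] p by simp
    have "(\<lambda>n. (\<Sum>j\<in>{1..N}. ?d n j powr p) / N) \<longlonglongrightarrow> (\<Sum>j\<in>{1..N}. 0) / N"
      by (intro tendsto_divide tendsto_sum tendsto_const dp) (use N in auto)
    then have "(\<lambda>n. (\<Sum>j\<in>{1..N}. ?d n j powr p) / N) \<longlonglongrightarrow> 0" by simp
    from tendsto_powr'[OF this tendsto_const[of "1 / p"]] p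
    have s: "(\<lambda>n. ((\<Sum>j\<in>{1..N}. ?d n j powr p) / N) powr (1 / p)) \<longlonglongrightarrow> 0"
      by (simp add: sum_nonneg)
    have "(\<lambda>n. ?E * (2 * ?d n i + 2 * ((\<Sum>j\<in>{1..N}. ?d n j powr p) / N) powr (1 / p)))
        \<longlonglongrightarrow> ?E * (2 * 0 + 2 * 0)"
      by (intro tendsto_intros d[OF i] s)
    then have E: "(\<lambda>n. ?E * (2 * ?d n i + 2 * ((\<Sum>j\<in>{1..N}. ?d n j powr p) / N) powr (1 / p))) \<longlonglongrightarrow> 0"
      by simp
    have "(\<lambda>n. dist (particle N (u n) (u n 0) i) (particle N y (y 0) i)) \<longlonglongrightarrow> 0"
      by (rule Lim_null_comparison[OF always_eventually E]) (use le in simp)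
    then show "(\<lambda>n. particle N (u n) (u n 0) i) \<longlonglongrightarrow> particle N y (y 0) i"
      by (subst tendsto_dist_iff)
  next
    fix j assume "j \<in> {0..N}"
    then show "Y j \<in> measurable M PB" using V B by (auto simp: Y_def)
  qed auto
  moreover have "particle N (\<lambda>j. Y j \<omega>) (Y 0 \<omega>) i = particle N (\<lambda>j. V j \<omega>) (B \<omega>) i" for \<omega>
  proof -
    have "distr ?U PB (\<lambda>j. Y j \<omega>) = distr ?U PB (\<lambda>j. V j \<omega>)"
      by (rule distr_cong) (auto simp: Y_def space_uniform_count_measure)
    then show ?thesis using i by (simp add: particle_def Y_def)
  qed
  ultimately show "(\<lambda>\<omega>. particle N (\<lambda>j. V j \<omega>) (B \<omega>) i) \<in> borel_measurable M" by simp
next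
  fix \<omega> assume "\<omega> \<in> space M"
  then show "particle N (\<lambda>j. V j \<omega>) (B \<omega>) i \<in> PS"
    using measurable_space[OF B] measurable_space[OF V] by (intro particle_in_path_space[OF N _ _ i]) auto
qed

lemma particle_Lq:
  assumes M: "finite_measure M" and N: "N \<ge> 1" and V: "\<And>i. i \<in> {1..N} \<Longrightarrow> V i \<in> Lq_space M p PB"
    and B: "B \<in> Lq_space M p PB" and i: "i \<in> {1..N}"
  shows "(\<lambda>\<omega>. particle N (\<lambda>j. V j \<omega>) (B \<omega>) i) \<in> Lq_space M p PB"
proof -
  have mB: "B \<in> measurable M PB" and mV: "V j \<in> measurable M PB" if "j \<in> {1..N}" for j
    using B V[OF that] i by (auto simp: Lq_space_def)
  have nV: "(\<lambda>\<omega>. norm (V j \<omega>)) \<in> borel_measurable M" if "j \<in> {1..N}" for j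
    by (rule measurable_path_norm[OF mV[OF that]])
  have nn: "norm \<in> borel_measurable PB" using measurable_path_norm[of "\<lambda>x. x" PB T] by simp
  \<comment> \<open>The empirical \<open>L^p\<close> norm of the driving paths. Its
    \<open>p\<close>-th power is an average of integrable functions and so integrable.\<close>
  let ?h = "\<lambda>\<omega>. ((\<Sum>j\<in>{1..N}. norm (V j \<omega>) powr p) / N) powr (1 / p)"
  have mB: "B \<in> measurable M PB" using B by (simp add: Lq_space_def)
  show ?thesis
  proof (rule Lq_dominated[OF M particle_measurable[of N V M B, OF N mV mB i] V[OF i] B, of
        ?h "norm (sol (return PB 0) 0)" "10 * exp (8 * L * T)"])
    show "?h \<in> borel_measurable M"
      using nV by measurable
    have "integrable M (\<lambda>\<omega>. (\<Sum>j\<in>{1..N}. norm (V j \<omega>) powr p) / N)"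
      using V by (intro integrable_divide Bochner_Integration.integrable_sum) (auto simp: Lq_space_def)
    then show "integrable M (\<lambda>\<omega>. ?h \<omega> powr p)"
      using p by (simp add: powr_powr sum_nonneg)
    fix \<omega> assume "\<omega> \<in> space M"
    then have VS: "V j \<omega> \<in> PS" "B \<omega> \<in> PS" if "j \<in> {1..N}" for j
      using measurable_space[OF mB] measurable_space[OF mV[OF that]] by auto
    have "(\<lambda>x. norm x powr p) \<in> borel_measurable PB" using nn by measurable
    then have "(\<integral>x. norm x powr p \<partial>distr (uniform_count_measure {1..N}) PB (\<lambda>j. V j \<omega>))
        = (\<Sum>j\<in>{1..N}. norm (V j \<omega>) powr p) / N"
      by (intro integral_distr_uniform_count(1)) (use VS in auto)
    moreover have "distr (uniform_count_measure {1..N}) PB (\<lambda>j. V j \<omega>) \<in> prob_moment p PB"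
      by (rule uniform_prob_moment[OF N]) (rule VS)
    ultimately show "norm (particle N (\<lambda>j. V j \<omega>) (B \<omega>) i) \<le> norm (sol (return PB 0) 0)
      + 10 * exp (8 * L * T) * (norm (V i \<omega>) + norm (B \<omega>) + ?h \<omega>)"
      using norm_msol_le[of "distr (uniform_count_measure {1..N}) PB (\<lambda>j. V j \<omega>)" "B \<omega>" "V i \<omega>"]
        VS(2)[OF i] VS(1)[OF i] by (simp add: particle_def)
  qed auto
qed

text \<open>The coupling itself serves as the probability space, with the two projections as driving
  paths. Adding \<open>\<beta>\<close> to both leaves their distance unchanged, so one coupling of
  the untranslated laws serves every \<open>\<beta>\<close>.\<close>

lemma wasserstein_msol_le:
  assumes m: "m \<in> prob_moment p PB" "m' \<in> prob_moment p PB" and \<beta>: "\<beta> \<in> PS"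
    and \<gamma>: "\<gamma> \<in> couplings m m'"
  shows "wasserstein p (distr m PB (msol m \<beta>)) (distr m' PB (msol m' \<beta>))
    \<le> ennreal (exp (8 * L * T) * 8 * (\<integral>(x, y). dist x y powr p \<partial>\<gamma>) powr (1 / p))"
proof -
  note m1 = prob_momentD[OF m(1)] and m2 = prob_momentD[OF m(2)]
  have s: "sets \<gamma> = sets (PB \<Otimes>\<^sub>M PB)"
    using \<gamma> m1(3) m2(3) by (simp add: couplings_def cong: sets_pair_measure_cong)
  have fs: "fst \<in> measurable \<gamma> PB" "snd \<in> measurable \<gamma> PB"
    by (simp_all cong: measurable_cong_sets add: s)
  have d1: "distr \<gamma> PB fst = m"
    using \<gamma> m1(3) distr_cong[OF refl, of PB m \<gamma> fst fst] by (simp add: couplings_def)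
  have d2: "distr \<gamma> PB snd = m'"
    using \<gamma> m2(3) distr_cong[OF refl, of PB m' \<gamma> snd snd] by (simp add: couplings_def)
  have P: "prob_space \<gamma>" by (rule prob_space_distrD[OF fs(1)]) (simp add: d1 m1)
  have nn: "(\<lambda>x. norm x powr p) \<in> borel_measurable PB"
    using measurable_path_norm[of "\<lambda>x. x" PB T] by measurable
  have L: "fst \<in> Lq_space \<gamma> p PB" "snd \<in> Lq_space \<gamma> p PB"
    using fs m1(5) m2(5) integrable_distr_eq[OF fs(1) nn] integrable_distr_eq[OF fs(2) nn]
    by (auto simp: Lq_space_def d1 d2)
  have e1: "distr \<gamma> PB (\<lambda>z. fst z + \<beta>) = distr m PB (\<lambda>v. v + \<beta>)"
    using distr_shift[OF fs(1) \<beta>] by (simp add: d1)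
  have e2: "distr \<gamma> PB (\<lambda>z. snd z + \<beta>) = distr m' PB (\<lambda>v. v + \<beta>)"
    using distr_shift[OF fs(2) \<beta>] by (simp add: d2)
  have f1: "distr \<gamma> PB (\<lambda>z. msol m \<beta> (fst z)) = distr m PB (msol m \<beta>)"
    using distr_distr[OF msol_measurable[OF m(1) \<beta>] fs(1)] by (simp add: d1 comp_def)
  have f2: "distr \<gamma> PB (\<lambda>z. msol m' \<beta> (snd z)) = distr m' PB (msol m' \<beta>)"
    using distr_distr[OF msol_measurable[OF m(2) \<beta>] fs(2)] by (simp add: d2 comp_def)
  show ?thesis
    using wasserstein_sol_le[OF P Lq_shift[OF P L(1) \<beta>] Lq_shift[OF P L(2) \<beta>]]
    unfolding e1 e2 msol_def[symmetric] f1 f2 by (simp add: dist_add_cancel2 case_prod_beta')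
qed

end

section \<open>Sums of independent identically distributed random variables\<close>

lemma (in prob_space) second_moment_sum_indep_centered:
  fixes X :: "'i \<Rightarrow> 'a \<Rightarrow> real"
  assumes I: "finite I" and ind: "indep_vars (\<lambda>_. borel) X I"
    and sq: "\<And>i. i \<in> I \<Longrightarrow> integrable M (\<lambda>x. (X i x)\<^sup>2)" and z: "\<And>i. i \<in> I \<Longrightarrow> expectation (X i) = 0"
  shows "integrable M (\<lambda>x. (\<Sum>i\<in>I. X i x)\<^sup>2)"
    and "expectation (\<lambda>x. (\<Sum>i\<in>I. X i x)\<^sup>2) = (\<Sum>i\<in>I. expectation (\<lambda>x. (X i x)\<^sup>2))"
proof -
  have rv: "X i \<in> borel_measurable M" if "i \<in> I" for i
    using ind that by (auto simp: indep_vars_def2)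
  have int: "integrable M (X i)" if "i \<in> I" for i
    by (rule square_integrable_imp_integrable[OF rv[OF that] sq[OF that]])
  have pr: "integrable M (\<lambda>x. X i x * X j x) \<and> expectation (\<lambda>x. X i x * X j x) = 0"
    if "i \<in> I" "j \<in> I" "i \<noteq> j" for i j
  proof -
    have ind2: "indep_vars (\<lambda>_. borel) X {i, j}" by (rule indep_vars_subset[OF ind]) (use that in auto)
    have "integrable M (\<lambda>x. \<Prod>k\<in>{i, j}. X k x)"
      by (rule indep_vars_integrable[OF _ ind2]) (use that int in auto)
    moreover have "expectation (\<lambda>x. \<Prod>k\<in>{i, j}. X k x) = (\<Prod>k\<in>{i, j}. expectation (X k))"
      by (rule indep_vars_lebesgue_integral[OF _ ind2]) (use that int in auto)
    ultimately show ?thesis using that z by simp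
  qed
  have pi: "integrable M (\<lambda>x. X i x * X j x)" if "i \<in> I" "j \<in> I" for i j
    using pr[OF that] sq[OF that(1)] by (cases "i = j") (auto simp: power2_eq_square)
  have eq: "(\<Sum>i\<in>I. X i x)\<^sup>2 = (\<Sum>i\<in>I. \<Sum>j\<in>I. X i x * X j x)" for x
    by (simp add: power2_eq_square sum_product)
  show "integrable M (\<lambda>x. (\<Sum>i\<in>I. X i x)\<^sup>2)"
    unfolding eq by (intro Bochner_Integration.integrable_sum pi)
  have "expectation (\<lambda>x. (\<Sum>i\<in>I. X i x)\<^sup>2) = (\<Sum>i\<in>I. \<Sum>j\<in>I. expectation (\<lambda>x. X i x * X j x))"
    unfolding eq by (simp add: pi Bochner_Integration.integral_sum)
  also have "\<dots> = (\<Sum>i\<in>I. \<Sum>j\<in>I. if j = i then expectation (\<lambda>x. (X i x)\<^sup>2) else 0)"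
    using pr by (intro sum.cong) (auto simp: power2_eq_square)
  also have "\<dots> = (\<Sum>i\<in>I. expectation (\<lambda>x. (X i x)\<^sup>2))" using I by (simp add: sum.delta)
  finally show "expectation (\<lambda>x. (\<Sum>i\<in>I. X i x)\<^sup>2) = (\<Sum>i\<in>I. expectation (\<lambda>x. (X i x)\<^sup>2))" .
qed

locale iid_sequence = prob_space M for M :: "'w measure" +
  fixes E :: "'e measure" and V :: "nat \<Rightarrow> 'w \<Rightarrow> 'e" and m :: "'e measure"
  assumes indep: "indep_vars (\<lambda>_. E) V {1..}"
    and law: "\<And>i. i \<ge> 1 \<Longrightarrow> distr M E (V i) = m"
begin

lemma V_measurable: "i \<ge> 1 \<Longrightarrow> V i \<in> measurable M E"
  using indep by (auto simp: indep_vars_def2)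

lemma sets_m: "sets m = sets E"
  using law[of 1] by (metis le_refl sets_distr)

lemma prob_space_m: "prob_space m"
  using prob_space_distr[OF V_measurable[of 1]] law[of 1] by simp

lemma meas_m: "f \<in> measurable E N \<Longrightarrow> f \<in> measurable m N"
  by (simp cong: measurable_cong_sets add: sets_m)

lemma expectation_V:
  fixes f :: "'e \<Rightarrow> real"
  assumes "i \<ge> 1" "f \<in> borel_measurable E"
  shows "expectation (\<lambda>x. f (V i x)) = (\<integral>x. f x \<partial>m)"
    and "integrable M (\<lambda>x. f (V i x)) \<longleftrightarrow> integrable m f"
  using integral_distr[OF V_measurable[OF assms(1)] assms(2)]
    integrable_distr_eq[OF V_measurable[OF assms(1)] assms(2)] law[OF assms(1)] by auto

text \<open>Indicators are bounded, so Hoeffding's inequality makes the deviation probabilities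
  exponentially small and hence summable; Borel-Cantelli does the rest.\<close>

lemma SLLN_indicator:
  assumes A: "A \<in> sets E"
  shows "AE \<omega> in M. (\<lambda>N. (\<Sum>i\<in>{1..N}. indicator A (V i \<omega>)) / real N) \<longlonglongrightarrow> measure m A"
proof -
  let ?X = "\<lambda>i \<omega>. indicator A (V i \<omega>) :: real"
  have Am: "(indicator A :: 'e \<Rightarrow> real) \<in> borel_measurable E" using A by simp
  have mean: "expectation (?X 1) = measure m A"
    using expectation_V(1)[OF _ Am, of 1] A sets_m by simp
  have X: "?X i \<in> borel_measurable M" if "i \<ge> 1" for i
    by (rule measurable_compose[OF V_measurable[OF that] Am])
  have dX: "distr M borel (?X i) = distr m borel (indicator A)" if "i \<ge> 1" for i
    using distr_distr[OF Am V_measurable[OF that]] law[OF that] by (simp add: comp_def)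
  have step: "AE \<omega> in M. eventually (\<lambda>N. \<bar>(\<Sum>i\<in>{1..N}. ?X i \<omega>) / real N - measure m A\<bar> < e) sequentially"
    if e: "e > 0" for e :: real
  proof -
    define F where "F N = {\<omega>\<in>space M. \<bar>(\<Sum>i\<in>{1..N}. ?X i \<omega>) - real N * measure m A\<bar> \<ge> e * real N}" for N
    have S: "(\<lambda>\<omega>. \<Sum>i\<in>{1..N}. ?X i \<omega>) \<in> borel_measurable M" for N
      by (intro borel_measurable_sum X) auto
    have F: "F N \<in> sets M" for N
      unfolding F_def using S[of N] by measurable
    have bound: "prob (F N) \<le> 2 * exp (- 2 * e\<^sup>2) ^ N" if N: "N \<ge> 1" for N
    proof -
      interpret H: Hoeffding_ineq_iid M "{1..N}" ?X "?X 1" 0 1 "expectation (?X 1)"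
      proof unfold_locales
        show "indep_vars (\<lambda>_. borel) ?X {1..N}"
          by (rule indep_vars_compose2[OF indep_vars_subset[OF indep]]) (use Am in auto)
        show "distr M borel (?X i) = distr M borel (?X 1)" if "i \<in> {1..N}" for i
          using dX[of i] dX[of 1] that by simp
        show "?X 1 \<in> borel_measurable M" by (rule X) simp
        show "AE x in M. ?X 1 x \<in> {0..1}" by (auto simp: indicator_def)
      qed auto
      have "prob {x\<in>space M. \<bar>(\<Sum>i\<in>{1..N}. ?X i x) - real (card {1..N}) * expectation (?X 1)\<bar> \<ge> e * real N}
          \<le> 2 * exp (-2 * (e * real N)\<^sup>2 / (real (card {1..N}) * (1 - 0)\<^sup>2))"
        by (rule H.Hoeffding_ineq_abs_ge) (use e N in auto)
      also have "-2 * (e * real N)\<^sup>2 / (real (card {1..N}) * (1 - 0)\<^sup>2) = real N * (- 2 * e\<^sup>2)"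
        using N by (simp add: power2_eq_square)
      also have "exp \<dots> = exp (- 2 * e\<^sup>2) ^ N" by (rule exp_of_nat_mult)
      finally show ?thesis by (simp add: F_def mean[simplified])
    qed
    have sm: "summable (\<lambda>N. prob (F N))"
    proof (rule summable_comparison_test_ev)
      show "\<forall>\<^sub>F N in sequentially. norm (prob (F N)) \<le> 2 * exp (- 2 * e\<^sup>2) ^ N"
        using bound by (auto simp: eventually_sequentially intro!: exI[of _ 1])
      show "summable (\<lambda>N. 2 * exp (- 2 * e\<^sup>2) ^ N)"
        using e by (intro summable_mult summable_geometric) simp
    qed
    have "AE \<omega> in M. eventually (\<lambda>N. \<omega> \<in> space M - F N) sequentially"
      by (rule borel_cantelli_AE1[OF F _ sm]) (simp add: emeasure_eq_measure)
    then show ?thesis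
    proof (rule AE_mp, intro AE_I2 impI)
      fix \<omega> assume "eventually (\<lambda>N. \<omega> \<in> space M - F N) sequentially"
      then show "eventually (\<lambda>N. \<bar>(\<Sum>i\<in>{1..N}. ?X i \<omega>) / real N - measure m A\<bar> < e) sequentially"
        using eventually_gt_at_top[of 0]
      proof eventually_elim
        case (elim N)
        then have "\<bar>(\<Sum>i\<in>{1..N}. ?X i \<omega>) - real N * measure m A\<bar> < e * real N" by (auto simp: F_def)
        moreover have "(\<Sum>i\<in>{1..N}. ?X i \<omega>) / real N - measure m A
            = ((\<Sum>i\<in>{1..N}. ?X i \<omega>) - real N * measure m A) / real N"
          using elim by (simp add: field_simps)
        ultimately show ?case using elim by (simp add: divide_less_eq)
      qed
    qed
  qed
  have "AE \<omega> in M. \<forall>k. eventually (\<lambda>N. \<bar>(\<Sum>i\<in>{1..N}. ?X i \<omega>) / real N - measure m A\<bar> < 1 / real (Suc k)) sequentially"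
    unfolding AE_all_countable by (intro allI step) simp
  then show ?thesis
  proof (rule AE_mp, intro AE_I2 impI tendstoI)
    fix \<omega> and e :: real
    assume *: "\<forall>k. eventually (\<lambda>N. \<bar>(\<Sum>i\<in>{1..N}. ?X i \<omega>) / real N - measure m A\<bar> < 1 / real (Suc k)) sequentially"
      and "e > 0"
    then obtain k where k: "1 / real (Suc k) < e"
      using reals_Archimedean[of e] by (auto simp: inverse_eq_divide)
    show "eventually (\<lambda>N. dist ((\<Sum>i\<in>{1..N}. ?X i \<omega>) / real N) (measure m A) < e) sequentially"
      using *[rule_format, of k] by (rule eventually_mono) (use k in \<open>simp add: dist_real_def\<close>)
  qed
qed

text \<open>
  A law of large numbers up to the factor 2, which suffices for the tails. Along \<open>N = 2 ^ n\<close> it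
  follows from Chebyshev's inequality for the variables truncated at \<open>2 ^ n\<close>; the factor 2 pays for
  the interpolation.
\<close>

lemma averages_eventually_le:
  fixes \<phi> :: "'e \<Rightarrow> real"
  assumes \<phi>: "\<phi> \<in> borel_measurable E" "\<And>x. 0 \<le> \<phi> x" and r: "1 < r" "r \<le> 2"
    and int: "integrable m (\<lambda>x. \<phi> x powr r)" and \<delta>: "\<delta> > 0"
  shows "AE \<omega> in M. eventually (\<lambda>N. (\<Sum>i\<in>{1..N}. \<phi> (V i \<omega>)) / real N \<le> 2 * ((\<integral>x. \<phi> x \<partial>m) + \<delta>)) sequentially"
proof -
  interpret m: prob_space m by (rule prob_space_m)
  define C where "C = (\<integral>x. \<phi> x powr r \<partial>m)"
  have pr: "(\<lambda>x. \<phi> x powr r) \<in> borel_measurable E" using \<phi>(1) by measurable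
  have int1: "integrable m \<phi>"
  proof (rule Bochner_Integration.integrable_bound)
    show "integrable m (\<lambda>x. 1 + \<phi> x powr r)" using int by simp
    have "\<phi> x \<le> 1 + \<phi> x powr r" for x
      using powr_le_one_plus_powr[of "\<phi> x" 1 r] \<phi>(2)[of x] r by simp
    then show "AE x in m. norm (\<phi> x) \<le> norm (1 + \<phi> x powr r)" using \<phi>(2) by (intro AE_I2) auto
  qed (rule meas_m[OF \<phi>(1)])
  \<comment> \<open>\<open>q < 1\<close> as \<open>1 < r\<close>. Both bad events below have
    probability of order \<open>q ^ n\<close>: a factor \<open>2 ^ n\<close> for the number of
    variables and \<open>(2 ^ n) powr (- r)\<close> from the moment.\<close>
  define q where "q = 2 powr (1 - r)"
  have q: "0 < q" "q < 1" using r by (auto simp: q_def powr_less_one)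
  have qn: "q ^ n = 2 ^ n * (2 ^ n) powr (- r)" for n :: nat
  proof -
    have "q ^ n = 2 powr (real n * (1 - r))" by (simp add: q_def powr_realpow[symmetric] powr_powr mult.commute)
    also have "\<dots> = 2 powr real n * 2 powr (real n * (- r))" by (simp add: powr_add[symmetric] algebra_simps)
    also have "2 powr (real n * (- r)) = (2 ^ n) powr (- r)"
      by (simp add: powr_realpow[symmetric] powr_powr)
    finally show ?thesis by (simp add: powr_realpow)
  qed
  define \<psi> where "\<psi> n x = min (\<phi> x) (2 ^ n)" for n :: nat and x
  have \<psi>m: "\<psi> n \<in> borel_measurable E" for n unfolding \<psi>_def using \<phi>(1) by measurable
  have \<psi>b: "0 \<le> \<psi> n x" "\<psi> n x \<le> 2 ^ n" "\<psi> n x \<le> \<phi> x" for n x using \<phi>(2)[of x] by (auto simp: \<psi>_def)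
  have \<psi>i: "integrable m (\<psi> n)" for n
    by (rule m.integrable_const_bound[where B = "2 ^ n"]) (use \<psi>b meas_m[OF \<psi>m] in auto)
  \<comment> \<open>Truncation exchanges the missing second moment for the growth
    \<open>(2 ^ n) powr (2 - r)\<close>; here \<open>r \<le> 2\<close> is used.\<close>
  have \<psi>sq: "(\<psi> n x)\<^sup>2 \<le> \<phi> x powr r * (2 ^ n) powr (2 - r)" for n x
  proof -
    have "(\<psi> n x)\<^sup>2 = \<psi> n x powr 2" using \<psi>b(1)[of n x] by simp
    also have "\<dots> = \<psi> n x powr r * \<psi> n x powr (2 - r)" by (simp add: powr_add[symmetric])
    also have "\<dots> \<le> \<phi> x powr r * (2 ^ n) powr (2 - r)"
      using \<psi>b r by (intro mult_mono powr_mono2) auto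
    finally show ?thesis .
  qed
  define \<mu> where "\<mu> n = (\<integral>x. \<psi> n x \<partial>m)" for n
  \<comment> \<open>Truncation can only lower the mean, so the bias has the right sign for an upper
    bound.\<close>
  have \<mu>: "\<mu> n \<le> (\<integral>x. \<phi> x \<partial>m)" for n unfolding \<mu>_def by (intro integral_mono \<psi>i int1 \<psi>b)
  \<comment> \<open>On \<open>F n\<close> some of the first \<open>2 ^ n\<close> variables reaches
    the truncation level; on \<open>G n\<close> the truncated sum deviates from its mean by at least
    \<open>\<delta> * 2 ^ n\<close>.\<close>
  define F where "F n = (\<Union>i\<in>{1..2^n}. {\<omega>\<in>space M. \<phi> (V i \<omega>) \<ge> 2 ^ n})" for n :: nat
  define G where "G n = {\<omega>\<in>space M. (\<Sum>i\<in>{1..2^n}. \<psi> n (V i \<omega>) - \<mu> n)\<^sup>2 \<ge> (\<delta> * 2 ^ n)\<^sup>2}" for n :: nat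
  have phm: "(\<lambda>\<omega>. \<phi> (V i \<omega>)) \<in> borel_measurable M" if "i \<ge> 1" for i
    by (rule measurable_compose[OF V_measurable[OF that] \<phi>(1)])
  have psm: "(\<lambda>\<omega>. \<psi> n (V i \<omega>)) \<in> borel_measurable M" if "i \<ge> 1" for i n
    by (rule measurable_compose[OF V_measurable[OF that] \<psi>m])
  have F: "F n \<in> sets M" for n
    unfolding F_def using phm by (intro sets.finite_UN) (auto intro!: borel_measurable_le)
  have "(\<lambda>\<omega>. \<Sum>i\<in>{1..2^n}. \<psi> n (V i \<omega>) - \<mu> n) \<in> borel_measurable M" for n :: nat
    using psm by (intro borel_measurable_sum borel_measurable_diff) auto
  then have G: "G n \<in> sets M" for n unfolding G_def by measurable
  have PF: "prob (F n) \<le> C * q ^ n" for n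
  proof -
    have one: "prob {\<omega>\<in>space M. \<phi> (V i \<omega>) \<ge> 2 ^ n} \<le> C * (2 ^ n) powr (- r)" if i: "i \<ge> 1" for i
    proof -
      have "prob {\<omega>\<in>space M. \<phi> (V i \<omega>) \<ge> 2 ^ n} \<le> prob {\<omega>\<in>space M. \<phi> (V i \<omega>) powr r \<ge> (2 ^ n) powr r}"
      proof (rule finite_measure_mono)
        show "{\<omega>\<in>space M. \<phi> (V i \<omega>) \<ge> 2 ^ n} \<subseteq> {\<omega>\<in>space M. \<phi> (V i \<omega>) powr r \<ge> (2 ^ n) powr r}"
          using r by (intro subsetI CollectI) (auto intro: powr_mono2)
        show "{\<omega>\<in>space M. \<phi> (V i \<omega>) powr r \<ge> (2 ^ n) powr r} \<in> events"
          using phm[OF i] by measurable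
      qed
      also have "\<dots> \<le> expectation (\<lambda>\<omega>. \<phi> (V i \<omega>) powr r) / (2 ^ n) powr r"
        by (rule integral_Markov_inequality_measure[where A = "{}"])
          (use expectation_V(2)[OF i pr] int in auto)
      also have "\<dots> = C * (2 ^ n) powr (- r)"
        using expectation_V(1)[OF i pr] by (simp add: C_def powr_minus divide_inverse)
      finally show ?thesis .
    qed
    have "prob (F n) \<le> (\<Sum>i\<in>{1..2^n}. prob {\<omega>\<in>space M. \<phi> (V i \<omega>) \<ge> 2 ^ n})"
      unfolding F_def using phm by (intro finite_measure_subadditive_finite) (auto intro!: borel_measurable_le)
    also have "\<dots> \<le> (\<Sum>i\<in>{1..2^n::nat}. C * (2 ^ n) powr (- r))" by (intro sum_mono one) auto
    also have "\<dots> = C * q ^ n" by (simp add: qn)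
    finally show ?thesis .
  qed
  have PG: "prob (G n) \<le> C / \<delta>\<^sup>2 * q ^ n" for n
  proof -
    let ?X = "\<lambda>i \<omega>. \<psi> n (V i \<omega>) - \<mu> n" and ?I = "{1..2^n} :: nat set"
    have xm: "(\<lambda>x. \<psi> n x - \<mu> n) \<in> borel_measurable E" "(\<lambda>x. (\<psi> n x - \<mu> n)\<^sup>2) \<in> borel_measurable E"
      using \<psi>m by measurable
    have sqi: "integrable m (\<lambda>x. (\<psi> n x - \<mu> n)\<^sup>2)"
    proof (rule m.integrable_const_bound[where B = "(2 ^ n + \<bar>\<mu> n\<bar>)\<^sup>2"])
      have "(\<psi> n x - \<mu> n)\<^sup>2 \<le> (2 ^ n + \<bar>\<mu> n\<bar>)\<^sup>2" for x
      proof -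
        have "\<bar>\<psi> n x - \<mu> n\<bar> \<le> 2 ^ n + \<bar>\<mu> n\<bar>"
          using \<psi>b(1)[of n x] \<psi>b(2)[of n x] by linarith
        from power_mono[OF this abs_ge_zero, of 2] show ?thesis by simp
      qed
      then show "AE x in m. norm ((\<psi> n x - \<mu> n)\<^sup>2) \<le> (2 ^ n + \<bar>\<mu> n\<bar>)\<^sup>2" by simp
    qed (rule meas_m[OF xm(2)])
    have psi2: "integrable m (\<lambda>x. (\<psi> n x)\<^sup>2)"
      by (rule m.integrable_const_bound[where B = "(2 ^ n)\<^sup>2"])
        (use \<psi>b meas_m[OF \<psi>m] in \<open>auto intro!: AE_I2 power_mono\<close>)
    have sq_le: "(\<integral>x. (\<psi> n x - \<mu> n)\<^sup>2 \<partial>m) \<le> C * (2 ^ n) powr (2 - r)"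
    proof -
      have "(\<integral>x. (\<psi> n x - \<mu> n)\<^sup>2 \<partial>m) = (\<integral>x. (\<psi> n x)\<^sup>2 \<partial>m) - (\<mu> n)\<^sup>2"
        unfolding \<mu>_def by (rule m.variance_eq[OF \<psi>i psi2])
      also have "\<dots> \<le> (\<integral>x. (\<psi> n x)\<^sup>2 \<partial>m)" by simp
      also have "\<dots> \<le> (\<integral>x. \<phi> x powr r * (2 ^ n) powr (2 - r) \<partial>m)"
        using int by (intro integral_mono psi2 \<psi>sq) auto
      also have "\<dots> = C * (2 ^ n) powr (2 - r)" by (simp add: C_def)
      finally show ?thesis .
    qed
    have ind: "indep_vars (\<lambda>_. borel) ?X ?I"
      by (rule indep_vars_compose2[OF indep_vars_subset[OF indep]]) (use xm(1) in auto)
    have z: "expectation (?X i) = 0" if "i \<in> ?I" for i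
      using expectation_V(1)[OF _ xm(1), of i] that \<psi>i by (simp add: \<mu>_def m.prob_space)
    have s: "integrable M (\<lambda>\<omega>. (?X i \<omega>)\<^sup>2)" if "i \<in> ?I" for i
      using expectation_V(2)[OF _ xm(2), of i] that sqi by simp
    have "prob (G n) \<le> expectation (\<lambda>\<omega>. (\<Sum>i\<in>?I. ?X i \<omega>)\<^sup>2) / (\<delta> * 2 ^ n)\<^sup>2"
      unfolding G_def using \<delta>
      by (intro integral_Markov_inequality_measure[where A = "{}"]
          second_moment_sum_indep_centered(1)[OF _ ind s z]) auto
    also have "expectation (\<lambda>\<omega>. (\<Sum>i\<in>?I. ?X i \<omega>)\<^sup>2) = (\<Sum>i\<in>?I. expectation (\<lambda>\<omega>. (?X i \<omega>)\<^sup>2))"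
      by (rule second_moment_sum_indep_centered(2)[OF _ ind s z]) auto
    also have "\<dots> \<le> (\<Sum>i\<in>?I. C * (2 ^ n) powr (2 - r))"
      using sq_le expectation_V(1)[OF _ xm(2)] by (intro sum_mono) auto
    also have "\<dots> = C * (2 ^ n) * (2 ^ n) powr (2 - r)" by simp
    also have "\<dots> / (\<delta> * 2 ^ n)\<^sup>2 = C / \<delta>\<^sup>2 * q ^ n"
    proof -
      have "(2 ^ n :: real) powr (2 - r) = (2 ^ n)\<^sup>2 * (2 ^ n) powr (- r)"
        using powr_add[of "2 ^ n :: real" 2 "- r"] by simp
      then show ?thesis using \<delta> by (simp add: qn power_mult_distrib)
    qed
    finally show ?thesis using \<delta> by (simp add: divide_right_mono)
  qed
  have geo: "summable (\<lambda>n. c * q ^ n)" for c using q by (intro summable_mult summable_geometric) simp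
  have "AE \<omega> in M. eventually (\<lambda>n. \<omega> \<in> space M - F n) sequentially"
    by (rule borel_cantelli_AE1[OF F]) (use PF in \<open>auto simp: emeasure_eq_measure
        intro!: summable_comparison_test'[OF geo[of C], of 0]\<close>)
  moreover have "AE \<omega> in M. eventually (\<lambda>n. \<omega> \<in> space M - G n) sequentially"
    by (rule borel_cantelli_AE1[OF G]) (use PG in \<open>auto simp: emeasure_eq_measure
        intro!: summable_comparison_test'[OF geo[of "C / \<delta>\<^sup>2"], of 0]\<close>)
  ultimately show ?thesis
  proof eventually_elim
    case (elim \<omega>)
    then have "eventually (\<lambda>n. \<omega> \<in> space M - F n \<and> \<omega> \<in> space M - G n) sequentially"
      by (rule eventually_conj)
    then obtain n0 where n0: "\<And>n. n \<ge> n0 \<Longrightarrow> \<omega> \<in> space M - F n \<and> \<omega> \<in> space M - G n"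
      by (auto simp: eventually_sequentially)
    have dy: "(\<Sum>i\<in>{1..2^n}. \<phi> (V i \<omega>)) \<le> 2 ^ n * ((\<integral>x. \<phi> x \<partial>m) + \<delta>)" if n: "n \<ge> n0" for n
    proof -
      have "\<phi> (V i \<omega>) = \<psi> n (V i \<omega>)" if "i \<in> {1..2^n}" for i
      proof -
        have "\<not> 2 ^ n \<le> \<phi> (V i \<omega>)" using n0[OF n] that by (auto simp: F_def)
        then show ?thesis by (simp add: \<psi>_def)
      qed
      then have "(\<Sum>i\<in>{1..2^n}. \<phi> (V i \<omega>)) = (\<Sum>i\<in>{1..2^n}. \<psi> n (V i \<omega>))" by (intro sum.cong) auto
      also have "\<dots> = (\<Sum>i\<in>{1..2^n}. \<psi> n (V i \<omega>) - \<mu> n) + 2 ^ n * \<mu> n" by (simp add: sum_subtractf)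
      also have "(\<Sum>i\<in>{1..2^n}. \<psi> n (V i \<omega>) - \<mu> n) \<le> \<delta> * 2 ^ n"
      proof (rule ccontr)
        assume "\<not> ?thesis"
        then have "(\<delta> * 2 ^ n)\<^sup>2 \<le> (\<Sum>i\<in>{1..2^n}. \<psi> n (V i \<omega>) - \<mu> n)\<^sup>2"
          using \<delta> by (intro power_mono) auto
        then show False using n0[OF n] by (auto simp: G_def)
      qed
      also have "2 ^ n * \<mu> n \<le> 2 ^ n * (\<integral>x. \<phi> x \<partial>m)" using \<mu> by simp
      finally show ?thesis by (simp add: algebra_simps)
    qed
    show ?case
      unfolding eventually_sequentially
    proof (intro exI allI impI)
      fix N :: nat assume N: "N \<ge> 2 ^ n0"
      then have N0: "N > 0" using less_le_trans[of 0 "2 ^ n0" N] by simp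
      \<comment> \<open>\<open>N\<close> lies between two consecutive powers of two. The summands
        are nonnegative, so the sum may be extended to \<open>2 ^ (n + 1)\<close> terms, which is at
        most \<open>2 * N\<close>.\<close>
      obtain n where n: "2 ^ n \<le> N" "N < 2 ^ (n + 1)" using ex_power_ivl1[of 2 N] N0 by auto
      have "n0 < n + 1" using N n(2) by (meson le_less_trans nat_power_less_imp_less zero_less_numeral)
      have "(\<Sum>i\<in>{1..N}. \<phi> (V i \<omega>)) \<le> (\<Sum>i\<in>{1..2^(n+1)}. \<phi> (V i \<omega>))"
        using n \<phi>(2) by (intro sum_mono2) auto
      also have "\<dots> \<le> 2 ^ (n + 1) * ((\<integral>x. \<phi> x \<partial>m) + \<delta>)"
        by (rule dy) (use \<open>n0 < n + 1\<close> in simp)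
      also have "\<dots> \<le> (2 * real N) * ((\<integral>x. \<phi> x \<partial>m) + \<delta>)"
      proof (rule mult_right_mono)
        have "(2::real) ^ n \<le> real N" using n(1) by (metis of_nat_le_iff of_nat_numeral of_nat_power)
        then show "(2::real) ^ (n + 1) \<le> 2 * real N" by simp
        show "0 \<le> (\<integral>x. \<phi> x \<partial>m) + \<delta>" using \<delta> \<phi>(2) by (simp add: add_nonneg_nonneg)
      qed
      finally show "(\<Sum>i\<in>{1..N}. \<phi> (V i \<omega>)) / real N \<le> 2 * ((\<integral>x. \<phi> x \<partial>m) + \<delta>)"
        using N0 by (simp add: divide_le_eq mult_ac)
    qed
  qed
qed

end

section \<open>Couplings from a finite partition\<close>

lemma integral_cells:
  fixes f :: "nat \<Rightarrow> real"
  assumes \<mu>: "prob_space \<mu>" and c: "c \<in> measurable \<mu> (count_space UNIV)"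
    and k: "\<And>x. x \<in> space \<mu> \<Longrightarrow> c x \<le> k"
  shows "integrable \<mu> (\<lambda>x. f (c x))"
    and "(\<integral>x. f (c x) \<partial>\<mu>) = (\<Sum>j\<le>k. f j * measure \<mu> {x\<in>space \<mu>. c x = j})"
proof -
  interpret prob_space \<mu> by fact
  have S: "{x\<in>space \<mu>. c x = j} \<in> events" for j using c by measurable
  have eq: "f (c x) = (\<Sum>j\<le>k. f j * indicator {x\<in>space \<mu>. c x = j} x)" if "x \<in> space \<mu>" for x
    using that k[OF that] by (simp add: indicator_def if_distrib sum.delta cong: if_cong)
  have "integrable \<mu> (\<lambda>x. \<Sum>j\<le>k. f j * indicator {x\<in>space \<mu>. c x = j} x)"
    using S by (intro Bochner_Integration.integrable_sum integrable_mult_right integrable_real_indicator)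
      (auto simp: emeasure_eq_measure)
  then show "integrable \<mu> (\<lambda>x. f (c x))"
    by (rule Bochner_Integration.integrable_cong[OF refl, THEN iffD2, rotated]) (rule eq)
  have "(\<integral>x. f (c x) \<partial>\<mu>) = (\<integral>x. (\<Sum>j\<le>k. f j * indicator {x\<in>space \<mu>. c x = j} x) \<partial>\<mu>)"
    by (rule Bochner_Integration.integral_cong[OF refl eq])
  also have "\<dots> = (\<Sum>j\<le>k. f j * measure \<mu> {x\<in>space \<mu>. c x = j})"
    using S by (subst Bochner_Integration.integral_sum) (auto simp: emeasure_eq_measure)
  finally show "(\<integral>x. f (c x) \<partial>\<mu>) = (\<Sum>j\<le>k. f j * measure \<mu> {x\<in>space \<mu>. c x = j})" .
qed

lemma nn_integral_cells:
  fixes f :: "nat \<Rightarrow> real"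
  assumes \<mu>: "prob_space \<mu>" and c: "c \<in> measurable \<mu> (count_space UNIV)"
    and k: "\<And>x. x \<in> space \<mu> \<Longrightarrow> c x \<le> k" and f: "\<And>j. 0 \<le> f j"
  shows "(\<integral>\<^sup>+x. ennreal (f (c x)) \<partial>\<mu>) = ennreal (\<Sum>j\<le>k. f j * measure \<mu> {x\<in>space \<mu>. c x = j})"
  using nn_integral_eq_integral[OF integral_cells(1)[OF \<mu> c k]] integral_cells(2)[OF \<mu> c k] f by simp

text \<open>There are finitely many cells, and those of mass zero form a null set, so quotients by
  the mass of a point's own cell are legitimate almost everywhere.\<close>

lemma AE_cells_positive:
  assumes \<mu>: "prob_space \<mu>" and c: "c \<in> measurable \<mu> (count_space UNIV)"
    and k: "\<And>x. x \<in> space \<mu> \<Longrightarrow> c x \<le> (k::nat)"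
  shows "AE x in \<mu>. measure \<mu> {y\<in>space \<mu>. c y = c x} > 0"
proof -
  interpret prob_space \<mu> by fact
  have "AE x in \<mu>. measure \<mu> {y\<in>space \<mu>. c y = j} = 0 \<longrightarrow> c x \<noteq> j" for j
  proof (cases "measure \<mu> {y\<in>space \<mu>. c y = j} = 0")
    case True
    moreover have "{y\<in>space \<mu>. c y = j} \<in> events" using c by measurable
    ultimately have "AE x in \<mu>. x \<notin> {y\<in>space \<mu>. c y = j}"
      by (intro AE_not_in) (simp add: null_sets_def emeasure_eq_measure)
    then show ?thesis by (rule AE_mp) (auto intro: AE_I2)
  qed auto
  then have "AE x in \<mu>. \<forall>j. measure \<mu> {y\<in>space \<mu>. c y = j} = 0 \<longrightarrow> c x \<noteq> j"
    by (simp add: AE_all_countable)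
  then show ?thesis by (rule AE_mp) (auto intro!: AE_I2 simp: zero_less_measure_iff less_le)
qed

text \<open>
  \<open>c\<close> maps a point to its cell. In every cell, the common part \<open>min\<close> of the two masses is coupled by
  the product of the conditional laws; the remaining masses are coupled by their normalised product.
  Cell \<open>0\<close> is the one whose diameter is not controlled.
\<close>

lemma cell_coupling:
  fixes \<mu> \<nu> :: "'a measure" and c :: "'a \<Rightarrow> nat" and d :: "'a \<times> 'a \<Rightarrow> real" and t :: "'a \<Rightarrow> real"
  assumes \<mu>: "prob_space \<mu>" "sets \<mu> = sets E" and \<nu>: "prob_space \<nu>" "sets \<nu> = sets E"
    and c: "c \<in> measurable E (count_space UNIV)" and k: "\<And>x. x \<in> space E \<Longrightarrow> c x \<le> k"
    and d: "d \<in> borel_measurable (E \<Otimes>\<^sub>M E)" "\<And>z. 0 \<le> d z"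
    and t: "t \<in> borel_measurable E" "\<And>x. 0 \<le> t x" and eK: "0 \<le> e" "0 \<le> K"
    and d_near: "\<And>x y. x \<in> space E \<Longrightarrow> y \<in> space E \<Longrightarrow> c x = c y \<Longrightarrow> c x \<noteq> 0 \<Longrightarrow> d (x, y) \<le> e"
    and d_far: "\<And>x y. x \<in> space E \<Longrightarrow> y \<in> space E \<Longrightarrow> d (x, y) \<le> K + t x + t y"
  defines "a \<equiv> \<lambda>j. measure \<mu> {x\<in>space E. c x = j}" and "b \<equiv> \<lambda>j. measure \<nu> {x\<in>space E. c x = j}"
  obtains \<gamma> where "\<gamma> \<in> couplings \<mu> \<nu>"
    "(\<integral>\<^sup>+z. ennreal (d z) \<partial>\<gamma>) \<le> ennreal (e + K * (a 0 + (\<Sum>j\<le>k. \<bar>a j - b j\<bar>)))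
      + 2 * (\<integral>\<^sup>+x. ennreal (t x) \<partial>\<mu>) + 2 * (\<integral>\<^sup>+x. ennreal (t x) \<partial>\<nu>)"
proof -
  interpret \<mu>: prob_space \<mu> by fact
  interpret \<nu>: prob_space \<nu> by fact
  interpret P: pair_sigma_finite \<mu> \<nu> ..
  have sp: "space \<mu> = space E" "space \<nu> = space E"
    using sets_eq_imp_space_eq[OF \<mu>(2)] sets_eq_imp_space_eq[OF \<nu>(2)] by auto
  have cm: "c \<in> measurable \<mu> (count_space UNIV)" "c \<in> measurable \<nu> (count_space UNIV)"
    using c unfolding measurable_cong_sets[OF \<mu>(2) refl] measurable_cong_sets[OF \<nu>(2) refl] by auto
  have sP: "sets (\<mu> \<Otimes>\<^sub>M \<nu>) = sets (E \<Otimes>\<^sub>M E)" by (intro sets_pair_measure_cong \<mu> \<nu>)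
  have dm: "d \<in> borel_measurable (\<mu> \<Otimes>\<^sub>M \<nu>)" using d(1) unfolding measurable_cong_sets[OF sP refl] .
  have tm: "t \<in> borel_measurable \<mu>" "t \<in> borel_measurable \<nu>"
    using t(1) unfolding measurable_cong_sets[OF \<mu>(2) refl] measurable_cong_sets[OF \<nu>(2) refl] by auto
  \<comment> \<open>\<open>s j\<close> is the common mass of cell \<open>j\<close>, \<open>R\<close>
    the total mass left over, and \<open>\<rho> j\<close>, \<open>\<rho>' j\<close> the fractions of
    the cell left over on either side. \<open>H\<close> is the density of the coupling with respect
    to the product measure: \<open>D\<close> couples the common parts within a cell, the quotient by
    \<open>R\<close> couples what is left.\<close>
  define s where "s j = min (a j) (b j)" for j
  define R where "R = (\<Sum>j\<le>k. b j - s j)"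
  define \<rho> where "\<rho> j = 1 - s j / a j" for j
  define \<rho>' where "\<rho>' j = 1 - s j / b j" for j
  define D where "D i = s i / (a i * b i)" for i
  define H where "H i j = (if j = i then D i else 0) + \<rho> i * \<rho>' j / R" for i j
  \<comment> \<open>\<open>H\<close> without the diagonal common part of the controlled cells: the
    part of the coupling that is charged with the far bound on \<open>d\<close>.\<close>
  define H0 where "H0 i j = (if j = i then (if i = 0 then D i else 0) else 0) + \<rho> i * \<rho>' j / R" for i j
  have a0: "0 \<le> a j" and b0: "0 \<le> b j" and s0: "0 \<le> s j" "s j \<le> a j" "s j \<le> b j" for j
    by (auto simp: a_def b_def s_def)
  have one: "(\<Sum>j\<le>k. a j) = 1" "(\<Sum>j\<le>k. b j) = 1"
    using integral_cells(2)[OF \<mu>(1) cm(1), of k "\<lambda>_. 1"] integral_cells(2)[OF \<nu>(1) cm(2), of k "\<lambda>_. 1"] k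
      \<mu>.prob_space \<nu>.prob_space by (simp_all add: sp a_def b_def)
  have R': "R = (\<Sum>j\<le>k. a j - s j)" using one by (simp add: R_def sum_subtractf)
  have R0: "0 \<le> R" using s0 by (simp add: R_def sum_nonneg)
  have Rle: "R \<le> (\<Sum>j\<le>k. \<bar>a j - b j\<bar>)" unfolding R_def by (intro sum_mono) (auto simp: s_def)
  \<comment> \<open>In a cell of mass zero, division by zero gives \<open>\<rho> j = 1\<close>; the
    product with \<open>a j\<close> is still correct.\<close>
  have \<rho>: "0 \<le> \<rho> j" "\<rho> j \<le> 1" "\<rho> j * a j = a j - s j" for j
    using s0[of j] a0[of j] by (cases "a j = 0"; force simp: \<rho>_def field_simps divide_le_eq_1)+
  have \<rho>': "0 \<le> \<rho>' j" "\<rho>' j \<le> 1" "\<rho>' j * b j = b j - s j" for j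
    using s0[of j] b0[of j] by (cases "b j = 0"; force simp: \<rho>'_def field_simps divide_le_eq_1)+
  have S\<rho>: "(\<Sum>j\<le>k. \<rho> j * a j) = R" "(\<Sum>j\<le>k. \<rho>' j * b j) = R"
    by (simp only: \<rho>(3) R', simp only: \<rho>'(3) R_def)
  \<comment> \<open>For \<open>R = 0\<close> the quotient vanishes by convention, and so does
    \<open>\<rho> i\<close>, because nothing is left over.\<close>
  have \<rho>R: "\<rho> i * R / R = \<rho> i" if "i \<le> k" "a i > 0" for i
  proof (cases "R = 0")
    case True
    then have "a i - s i = 0" using R' s0 that(1) by (simp add: sum_nonneg_eq_0_iff)
    then show ?thesis using that(2) by (simp add: \<rho>_def)
  qed simp
  have \<rho>'R: "\<rho>' i * R / R = \<rho>' i" if "i \<le> k" "b i > 0" for i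
  proof (cases "R = 0")
    case True
    then have "b i - s i = 0" using R_def s0 that(1) by (simp add: sum_nonneg_eq_0_iff)
    then show ?thesis using that(2) by (simp add: \<rho>'_def)
  qed simp
  have D0: "0 \<le> D i" for i using s0 a0 b0 by (simp add: D_def)
  have Db: "D i * b i = s i / a i" for i
    using s0[of i] b0[of i] by (cases "b i = 0") (auto simp: D_def)
  have Da: "D i * a i = s i / b i" for i
    using s0[of i] a0[of i] by (cases "a i = 0") (auto simp: D_def)
  have H_nonneg: "0 \<le> H i j" "0 \<le> H0 i j" for i j
    using D0 \<rho> \<rho>' R0 by (auto simp: H_def H0_def)
  have Hsum: "(\<Sum>j\<le>k. H i j * b j) = s i / a i + \<rho> i * R / R"
    "(\<Sum>j\<le>k. H0 i j * b j) = (if i = 0 then s i / a i else 0) + \<rho> i * R / R"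
    if "i \<le> k" for i
    using that Db[of i] Db[of 0] S\<rho>(2)
    by (simp_all add: H_def H0_def distrib_right sum.distrib if_distrib[of "\<lambda>x. x * _"] sum.delta
        sum_divide_distrib[symmetric] sum_distrib_left[symmetric] mult.assoc cong: if_cong)
  have Hsum': "(\<Sum>i\<le>k. H i j * a i) = s j / b j + \<rho>' j * R / R"
    "(\<Sum>i\<le>k. H0 i j * a i) = (if j = 0 then s j / b j else 0) + \<rho>' j * R / R"
    if "j \<le> k" for j
  proof -
    have e: "H i j * a i = (if j = i then D i * a i else 0) + \<rho>' j * (\<rho> i * a i) / R"
      "H0 i j * a i = (if j = i then (if i = 0 then D i * a i else 0) else 0) + \<rho>' j * (\<rho> i * a i) / R" for i
      by (auto simp: H_def H0_def algebra_simps)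
    show "(\<Sum>i\<le>k. H i j * a i) = s j / b j + \<rho>' j * R / R"
      "(\<Sum>i\<le>k. H0 i j * a i) = (if j = 0 then s j / b j else 0) + \<rho>' j * R / R"
      unfolding e using that Da[of j] Da[of 0] S\<rho>(1)
      by (simp_all add: sum.distrib sum.delta' sum_divide_distrib[symmetric] sum_distrib_left[symmetric] cong: if_cong)
  qed
  define h where "h = (\<lambda>(x, y). ennreal (H (c x) (c y)))"
  define h0 where "h0 = (\<lambda>(x, y). ennreal (H0 (c x) (c y)))"
  have cP: "(\<lambda>z. c (fst z)) \<in> measurable (\<mu> \<Otimes>\<^sub>M \<nu>) (count_space UNIV)"
    "(\<lambda>z. c (snd z)) \<in> measurable (\<mu> \<Otimes>\<^sub>M \<nu>) (count_space UNIV)"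
    using cm by measurable
  have "(\<lambda>z. G (c (fst z)) (c (snd z))) \<in> borel_measurable (\<mu> \<Otimes>\<^sub>M \<nu>)" for G :: "nat \<Rightarrow> nat \<Rightarrow> real"
    by (rule measurable_compose_countable[OF _ cP(1)], rule measurable_compose_countable[OF _ cP(2)]) simp
  from measurable_compose[OF this measurable_ennreal]
  have hm: "h \<in> borel_measurable (\<mu> \<Otimes>\<^sub>M \<nu>)" "h0 \<in> borel_measurable (\<mu> \<Otimes>\<^sub>M \<nu>)"
    unfolding h_def h0_def case_prod_beta' by auto
  have posa: "AE x in \<mu>. a (c x) > 0" using AE_cells_positive[OF \<mu>(1) cm(1), of k] k by (simp add: sp a_def)
  have posb: "AE y in \<nu>. b (c y) > 0" using AE_cells_positive[OF \<nu>(1) cm(2), of k] k by (simp add: sp b_def)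
  \<comment> \<open>Integrating \<open>h\<close> over the second variable gives \<open>1\<close>,
    which is the first marginal condition. For \<open>h0\<close> the bound is kept as a function of
    the cell, since its integral \<open>a 0 + R\<close> is what \<open>K\<close> multiplies.\<close>
  have rowH: "AE x in \<mu>. (\<integral>\<^sup>+y. h (x, y) \<partial>\<nu>) = 1"
    and rowH0: "AE x in \<mu>. (\<integral>\<^sup>+y. h0 (x, y) \<partial>\<nu>) \<le> ennreal ((if c x = 0 then 1 else 0) + \<rho> (c x))"
  proof -
    have *: "(\<integral>\<^sup>+y. h (x, y) \<partial>\<nu>) = 1 \<and> (\<integral>\<^sup>+y. h0 (x, y) \<partial>\<nu>) \<le> ennreal ((if c x = 0 then 1 else 0) + \<rho> (c x))"
      if x: "x \<in> space \<mu>" and p: "a (c x) > 0" for x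
    proof -
      have ck: "c x \<le> k" using k x by (simp add: sp)
      have "(\<integral>\<^sup>+y. h (x, y) \<partial>\<nu>) = ennreal (\<Sum>j\<le>k. H (c x) j * b j)"
        unfolding h_def prod.case using nn_integral_cells[OF \<nu>(1) cm(2), of k "H (c x)"] k H_nonneg by (simp add: sp b_def)
      also have "\<dots> = 1" using Hsum(1)[OF ck] \<rho>R[OF ck p] by (simp add: \<rho>_def)
      finally have 1: "(\<integral>\<^sup>+y. h (x, y) \<partial>\<nu>) = 1" .
      have "(\<integral>\<^sup>+y. h0 (x, y) \<partial>\<nu>) = ennreal (\<Sum>j\<le>k. H0 (c x) j * b j)"
        unfolding h0_def prod.case using nn_integral_cells[OF \<nu>(1) cm(2), of k "H0 (c x)"] k H_nonneg by (simp add: sp b_def)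
      also have "\<dots> \<le> ennreal ((if c x = 0 then 1 else 0) + \<rho> (c x))"
        unfolding Hsum(2)[OF ck] \<rho>R[OF ck p] using s0[of "c x"] p by (intro ennreal_leI add_right_mono) auto
      finally show ?thesis using 1 by simp
    qed
    from posa show "AE x in \<mu>. (\<integral>\<^sup>+y. h (x, y) \<partial>\<nu>) = 1"
      by (rule AE_mp) (use * in \<open>auto intro!: AE_I2\<close>)
    from posa show "AE x in \<mu>. (\<integral>\<^sup>+y. h0 (x, y) \<partial>\<nu>) \<le> ennreal ((if c x = 0 then 1 else 0) + \<rho> (c x))"
      by (rule AE_mp) (use * in \<open>auto intro!: AE_I2\<close>)
  qed
  \<comment> \<open>For \<open>h0\<close> the crude bound \<open>2\<close> is enough here:
    \<open>K\<close> is charged to the first variable alone, and only the tail \<open>t\<close> of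
    the second variable is integrated against the columns.\<close>
  have colH: "AE y in \<nu>. (\<integral>\<^sup>+x. h (x, y) \<partial>\<mu>) = 1"
    and colH0: "AE y in \<nu>. (\<integral>\<^sup>+x. h0 (x, y) \<partial>\<mu>) \<le> 2"
  proof -
    have *: "(\<integral>\<^sup>+x. h (x, y) \<partial>\<mu>) = 1 \<and> (\<integral>\<^sup>+x. h0 (x, y) \<partial>\<mu>) \<le> 2"
      if y: "y \<in> space \<nu>" and p: "b (c y) > 0" for y
    proof -
      have ck: "c y \<le> k" using k y by (simp add: sp)
      have "(\<integral>\<^sup>+x. h (x, y) \<partial>\<mu>) = ennreal (\<Sum>i\<le>k. H i (c y) * a i)"
        unfolding h_def prod.case using nn_integral_cells[OF \<mu>(1) cm(1), of k "\<lambda>i. H i (c y)"] k H_nonneg by (simp add: sp a_def)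
      also have "\<dots> = 1" using Hsum'(1)[OF ck] \<rho>'R[OF ck p] by (simp add: \<rho>'_def)
      finally have 1: "(\<integral>\<^sup>+x. h (x, y) \<partial>\<mu>) = 1" .
      have "(\<integral>\<^sup>+x. h0 (x, y) \<partial>\<mu>) = ennreal (\<Sum>i\<le>k. H0 i (c y) * a i)"
        unfolding h0_def prod.case using nn_integral_cells[OF \<mu>(1) cm(1), of k "\<lambda>i. H0 i (c y)"] k H_nonneg by (simp add: sp a_def)
      also have "\<dots> \<le> ennreal 2"
      proof -
        have "(if c y = 0 then s (c y) / b (c y) else 0) \<le> 1" using s0[of "c y"] p by auto
        then show ?thesis
          unfolding Hsum'(2)[OF ck] \<rho>'R[OF ck p] using \<rho>'(2)[of "c y"]
          by (intro ennreal_leI) linarith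
      qed
      finally show ?thesis using 1 by simp
    qed
    from posb show "AE y in \<nu>. (\<integral>\<^sup>+x. h (x, y) \<partial>\<mu>) = 1"
      by (rule AE_mp) (use * in \<open>auto intro!: AE_I2\<close>)
    from posb show "AE y in \<nu>. (\<integral>\<^sup>+x. h0 (x, y) \<partial>\<mu>) \<le> 2"
      by (rule AE_mp) (use * in \<open>auto intro!: AE_I2\<close>)
  qed
  define \<gamma> where "\<gamma> = density (\<mu> \<Otimes>\<^sub>M \<nu>) h"
  have fstI: "(\<integral>\<^sup>+z. f (fst z) * g z \<partial>(\<mu> \<Otimes>\<^sub>M \<nu>)) = (\<integral>\<^sup>+x. f x * (\<integral>\<^sup>+y. g (x, y) \<partial>\<nu>) \<partial>\<mu>)"
    if f: "f \<in> borel_measurable \<mu>" and g: "g \<in> borel_measurable (\<mu> \<Otimes>\<^sub>M \<nu>)" for f :: "'a \<Rightarrow> ennreal" and g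
  proof -
    have "(\<lambda>z. f (fst z) * g z) \<in> borel_measurable (\<mu> \<Otimes>\<^sub>M \<nu>)" using f g by measurable
    from \<nu>.nn_integral_fst[OF this, symmetric]
    have "(\<integral>\<^sup>+z. f (fst z) * g z \<partial>(\<mu> \<Otimes>\<^sub>M \<nu>)) = (\<integral>\<^sup>+x. \<integral>\<^sup>+y. f x * g (x, y) \<partial>\<nu> \<partial>\<mu>)" by simp
    also have "\<dots> = (\<integral>\<^sup>+x. f x * (\<integral>\<^sup>+y. g (x, y) \<partial>\<nu>) \<partial>\<mu>)"
      using g by (intro nn_integral_cong nn_integral_cmult measurable_Pair2) auto
    finally show ?thesis .
  qed
  have sndI: "(\<integral>\<^sup>+z. f (snd z) * g z \<partial>(\<mu> \<Otimes>\<^sub>M \<nu>)) = (\<integral>\<^sup>+y. f y * (\<integral>\<^sup>+x. g (x, y) \<partial>\<mu>) \<partial>\<nu>)"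
    if f: "f \<in> borel_measurable \<nu>" and g: "g \<in> borel_measurable (\<mu> \<Otimes>\<^sub>M \<nu>)" for f :: "'a \<Rightarrow> ennreal" and g
  proof -
    have "(\<lambda>z. f (snd z) * g z) \<in> borel_measurable (\<mu> \<Otimes>\<^sub>M \<nu>)" using f g by measurable
    from P.nn_integral_snd[OF this, symmetric]
    have "(\<integral>\<^sup>+z. f (snd z) * g z \<partial>(\<mu> \<Otimes>\<^sub>M \<nu>)) = (\<integral>\<^sup>+y. \<integral>\<^sup>+x. f y * g (x, y) \<partial>\<mu> \<partial>\<nu>)" by simp
    also have "\<dots> = (\<integral>\<^sup>+y. f y * (\<integral>\<^sup>+x. g (x, y) \<partial>\<mu>) \<partial>\<nu>)"
      using g by (intro nn_integral_cong nn_integral_cmult measurable_Pair1) auto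
    finally show ?thesis .
  qed
  have m1: "distr \<gamma> \<mu> fst = \<mu>"
  proof (rule measure_eqI)
    fix A assume "A \<in> sets (distr \<gamma> \<mu> fst)"
    then have A: "A \<in> sets \<mu>" by simp
    have "emeasure (distr \<gamma> \<mu> fst) A = (\<integral>\<^sup>+z. h z * indicator (fst -` A \<inter> space (\<mu> \<Otimes>\<^sub>M \<nu>)) z \<partial>(\<mu> \<Otimes>\<^sub>M \<nu>))"
      using A hm(1) unfolding \<gamma>_def
      by (subst emeasure_distr) (auto intro!: emeasure_density measurable_sets[OF measurable_fst])
    also have "\<dots> = (\<integral>\<^sup>+z. indicator A (fst z) * h z \<partial>(\<mu> \<Otimes>\<^sub>M \<nu>))"
      by (intro nn_integral_cong) (auto simp: indicator_def)
    also have "\<dots> = (\<integral>\<^sup>+x. indicator A x * (\<integral>\<^sup>+y. h (x, y) \<partial>\<nu>) \<partial>\<mu>)" by (rule fstI) (use A hm in auto)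
    also have "\<dots> = (\<integral>\<^sup>+x. indicator A x \<partial>\<mu>)"
      by (rule nn_integral_cong_AE) (use rowH in \<open>rule AE_mp, auto intro!: AE_I2\<close>)
    finally show "emeasure (distr \<gamma> \<mu> fst) A = emeasure \<mu> A" using A by simp
  qed simp
  have m2: "distr \<gamma> \<nu> snd = \<nu>"
  proof (rule measure_eqI)
    fix A assume "A \<in> sets (distr \<gamma> \<nu> snd)"
    then have A: "A \<in> sets \<nu>" by simp
    have "emeasure (distr \<gamma> \<nu> snd) A = (\<integral>\<^sup>+z. h z * indicator (snd -` A \<inter> space (\<mu> \<Otimes>\<^sub>M \<nu>)) z \<partial>(\<mu> \<Otimes>\<^sub>M \<nu>))"
      using A hm(1) unfolding \<gamma>_def
      by (subst emeasure_distr) (auto intro!: emeasure_density measurable_sets[OF measurable_snd])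
    also have "\<dots> = (\<integral>\<^sup>+z. indicator A (snd z) * h z \<partial>(\<mu> \<Otimes>\<^sub>M \<nu>))"
      by (intro nn_integral_cong) (auto simp: indicator_def)
    also have "\<dots> = (\<integral>\<^sup>+y. indicator A y * (\<integral>\<^sup>+x. h (x, y) \<partial>\<mu>) \<partial>\<nu>)" by (rule sndI) (use A hm in auto)
    also have "\<dots> = (\<integral>\<^sup>+y. indicator A y \<partial>\<nu>)"
      by (rule nn_integral_cong_AE) (use colH in \<open>rule AE_mp, auto intro!: AE_I2\<close>)
    finally show "emeasure (distr \<gamma> \<nu> snd) A = emeasure \<nu> A" using A by simp
  qed simp
  have "\<gamma> \<in> couplings \<mu> \<nu>" using m1 m2 by (simp add: couplings_def \<gamma>_def)
  moreover have "(\<integral>\<^sup>+z. ennreal (d z) \<partial>\<gamma>) \<le> ennreal (e + K * (a 0 + (\<Sum>j\<le>k. \<bar>a j - b j\<bar>)))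
      + 2 * (\<integral>\<^sup>+x. ennreal (t x) \<partial>\<mu>) + 2 * (\<integral>\<^sup>+x. ennreal (t x) \<partial>\<nu>)"
  proof -
    have "(\<integral>\<^sup>+z. ennreal (d z) \<partial>\<gamma>) = (\<integral>\<^sup>+z. h z * ennreal (d z) \<partial>(\<mu> \<Otimes>\<^sub>M \<nu>))"
      unfolding \<gamma>_def using dm hm by (intro nn_integral_density) auto
    also have "\<dots> \<le> (\<integral>\<^sup>+z. ennreal e * h z + (ennreal (K + t (fst z)) * h0 z + ennreal (t (snd z)) * h0 z) \<partial>(\<mu> \<Otimes>\<^sub>M \<nu>))"
    proof (rule nn_integral_mono)
      fix z assume "z \<in> space (\<mu> \<Otimes>\<^sub>M \<nu>)"
      then obtain x y where z: "z = (x, y)" and xy: "x \<in> space E" "y \<in> space E"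
        by (auto simp: space_pair_measure sp)
      \<comment> \<open>Pairs in a common controlled cell pay at most \<open>e\<close> against the
        full density; on all others \<open>H0\<close> agrees with \<open>H\<close> and takes the far
        bound.\<close>
      have "H (c x) (c y) * d (x, y) \<le> e * H (c x) (c y) + (K + t x + t y) * H0 (c x) (c y)"
      proof (cases "c x = c y \<and> c x \<noteq> 0")
        case True
        have "H (c x) (c y) * d (x, y) \<le> H (c x) (c y) * e"
          using True H_nonneg d_near[OF xy] by (intro mult_left_mono) auto
        moreover have "0 \<le> (K + t x + t y) * H0 (c x) (c y)" using eK t(2) H_nonneg by simp
        ultimately show ?thesis by (simp add: mult.commute)
      next
        case False
        then have "H (c x) (c y) = H0 (c x) (c y)" by (auto simp: H_def H0_def)
        moreover have "H0 (c x) (c y) * d (x, y) \<le> H0 (c x) (c y) * (K + t x + t y)"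
          using H_nonneg d_far[OF xy] by (intro mult_left_mono) auto
        moreover have "0 \<le> e * H0 (c x) (c y)" using eK H_nonneg by simp
        ultimately show ?thesis by (simp add: mult.commute)
      qed
      then have "ennreal (H (c x) (c y) * d (x, y))
          \<le> ennreal (e * H (c x) (c y) + ((K + t x) * H0 (c x) (c y) + t y * H0 (c x) (c y)))"
        by (intro ennreal_leI) (simp add: algebra_simps)
      then show "h z * ennreal (d z) \<le> ennreal e * h z + (ennreal (K + t (fst z)) * h0 z + ennreal (t (snd z)) * h0 z)"
        using H_nonneg d(2) eK t(2) by (simp add: z h_def h0_def ennreal_mult)
    qed
    also have "\<dots> = ennreal e * (\<integral>\<^sup>+z. h z \<partial>(\<mu> \<Otimes>\<^sub>M \<nu>)) + ((\<integral>\<^sup>+z. ennreal (K + t (fst z)) * h0 z \<partial>(\<mu> \<Otimes>\<^sub>M \<nu>))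
        + (\<integral>\<^sup>+z. ennreal (t (snd z)) * h0 z \<partial>(\<mu> \<Otimes>\<^sub>M \<nu>)))"
      using hm tm by (subst nn_integral_add, simp, simp, subst nn_integral_add, simp, simp) (simp add: nn_integral_cmult)
    also have "(\<integral>\<^sup>+z. h z \<partial>(\<mu> \<Otimes>\<^sub>M \<nu>)) = 1"
    proof -
      have "(\<integral>\<^sup>+z. h z \<partial>(\<mu> \<Otimes>\<^sub>M \<nu>)) = (\<integral>\<^sup>+x. (\<integral>\<^sup>+y. h (x, y) \<partial>\<nu>) \<partial>\<mu>)" using fstI[of "\<lambda>_. 1" h] hm by simp
      also have "\<dots> = (\<integral>\<^sup>+x. 1 \<partial>\<mu>)" by (rule nn_integral_cong_AE[OF rowH])
      finally show ?thesis by (simp add: \<mu>.emeasure_space_1)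
    qed
    also have "(\<integral>\<^sup>+z. ennreal (t (snd z)) * h0 z \<partial>(\<mu> \<Otimes>\<^sub>M \<nu>)) \<le> 2 * (\<integral>\<^sup>+y. ennreal (t y) \<partial>\<nu>)"
    proof -
      have "(\<integral>\<^sup>+z. ennreal (t (snd z)) * h0 z \<partial>(\<mu> \<Otimes>\<^sub>M \<nu>)) = (\<integral>\<^sup>+y. ennreal (t y) * (\<integral>\<^sup>+x. h0 (x, y) \<partial>\<mu>) \<partial>\<nu>)"
        by (rule sndI) (use tm hm in auto)
      also have "\<dots> \<le> (\<integral>\<^sup>+y. 2 * ennreal (t y) \<partial>\<nu>)"
      proof (rule nn_integral_mono_AE)
        from colH0 show "AE y in \<nu>. ennreal (t y) * (\<integral>\<^sup>+x. h0 (x, y) \<partial>\<mu>) \<le> 2 * ennreal (t y)"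
          by (rule AE_mp) (auto intro!: AE_I2 simp: mult.commute[of 2] mult_left_mono)
      qed
      finally show ?thesis using tm by (simp add: nn_integral_cmult)
    qed
    also have "(\<integral>\<^sup>+z. ennreal (K + t (fst z)) * h0 z \<partial>(\<mu> \<Otimes>\<^sub>M \<nu>))
        \<le> ennreal (K * (a 0 + (\<Sum>j\<le>k. \<bar>a j - b j\<bar>))) + 2 * (\<integral>\<^sup>+x. ennreal (t x) \<partial>\<mu>)"
    proof -
      let ?g = "\<lambda>j. (if j = 0 then 1 else 0) + \<rho> j"
      have "(\<integral>\<^sup>+z. ennreal (K + t (fst z)) * h0 z \<partial>(\<mu> \<Otimes>\<^sub>M \<nu>)) = (\<integral>\<^sup>+x. ennreal (K + t x) * (\<integral>\<^sup>+y. h0 (x, y) \<partial>\<nu>) \<partial>\<mu>)"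
        by (rule fstI) (use tm hm in auto)
      also have "\<dots> \<le> (\<integral>\<^sup>+x. ennreal K * ennreal (?g (c x)) + 2 * ennreal (t x) \<partial>\<mu>)"
      proof (rule nn_integral_mono_AE)
        have "ennreal (K + t x) * ennreal (?g (c x)) \<le> ennreal K * ennreal (?g (c x)) + 2 * ennreal (t x)" for x
        proof -
          have "t x * ?g (c x) \<le> t x * 2"
            using t(2)[of x] \<rho>[of "c x"] by (intro mult_left_mono) auto
          then have "(K + t x) * ?g (c x) \<le> K * ?g (c x) + 2 * t x" by (simp only: distrib_right mult.commute[of _ 2])
          from ennreal_leI[OF this] show ?thesis
            using eK t(2)[of x] \<rho>(1)[of "c x"]
            by (simp add: ennreal_mult[symmetric] ennreal_plus[symmetric] ennreal_numeral[symmetric]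
                del: ennreal_plus ennreal_numeral)
        qed
        then have *: "ennreal (K + t x) * q \<le> ennreal K * ennreal (?g (c x)) + 2 * ennreal (t x)"
          if "q \<le> ennreal (?g (c x))" for q x
          using that by (meson mult_left_mono order_trans zero_le)
        from rowH0 show "AE x in \<mu>. ennreal (K + t x) * (\<integral>\<^sup>+y. h0 (x, y) \<partial>\<nu>) \<le> ennreal K * ennreal (?g (c x)) + 2 * ennreal (t x)"
          by (rule AE_mp) (intro AE_I2 impI *)
      qed
      also have "\<dots> = ennreal K * (\<integral>\<^sup>+x. ennreal (?g (c x)) \<partial>\<mu>) + 2 * (\<integral>\<^sup>+x. ennreal (t x) \<partial>\<mu>)"
        using tm measurable_compose[OF cm(1), of "\<lambda>j. ennreal (?g j)" borel]
        by (simp add: nn_integral_add nn_integral_cmult)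
      also have "(\<integral>\<^sup>+x. ennreal (?g (c x)) \<partial>\<mu>) = ennreal (\<Sum>j\<le>k. ?g j * a j)"
        using nn_integral_cells[OF \<mu>(1) cm(1), of k ?g] k \<rho>(1) by (simp add: sp a_def)
      also have "(\<Sum>j\<le>k. ?g j * a j) = a 0 + R"
        using S\<rho>(1) by (simp add: distrib_right sum.distrib if_distrib[of "\<lambda>x. x * _"] sum.delta cong: if_cong)
      also have "ennreal K * ennreal (a 0 + R) \<le> ennreal (K * (a 0 + (\<Sum>j\<le>k. \<bar>a j - b j\<bar>)))"
        using eK a0[of 0] R0 Rle
        by (simp add: ennreal_mult[symmetric] ennreal_leI mult_left_mono del: ennreal_plus)
      finally show ?thesis by (simp add: add_right_mono)
    qed
    finally show ?thesis
      using eK a0[of 0] by (simp add: ennreal_plus sum_nonneg add.assoc add_left_mono add_right_mono)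
  qed
  ultimately show thesis by (rule that)
qed

section \<open>Law of large numbers in Wasserstein distance\<close>

text \<open>The partitions, truncation levels and tolerances range over countable sets, so a single
  null set serves all \<open>\<epsilon>\<close>. The cost is split into near pairs, unequal cell
  masses, the uncontrolled cell, and tails.\<close>

lemma wasserstein_LLN_couplings:
  fixes V :: "nat \<Rightarrow> 'w \<Rightarrow> ('d::finite) path"
  assumes iid: "iid_sequence M (path_borel T) V m" and T: "T > 0" and p: "1 \<le> p" "p < p'"
    and mom: "integrable m (\<lambda>x. norm x powr p')"
  shows "AE \<omega> in M. \<forall>\<epsilon>>0. eventually (\<lambda>N.
    \<exists>\<gamma>\<in>couplings (distr (uniform_count_measure {1..N}) (path_borel T) (\<lambda>i. V i \<omega>)) m.
      (\<integral>(x, y). dist x y powr p \<partial>\<gamma>) \<le> \<epsilon>) sequentially"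
proof -
  interpret iid_sequence M "path_borel T" V m by fact
  interpret m: prob_space m by (rule prob_space_m)
  let ?PB = "path_borel T :: 'd path measure" and ?PS = "path_space T :: 'd path set"
  obtain D :: "'d path set" where D: "countable D" "D \<subseteq> ?PS"
    "\<And>f e. f \<in> ?PS \<Longrightarrow> e > 0 \<Longrightarrow> \<exists>d\<in>D. dist d f < e"
    using path_space_separable[OF T] by metis
  have "D \<noteq> {}" using D(3)[of 0 1] by auto
  then have rng: "range (from_nat_into D) = D" using D(1) by (rule range_from_nat_into)
  define g where "g n x = (LEAST j. dist (from_nat_into D j) x < 1 / real (Suc n))" for n and x :: "'d path"
  have g: "dist (from_nat_into D (g n x)) x < 1 / real (Suc n)" if "x \<in> ?PS" for n x
  proof -
    have "\<exists>j. dist (from_nat_into D j) x < 1 / real (Suc n)"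
      using D(3)[OF that, of "1 / real (Suc n)"] rng by (metis imageE of_nat_0_less_iff zero_less_Suc zero_less_divide_1_iff)
    then show ?thesis unfolding g_def by (rule LeastI_ex)
  qed
  have g_meas: "g n \<in> measurable ?PB (count_space UNIV)" for n
    unfolding g_def
  proof (rule measurable_Least)
    fix i
    have "(\<lambda>x. dist (from_nat_into D i) x) \<in> borel_measurable ?PB"
      by (intro measurable_path_continuous continuous_intros)
    then show "Measurable.pred ?PB (\<lambda>x. dist (from_nat_into D i) x < 1 / real (Suc n))" by measurable
  qed
  \<comment> \<open>Only the first \<open>k\<close> centres get their own cell, numbered from
    \<open>1\<close>; cell \<open>0\<close> collects everything else.\<close>
  define c where "c n k x = (if g n x < k then Suc (g n x) else 0)" for n k and x :: "'d path"
  have c_meas: "c n k \<in> measurable ?PB (count_space UNIV)" for n k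
    unfolding c_def by (rule measurable_compose[OF g_meas]) simp
  have c_le: "c n k x \<le> k" for n k x by (simp add: c_def)
  have c_near: "dist x y \<le> 2 / real (Suc n)"
    if "x \<in> ?PS" "y \<in> ?PS" "c n k x = c n k y" "c n k x \<noteq> 0" for n k x y
  proof -
    have "g n x = g n y" using that by (auto simp: c_def split: if_splits)
    then have "dist x y < 1 / real (Suc n) + 1 / real (Suc n)"
      using g[OF that(1), of n] g[OF that(2), of n]
        dist_triangle[of x y "from_nat_into D (g n x)"] by (simp add: dist_commute)
    then show ?thesis by simp
  qed
  define A where "A n k j = {x\<in>?PS. c n k x = j}" for n k j
  have A: "A n k j \<in> sets ?PB" for n k j
  proof -
    have "c n k -` {j} \<inter> space ?PB \<in> sets ?PB" by (rule measurable_sets[OF c_meas]) simp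
    also have "c n k -` {j} \<inter> space ?PB = A n k j" by (auto simp: A_def)
    finally show ?thesis .
  qed
  \<comment> \<open>Every path is near some centre, so the uncontrolled cells decrease to the empty
    set as \<open>k\<close> grows; this plays the part of tightness of \<open>m\<close>.\<close>
  have A0: "(\<lambda>k. measure m (A n k 0)) \<longlonglongrightarrow> 0" for n
  proof -
    have "(\<lambda>k. measure m (A n k 0)) \<longlonglongrightarrow> measure m (\<Inter>k. A n k 0)"
    proof (rule m.finite_Lim_measure_decseq)
      show "range (\<lambda>k. A n k 0) \<subseteq> m.events" using A sets_m by auto
      show "decseq (\<lambda>k. A n k 0)" by (auto simp: decseq_def A_def c_def split: if_splits)
    qed
    moreover have "(\<Inter>k. A n k 0) = {}"
      by (auto simp: A_def c_def split: if_splits)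
    ultimately show ?thesis by simp
  qed
  have nm: "(\<lambda>x. norm x) \<in> borel_measurable ?PB" by (rule measurable_path_norm[where T = T]) simp
  \<comment> \<open>\<open>u\<close> is scaled such that
    \<open>dist x y powr p \<le> u x + u y\<close>; \<open>t l\<close> keeps \<open>u\<close> where
    it exceeds the level \<open>l\<close>, and elsewhere \<open>u\<close> is at most
    \<open>l\<close>.\<close>
  define u where "u x = 2 powr p * norm x powr p" for x :: "'d path"
  define t where "t l x = (if u x > real l then u x else 0)" for l :: nat and x
  have u0: "0 \<le> u x" for x by (simp add: u_def)
  have t0: "0 \<le> t l x" and tu: "t l x \<le> u x" "u x \<le> real l + t l x" for l x using u0 by (auto simp: t_def)
  have um: "u \<in> borel_measurable ?PB" unfolding u_def using nm by measurable
  have tm: "t l \<in> borel_measurable ?PB" for l unfolding t_def using um by measurable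
  have far: "dist x y powr p \<le> 2 * real l + t l x + t l y" for x y :: "'d path" and l
  proof -
    have "dist x y powr p \<le> (norm x + norm y) powr p"
      using p norm_triangle_ineq4[of x y] by (intro powr_mono2) (auto simp: dist_norm)
    also have "\<dots> \<le> u x + u y"
      using powr_add_le[of "norm x" "norm y" p] p by (simp add: u_def distrib_left)
    also have "\<dots> \<le> 2 * real l + t l x + t l y" using tu(2)[of x l] tu(2)[of y l] by simp
    finally show ?thesis .
  qed
  \<comment> \<open>Here \<open>p < p'\<close> enters: \<open>u\<close> has a moment of order
    \<open>r > 1\<close>. The cap at \<open>2\<close> is required by the truncation argument for
    averages.\<close>
  define r where "r = min (p' / p) 2"
  have r: "1 < r" "r \<le> 2" "p * r \<le> p'" using p by (auto simp: r_def min_def field_simps)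
  have ur: "integrable m (\<lambda>x. u x powr r)"
  proof (rule Bochner_Integration.integrable_bound)
    show "integrable m (\<lambda>x. 2 powr (p * r) * (1 + norm x powr p'))" using mom by simp
    show "(\<lambda>x. u x powr r) \<in> borel_measurable m" using meas_m[OF um] by measurable
    have "u x powr r \<le> 2 powr (p * r) * (1 + norm x powr p')" for x
      using powr_le_one_plus_powr[of "norm x" "p * r" p'] p r by (simp add: u_def powr_mult powr_powr)
    then show "AE x in m. norm (u x powr r) \<le> norm (2 powr (p * r) * (1 + norm x powr p'))"
      by (intro AE_I2) simp
  qed
  have ui: "integrable m u"
  proof (rule Bochner_Integration.integrable_bound)
    show "integrable m (\<lambda>x. 1 + u x powr r)" using ur by simp
    have "u x \<le> 1 + u x powr r" for x
      using powr_le_one_plus_powr[of "u x" 1 r] u0[of x] r by simp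
    then show "AE x in m. norm (u x) \<le> norm (1 + u x powr r)" using u0 by (intro AE_I2) simp
  qed (rule meas_m[OF um])
  have ti: "integrable m (t l)" for l
    by (rule Bochner_Integration.integrable_bound[OF ui meas_m[OF tm]]) (use t0 tu u0 in auto)
  have tr: "integrable m (\<lambda>x. t l x powr r)" for l
    by (rule integrable_powr_le[OF ur meas_m[OF tm]]) (use r t0 tu in auto)
  define \<tau> where "\<tau> l = (\<integral>x. t l x \<partial>m)" for l
  have \<tau>: "\<tau> \<longlonglongrightarrow> 0"
  proof -
    have "(\<lambda>l. \<integral>x. t l x \<partial>m) \<longlonglongrightarrow> (\<integral>x. 0 \<partial>m)"
    proof (rule integral_dominated_convergence[OF _ _ ui])
      show "AE x in m. (\<lambda>l. t l x) \<longlonglongrightarrow> 0"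
      proof (rule AE_I2, rule tendsto_eventually)
        fix x
        obtain l0 :: nat where "u x \<le> real l0" using real_arch_simple by blast
        then have "t l x = 0" if "l \<ge> l0" for l using that by (auto simp: t_def)
        then show "eventually (\<lambda>l. t l x = 0) sequentially" by (auto simp: eventually_sequentially)
      qed
    qed (use t0 tu meas_m[OF tm] in auto)
    then show ?thesis by (simp add: \<tau>_def[abs_def])
  qed
  define avg where "avg f N \<omega> = (\<Sum>i\<in>{1..N}. f (V i \<omega>)) / real N" for f :: "'d path \<Rightarrow> real" and N \<omega>
  have "AE \<omega> in M. \<forall>n k j. (\<lambda>N. avg (indicator (A n k j)) N \<omega>) \<longlonglongrightarrow> measure m (A n k j)"
    unfolding AE_all_countable avg_def by (intro allI SLLN_indicator A)
  moreover have "AE \<omega> in M. \<forall>l q. eventually (\<lambda>N. avg (t l) N \<omega> \<le> 2 * (\<tau> l + 1 / real (Suc q))) sequentially"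
    unfolding AE_all_countable avg_def \<tau>_def
    by (intro allI averages_eventually_le[OF tm t0 r(1,2) tr]) simp
  ultimately show ?thesis
    using AE_space
  proof eventually_elim
    case (elim \<omega>)
    have VS: "V i \<omega> \<in> ?PS" if "i \<ge> 1" for i
      using measurable_space[OF V_measurable[OF that] elim(3)] by simp
    show ?case
    proof (intro allI impI)
      fix \<epsilon> :: real assume \<epsilon>: "\<epsilon> > 0"
      \<comment> \<open>Near pairs cost \<open>\<epsilon> / 5\<close>, and unequal masses together
        with the uncontrolled cell another \<open>\<epsilon> / 5\<close>. The empirical tail is at
        most \<open>2 * (\<epsilon> / 40 + \<epsilon> / 40)\<close>, the tail of \<open>m\<close> at
        most \<open>\<epsilon> / 40\<close>, and both count twice. The index \<open>k\<close> comes
        after \<open>l\<close>, on which the factor \<open>K\<close> depends.\<close>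
      have "(\<lambda>n. (2 / real (Suc n)) powr p) \<longlonglongrightarrow> 0"
      proof -
        have "(\<lambda>n. 2 * (1 / real (Suc n))) \<longlonglongrightarrow> 2 * 0"
          by (intro tendsto_mult tendsto_const LIMSEQ_Suc[OF lim_inverse_n'])
        then have "(\<lambda>n. 2 / real (Suc n)) \<longlonglongrightarrow> 0" by simp
        from tendsto_powr'[OF this tendsto_const[of p]] p show ?thesis by simp
      qed
      from order_tendstoD(2)[OF this, of "\<epsilon> / 5"] \<epsilon>
      obtain n where n: "(2 / real (Suc n)) powr p < \<epsilon> / 5" by (auto simp: eventually_sequentially)
      from order_tendstoD(2)[OF \<tau>, of "\<epsilon> / 40"] \<epsilon>
      obtain l where l: "\<tau> l < \<epsilon> / 40" by (auto simp: eventually_sequentially)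
      obtain q where q: "1 / real (Suc q) < \<epsilon> / 40"
        using reals_Archimedean[of "\<epsilon> / 40"] \<epsilon> by (auto simp: inverse_eq_divide)
      define K where "K = 2 * real l"
      have "(\<lambda>k. K * measure m (A n k 0)) \<longlonglongrightarrow> K * 0" by (intro tendsto_mult tendsto_const A0)
      then have "(\<lambda>k. K * measure m (A n k 0)) \<longlonglongrightarrow> 0" by simp
      from order_tendstoD(2)[OF this, of "\<epsilon> / 5"] \<epsilon>
      obtain k where k: "K * measure m (A n k 0) < \<epsilon> / 5" by (auto simp: eventually_sequentially)
      let ?a = "\<lambda>N j. avg (indicator (A n k j)) N \<omega>"
      have "(\<lambda>N. K * (?a N 0 + (\<Sum>j\<le>k. \<bar>?a N j - measure m (A n k j)\<bar>)))
          \<longlonglongrightarrow> K * (measure m (A n k 0) + (\<Sum>j\<le>k. \<bar>measure m (A n k j) - measure m (A n k j)\<bar>))"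
        by (intro tendsto_intros) (use elim(1) in blast)+
      then have "(\<lambda>N. K * (?a N 0 + (\<Sum>j\<le>k. \<bar>?a N j - measure m (A n k j)\<bar>))) \<longlonglongrightarrow> K * measure m (A n k 0)"
        by simp
      from order_tendstoD(2)[OF this k]
      have ev1: "eventually (\<lambda>N. K * (?a N 0 + (\<Sum>j\<le>k. \<bar>?a N j - measure m (A n k j)\<bar>)) < \<epsilon> / 5) sequentially" .
      have ev2: "eventually (\<lambda>N. avg (t l) N \<omega> \<le> 2 * (\<tau> l + 1 / real (Suc q))) sequentially"
        using elim(2) by blast
      from ev1 ev2 eventually_gt_at_top[of 0]
      show "eventually (\<lambda>N.
          \<exists>\<gamma>\<in>couplings (distr (uniform_count_measure {1..N}) ?PB (\<lambda>i. V i \<omega>)) m.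
            (\<integral>(x, y). dist x y powr p \<partial>\<gamma>) \<le> \<epsilon>) sequentially"
      proof eventually_elim
        case (elim N)
        let ?\<mu> = "distr (uniform_count_measure {1..N}) ?PB (\<lambda>i. V i \<omega>)"
        have N: "N \<ge> 1" using elim by simp
        have Vs: "V i \<omega> \<in> space ?PB" if "i \<in> {1..N}" for i using VS[of i] that by simp
        have \<mu>: "prob_space ?\<mu>"
          by (rule prob_space.prob_space_distr[OF prob_space_uniform_count_Icc[OF N]
                measurable_uniform_count_Icc[OF Vs]])
        have am: "measure ?\<mu> (A n k j) = ?a N j" for j
        proof -
          have "measure ?\<mu> (A n k j) = (\<integral>x. indicator (A n k j) x \<partial>?\<mu>)"
            using A sets.sets_into_space[OF A] by (simp add: Int_absorb2)
          also have "\<dots> = ?a N j"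
            unfolding avg_def by (rule integral_distr_uniform_count(1)[OF Vs]) (use A in auto)
          finally show ?thesis .
        qed
        have tI: "(\<integral>\<^sup>+x. ennreal (t l x) \<partial>?\<mu>) = ennreal (avg (t l) N \<omega>)"
          using nn_integral_eq_integral[OF integral_distr_uniform_count(2)[OF Vs tm]]
            integral_distr_uniform_count(1)[OF Vs tm] by (simp add: avg_def t0)
        have tm': "(\<integral>\<^sup>+x. ennreal (t l x) \<partial>m) = ennreal (\<tau> l)"
          unfolding \<tau>_def by (rule nn_integral_eq_integral[OF ti]) (simp add: t0)
        have dm: "(\<lambda>(x, y). dist x y powr p) \<in> borel_measurable (?PB \<Otimes>\<^sub>M ?PB)"
        proof -
          have "(\<lambda>z. (case z of (x, y) \<Rightarrow> dist x y) powr p) \<in> borel_measurable (?PB \<Otimes>\<^sub>M ?PB)"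
            using dist_measurable_path[OF T] by measurable
          then show ?thesis by (simp add: case_prod_beta')
        qed
        obtain \<gamma> where \<gamma>: "\<gamma> \<in> couplings ?\<mu> m"
          "(\<integral>\<^sup>+z. ennreal (case z of (x, y) \<Rightarrow> dist x y powr p) \<partial>\<gamma>)
            \<le> ennreal ((2 / real (Suc n)) powr p + K * (measure ?\<mu> {x\<in>space ?PB. c n k x = 0}
                + (\<Sum>j\<le>k. \<bar>measure ?\<mu> {x\<in>space ?PB. c n k x = j} - measure m {x\<in>space ?PB. c n k x = j}\<bar>)))
              + 2 * (\<integral>\<^sup>+x. ennreal (t l x) \<partial>?\<mu>) + 2 * (\<integral>\<^sup>+x. ennreal (t l x) \<partial>m)"
        proof (rule cell_coupling[OF \<mu> _ prob_space_m sets_m c_meas[of n k], where k = k and t = "t l"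
              and d = "\<lambda>(x, y). dist x y powr p" and e = "(2 / real (Suc n)) powr p" and K = K])
          fix x y assume xy: "x \<in> space ?PB" "y \<in> space ?PB"
          show "(case (x, y) of (x, y) \<Rightarrow> dist x y powr p) \<le> K + t l x + t l y"
            using far[of x y l] by (simp add: K_def)
          assume "c n k x = c n k y" "c n k x \<noteq> 0"
          with c_near[of x y n k] xy p show "(case (x, y) of (x, y) \<Rightarrow> dist x y powr p) \<le> (2 / real (Suc n)) powr p"
            by (auto intro!: powr_mono2)
        qed (use c_le tm t0 dm in \<open>auto simp: K_def\<close>)
        have sp: "{x\<in>space ?PB. c n k x = j} = A n k j" for j by (simp add: A_def)
        have "(\<integral>\<^sup>+z. ennreal (case z of (x, y) \<Rightarrow> dist x y powr p) \<partial>\<gamma>)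
            \<le> ennreal ((2 / real (Suc n)) powr p + K * (?a N 0 + (\<Sum>j\<le>k. \<bar>?a N j - measure m (A n k j)\<bar>)))
              + 2 * ennreal (avg (t l) N \<omega>) + 2 * ennreal (\<tau> l)"
          using \<gamma>(2) unfolding sp am tI tm' .
        also have "\<dots> \<le> ennreal (2 * \<epsilon> / 5) + 2 * ennreal (\<epsilon> / 10) + 2 * ennreal (\<epsilon> / 40)"
          using elim(1,2) n l q by (intro add_mono mult_left_mono ennreal_leI) auto
        also have "\<dots> = ennreal (2 * \<epsilon> / 5) + ennreal (2 * (\<epsilon> / 10)) + ennreal (2 * (\<epsilon> / 40))"
          using ennreal_mult[of 2 "\<epsilon> / 10"] ennreal_mult[of 2 "\<epsilon> / 40"] \<epsilon> by simp
        also have "\<dots> = ennreal (2 * \<epsilon> / 5 + 2 * (\<epsilon> / 10) + 2 * (\<epsilon> / 40))"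
          using \<epsilon> by (simp add: ennreal_plus[symmetric] del: ennreal_plus)
        also have "\<dots> \<le> ennreal \<epsilon>" using \<epsilon> by (intro ennreal_leI) simp
        finally have nn: "(\<integral>\<^sup>+z. ennreal (case z of (x, y) \<Rightarrow> dist x y powr p) \<partial>\<gamma>) \<le> ennreal \<epsilon>" .
        have "sets \<gamma> = sets (?PB \<Otimes>\<^sub>M ?PB)"
          using \<gamma>(1) sets_m by (simp add: couplings_def cong: sets_pair_measure_cong)
        then have "(\<lambda>(x, y). dist x y powr p) \<in> borel_measurable \<gamma>"
          using dm by (simp cong: measurable_cong_sets)
        then have "(\<integral>(x, y). dist x y powr p \<partial>\<gamma>) = enn2real (\<integral>\<^sup>+z. ennreal (case z of (x, y) \<Rightarrow> dist x y powr p) \<partial>\<gamma>)"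
          by (intro integral_eq_nn_integral) auto
        also have "\<dots> \<le> \<epsilon>" using enn2real_mono[OF nn] \<epsilon> by simp
        finally show ?case using \<gamma>(1) by blast
      qed
    qed
  qed
qed

section \<open>Independence\<close>

lemma (in prob_space) indep_rv_prob:
  assumes ind: "indep_rv M E X F Y" and A: "A \<in> sets E" and B: "B \<in> sets F"
  shows "prob ((X -` A \<inter> space M) \<inter> (Y -` B \<inter> space M)) = prob (X -` A \<inter> space M) * prob (Y -` B \<inter> space M)"
  using ind unfolding indep_rv_def by (rule indep_setD) (rule in_vimage_algebra[OF A] in_vimage_algebra[OF B])+

text \<open>Passes from independence of variables of different types to \<open>indep_var\<close> for
  images in a common type; \<open>f\<close> and \<open>g\<close> generate smaller
  sigma-algebras.\<close>

lemma (in prob_space) indep_var_of_indep_rv: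
  assumes ind: "indep_rv M E X F Y" and X: "X \<in> measurable M E" and Y: "Y \<in> measurable M F"
    and f: "f \<in> measurable E N1" and g: "g \<in> measurable F N2"
  shows "indep_var N1 (\<lambda>\<omega>. f (X \<omega>)) N2 (\<lambda>\<omega>. g (Y \<omega>))"
proof -
  have sub: "sigma_sets (space M) {(\<lambda>\<omega>. h (Z \<omega>)) -` A \<inter> space M |A. A \<in> sets N}
      \<subseteq> sets (vimage_algebra (space M) Z G)"
    if Z: "Z \<in> measurable M G" and h: "h \<in> measurable G N" for Z :: "'a \<Rightarrow> 'z" and h G and N :: "'n measure"
  proof -
    have "(\<lambda>\<omega>. h (Z \<omega>)) \<in> measurable (vimage_algebra (space M) Z G) N"
      by (rule measurable_compose[OF measurable_vimage_algebra1 h]) (use Z in \<open>auto simp: measurable_def\<close>)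
    then have "{(\<lambda>\<omega>. h (Z \<omega>)) -` A \<inter> space M |A. A \<in> sets N} \<subseteq> sets (vimage_algebra (space M) Z G)"
      by (auto dest: measurable_sets)
    from sets.sigma_sets_subset[OF this] show ?thesis by simp
  qed
  have ev: "indep_set (sets (vimage_algebra (space M) X E)) (sets (vimage_algebra (space M) Y F))"
    using ind by (simp add: indep_rv_def)
  note ev1 = indep_setD_ev1[OF ev] and ev2 = indep_setD_ev2[OF ev]
  have "indep_set (sigma_sets (space M) {(\<lambda>\<omega>. f (X \<omega>)) -` A \<inter> space M |A. A \<in> sets N1})
      (sigma_sets (space M) {(\<lambda>\<omega>. g (Y \<omega>)) -` A \<inter> space M |A. A \<in> sets N2})"
    using sub[OF X f] sub[OF Y g] ev1 ev2 by (intro indep_setI indep_setD[OF ev]) blast+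
  with measurable_compose[OF X f] measurable_compose[OF Y g] show ?thesis
    unfolding indep_var_eq by blast
qed

text \<open>Finite cylinder events of a family are events of the family as one random variable,
  which is the form in which the independence of two sequences is given.\<close>

lemma cylinder_vimage:
  assumes J: "J \<noteq> {}" "finite J" "J \<subseteq> I" and A: "\<And>j. j \<in> J \<Longrightarrow> A j \<in> sets N"
    and Z: "\<And>i. i \<in> I \<Longrightarrow> Z i \<in> measurable M N"
  shows "\<exists>R\<in>sets (PiM I (\<lambda>_. N)).
    (\<lambda>\<omega>. \<lambda>i\<in>I. Z i \<omega>) -` R \<inter> space M = (\<Inter>j\<in>J. Z j -` A j \<inter> space M)"
proof -
  define R where "R = {x \<in> space (PiM I (\<lambda>_. N)). \<forall>j\<in>J. x j \<in> A j}"
  have "R \<in> sets (PiM I (\<lambda>_. N))"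
    unfolding R_def
  proof (rule sets.sets_Collect_finite_All[OF _ J(2)])
    fix j assume j: "j \<in> J"
    then have "(\<lambda>x. x j) -` A j \<inter> space (PiM I (\<lambda>_. N)) \<in> sets (PiM I (\<lambda>_. N))"
      using J(3) A[OF j] by (intro measurable_sets[OF measurable_component_singleton]) auto
    also have "(\<lambda>x. x j) -` A j \<inter> space (PiM I (\<lambda>_. N)) = {x \<in> space (PiM I (\<lambda>_. N)). x j \<in> A j}" by auto
    finally show "{x \<in> space (PiM I (\<lambda>_. N)). x j \<in> A j} \<in> sets (PiM I (\<lambda>_. N))" .
  qed
  moreover have "(\<lambda>\<omega>. \<lambda>i\<in>I. Z i \<omega>) -` R \<inter> space M = (\<Inter>j\<in>J. Z j -` A j \<inter> space M)"
  proof (intro set_eqI iffI)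
    fix \<omega> assume "\<omega> \<in> (\<lambda>\<omega>. \<lambda>i\<in>I. Z i \<omega>) -` R \<inter> space M"
    then have "\<omega> \<in> space M" "\<forall>j\<in>J. (\<lambda>i\<in>I. Z i \<omega>) j \<in> A j" by (auto simp: R_def)
    moreover have "(\<lambda>i\<in>I. Z i \<omega>) j = Z j \<omega>" if "j \<in> J" for j using that J(3) by auto
    ultimately show "\<omega> \<in> (\<Inter>j\<in>J. Z j -` A j \<inter> space M)" by simp
  next
    fix \<omega> assume *: "\<omega> \<in> (\<Inter>j\<in>J. Z j -` A j \<inter> space M)"
    then have \<omega>: "\<omega> \<in> space M" using J(1) by auto
    have "(\<lambda>i\<in>I. Z i \<omega>) \<in> space (PiM I (\<lambda>_. N))"
      using measurable_space[OF Z \<omega>] by (simp add: space_PiM)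
    moreover have "\<forall>j\<in>J. (\<lambda>i\<in>I. Z i \<omega>) j \<in> A j"
    proof
      fix j assume j: "j \<in> J"
      then have "Z j \<omega> \<in> A j" using * by blast
      then show "(\<lambda>i\<in>I. Z i \<omega>) j \<in> A j" using j J(3) by auto
    qed
    ultimately show "\<omega> \<in> (\<lambda>\<omega>. \<lambda>i\<in>I. Z i \<omega>) -` R \<inter> space M" using \<omega> by (simp add: R_def)
  qed
  ultimately show ?thesis by blast
qed

text \<open>Rectangles generate the sigma-algebra of a pair and are stable under intersection. Their
  probabilities factor between the two families by \<open>XY\<close>, and within each family by its
  own independence; regrouping gives the product over \<open>i\<close>.\<close>

lemma (in prob_space) indep_vars_pair:
  assumes X: "indep_vars (\<lambda>_. E) X I" and Y: "indep_vars (\<lambda>_. F) Y I"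
    and XY: "indep_rv M (PiM I (\<lambda>_. E)) (\<lambda>\<omega>. \<lambda>i\<in>I. X i \<omega>) (PiM I (\<lambda>_. F)) (\<lambda>\<omega>. \<lambda>i\<in>I. Y i \<omega>)"
    and h: "(\<lambda>(x, y). h x y) \<in> measurable (E \<Otimes>\<^sub>M F) G"
  shows "indep_vars (\<lambda>_. G) (\<lambda>i \<omega>. h (X i \<omega>) (Y i \<omega>)) I"
proof -
  have mX: "X i \<in> measurable M E" and mY: "Y i \<in> measurable M F" if "i \<in> I" for i
    using X Y that by (auto simp: indep_vars_def2)
  define S where "S i = {(X i -` A \<inter> space M) \<inter> (Y i -` C \<inter> space M) |A C. A \<in> sets E \<and> C \<in> sets F}" for i
  have inter: "prob ((\<Inter>j\<in>J. X j -` A j \<inter> space M) \<inter> (\<Inter>j\<in>J. Y j -` C j \<inter> space M))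
      = prob (\<Inter>j\<in>J. X j -` A j \<inter> space M) * prob (\<Inter>j\<in>J. Y j -` C j \<inter> space M)"
    if J: "J \<noteq> {}" "finite J" "J \<subseteq> I" and AC: "\<And>j. j \<in> J \<Longrightarrow> A j \<in> sets E" "\<And>j. j \<in> J \<Longrightarrow> C j \<in> sets F" for J A C
  proof -
    have "\<exists>R\<in>sets (PiM I (\<lambda>_. E)).
        (\<lambda>\<omega>. \<lambda>i\<in>I. X i \<omega>) -` R \<inter> space M = (\<Inter>j\<in>J. X j -` A j \<inter> space M)"
      by (rule cylinder_vimage[OF J]) (use AC mX in auto)
    then obtain R where R: "R \<in> sets (PiM I (\<lambda>_. E))"
      "(\<lambda>\<omega>. \<lambda>i\<in>I. X i \<omega>) -` R \<inter> space M = (\<Inter>j\<in>J. X j -` A j \<inter> space M)"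
      by blast
    have "\<exists>R\<in>sets (PiM I (\<lambda>_. F)).
        (\<lambda>\<omega>. \<lambda>i\<in>I. Y i \<omega>) -` R \<inter> space M = (\<Inter>j\<in>J. Y j -` C j \<inter> space M)"
      by (rule cylinder_vimage[OF J]) (use AC mY in auto)
    then obtain R' where R': "R' \<in> sets (PiM I (\<lambda>_. F))"
      "(\<lambda>\<omega>. \<lambda>i\<in>I. Y i \<omega>) -` R' \<inter> space M = (\<Inter>j\<in>J. Y j -` C j \<inter> space M)"
      by blast
    from indep_rv_prob[OF XY R(1) R'(1)] show ?thesis unfolding R(2) R'(2) .
  qed
  have "indep_sets S I"
  proof (rule indep_setsI)
    fix i assume "i \<in> I"
    then show "S i \<subseteq> events" using mX mY unfolding S_def by (auto intro!: sets.Int measurable_sets)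
  next
    fix Q J assume J: "J \<noteq> {}" "J \<subseteq> I" "finite J" and "\<forall>j\<in>J. Q j \<in> S j"
    then have "\<forall>j\<in>J. \<exists>A C. Q j = (X j -` A \<inter> space M) \<inter> (Y j -` C \<inter> space M) \<and> A \<in> sets E \<and> C \<in> sets F"
      by (simp add: S_def)
    then obtain A C where AC: "\<And>j. j \<in> J \<Longrightarrow> A j \<in> sets E" "\<And>j. j \<in> J \<Longrightarrow> C j \<in> sets F"
      and Q: "\<And>j. j \<in> J \<Longrightarrow> Q j = (X j -` A j \<inter> space M) \<inter> (Y j -` C j \<inter> space M)"
      by metis
    have "(\<Inter>j\<in>J. Q j) = (\<Inter>j\<in>J. X j -` A j \<inter> space M) \<inter> (\<Inter>j\<in>J. Y j -` C j \<inter> space M)"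
      using Q J(1) by auto
    then have "prob (\<Inter>j\<in>J. Q j) = prob (\<Inter>j\<in>J. X j -` A j \<inter> space M) * prob (\<Inter>j\<in>J. Y j -` C j \<inter> space M)"
      using inter[OF J(1,3,2) AC] by simp
    also have "\<dots> = (\<Prod>j\<in>J. prob (X j -` A j \<inter> space M)) * (\<Prod>j\<in>J. prob (Y j -` C j \<inter> space M))"
      using indep_varsD[OF X J(1,3,2), of A] indep_varsD[OF Y J(1,3,2), of C] AC by simp
    also have "\<dots> = (\<Prod>j\<in>J. prob (Q j))"
      unfolding prod.distrib[symmetric]
    proof (rule prod.cong[OF refl])
      fix j assume j: "j \<in> J"
      then show "prob (X j -` A j \<inter> space M) * prob (Y j -` C j \<inter> space M) = prob (Q j)"
        using inter[of "{j}" A C] AC J(2) Q[OF j] by auto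
    qed
    finally show "prob (\<Inter>j\<in>J. Q j) = (\<Prod>j\<in>J. prob (Q j))" .
  qed
  moreover have "Int_stable (S i)" for i
  proof (unfold Int_stable_def, intro ballI)
    fix a b assume "a \<in> S i" "b \<in> S i"
    then obtain A C A' C' where "A \<in> sets E" "C \<in> sets F" "A' \<in> sets E" "C' \<in> sets F"
      "a = (X i -` A \<inter> space M) \<inter> (Y i -` C \<inter> space M)" "b = (X i -` A' \<inter> space M) \<inter> (Y i -` C' \<inter> space M)"
      by (auto simp: S_def)
    then show "a \<inter> b \<in> S i" unfolding S_def
      by (intro CollectI exI[of _ "A \<inter> A'"] exI[of _ "C \<inter> C'"]) auto
  qed
  ultimately have ind: "indep_sets (\<lambda>i. sigma_sets (space M) (S i)) I" by (rule indep_sets_sigma)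
  have mh: "(\<lambda>\<omega>. h (X i \<omega>) (Y i \<omega>)) \<in> measurable N G"
    if "X i \<in> measurable N E" "Y i \<in> measurable N F" for N i
    using measurable_compose[OF measurable_Pair[OF that] h] by simp
  have "{(\<lambda>\<omega>. h (X i \<omega>) (Y i \<omega>)) -` A \<inter> space M |A. A \<in> sets G} \<subseteq> sigma_sets (space M) (S i)"
    if i: "i \<in> I" for i
  proof -
    \<comment> \<open>Both components are measurable for the sigma-algebra generated by the
      rectangles of index \<open>i\<close>, as one side may be the whole space; hence so is every
      measurable function of the pair.\<close>
    let ?N = "sigma (space M) (S i)"
    have S: "S i \<subseteq> Pow (space M)" by (auto simp: S_def)
    have sp: "space ?N = space M" "sets ?N = sigma_sets (space M) (S i)" using S by auto
    have "X i \<in> measurable ?N E"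
    proof (rule measurableI)
      fix A assume "A \<in> sets E"
      moreover have "X i -` A \<inter> space M = (X i -` A \<inter> space M) \<inter> (Y i -` space F \<inter> space M)"
        using measurable_space[OF mY[OF i]] by auto
      ultimately have "X i -` A \<inter> space M \<in> S i" unfolding S_def by blast
      then show "X i -` A \<inter> space ?N \<in> sets ?N" by (simp add: sp)
    qed (use measurable_space[OF mX[OF i]] sp in auto)
    moreover have "Y i \<in> measurable ?N F"
    proof (rule measurableI)
      fix A assume "A \<in> sets F"
      moreover have "Y i -` A \<inter> space M = (X i -` space E \<inter> space M) \<inter> (Y i -` A \<inter> space M)"
        using measurable_space[OF mX[OF i]] by auto
      ultimately have "Y i -` A \<inter> space M \<in> S i" unfolding S_def by blast
      then show "Y i -` A \<inter> space ?N \<in> sets ?N" by (simp add: sp)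
    qed (use measurable_space[OF mY[OF i]] sp in auto)
    ultimately have "(\<lambda>\<omega>. h (X i \<omega>) (Y i \<omega>)) \<in> measurable ?N G" by (rule mh)
    from measurable_sets[OF this] show ?thesis unfolding sp by blast
  qed
  then have "indep_sets (\<lambda>i. {(\<lambda>\<omega>. h (X i \<omega>) (Y i \<omega>)) -` A \<inter> space M |A. A \<in> sets G}) I"
    by (rule indep_sets_mono_sets[OF ind])
  moreover have "random_variable G (\<lambda>\<omega>. h (X i \<omega>) (Y i \<omega>))" if "i \<in> I" for i
    by (rule mh[OF mX[OF that] mY[OF that]])
  ultimately show ?thesis unfolding indep_vars_def2 by blast
qed

text \<open>The freezing principle: as the joint law of \<open>B\<close> and \<open>V\<close> is a
  product, Fubini's theorem over a set \<open>C\<close> of values of \<open>B\<close> is exactly the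
  characterisation of the conditional expectation. The kernel depends on \<open>\<omega>\<close>
  through \<open>B\<close> alone.\<close>

lemma (in prob_space) regular_conditional_law_indep:
  assumes ind: "indep_var F B G V" and f: "(\<lambda>(\<beta>, v). f \<beta> v) \<in> measurable (F \<Otimes>\<^sub>M G) E"
  shows "regular_conditional_law M E (\<lambda>\<omega>. f (B \<omega>) (V \<omega>)) F B (\<lambda>\<omega>. distr (distr M G V) E (f (B \<omega>)))"
proof -
  have B: "B \<in> measurable M F" and V: "V \<in> measurable M G"
    and joint: "distr M F B \<Otimes>\<^sub>M distr M G V = distr M (F \<Otimes>\<^sub>M G) (\<lambda>x. (B x, V x))"
    using ind unfolding indep_var_distribution_eq by auto
  let ?m = "distr M G V" and ?L = "distr M F B" and ?A = "vimage_algebra (space M) B F"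
  interpret m: prob_space ?m by (rule prob_space_distr[OF V])
  interpret L: prob_space ?L by (rule prob_space_distr[OF B])
  interpret P: pair_prob_space ?L ?m ..
  have Bs: "B \<in> space M \<rightarrow> space F" using B by (auto simp: measurable_def)
  have k0: "(\<lambda>\<beta>. distr ?m E (f \<beta>)) \<in> measurable F (prob_algebra E)"
    by (rule measurable_distr_prob_space2[OF measurable_const f])
      (simp add: space_prob_algebra m.prob_space_axioms)
  have k: "(\<lambda>\<omega>. distr ?m E (f (B \<omega>))) \<in> measurable ?A (prob_algebra E)"
    by (rule measurable_compose[OF measurable_vimage_algebra1[OF Bs] k0])
  have sub: "subalgebra M ?A"
    using measurable_sets[OF B] by (auto simp: subalgebra_def sets_vimage_algebra2[OF Bs])
  interpret A: finite_measure_subalgebra M ?A by unfold_locales (rule sub)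
  have fm: "(\<lambda>\<omega>. f (B \<omega>) (V \<omega>)) \<in> measurable M E"
    using measurable_compose[OF measurable_Pair[OF B V] f] by simp
  have "AE \<omega> in M. measure (distr ?m E (f (B \<omega>))) S
      = real_cond_exp M ?A (\<lambda>\<omega>. indicator S (f (B \<omega>) (V \<omega>))) \<omega>" if S: "S \<in> sets E" for S
  proof -
    let ?k = "\<lambda>\<beta>. measure (distr ?m E (f \<beta>)) S"
    have km: "?k \<in> borel_measurable F"
      by (rule measurable_compose[OF k0 measurable_measure_prob_algebra[OF S]])
    have gm: "(\<lambda>\<omega>. ?k (B \<omega>)) \<in> borel_measurable ?A"
      by (rule measurable_compose[OF measurable_vimage_algebra1[OF Bs] km])
    have kb: "0 \<le> ?k \<beta>" "?k \<beta> \<le> 1" if "\<beta> \<in> space F" for \<beta>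
    proof -
      have "f \<beta> \<in> measurable G E" using measurable_compose[OF measurable_Pair1'[OF that] f] by simp
      then interpret K: prob_space "distr ?m E (f \<beta>)" by (intro m.prob_space_distr) simp
      show "0 \<le> ?k \<beta>" "?k \<beta> \<le> 1" by (auto simp: K.prob_le_1)
    qed
    have gi: "integrable M (\<lambda>\<omega>. ?k (B \<omega>))"
    proof (rule integrable_const_bound[where B = 1])
      show "AE \<omega> in M. norm (?k (B \<omega>)) \<le> 1" using kb measurable_space[OF B] by (intro AE_I2) auto
      show "(\<lambda>\<omega>. ?k (B \<omega>)) \<in> borel_measurable M" by (rule measurable_compose[OF B km])
    qed
    have ii: "integrable M (\<lambda>\<omega>. indicator S (f (B \<omega>) (V \<omega>)) :: real)"
    proof (rule integrable_const_bound[where B = 1])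
      show "(\<lambda>\<omega>. indicator S (f (B \<omega>) (V \<omega>)) :: real) \<in> borel_measurable M"
        by (rule measurable_compose[OF fm]) (use S in simp)
    qed (auto simp: indicator_def)
    have "AE \<omega> in M. real_cond_exp M ?A (\<lambda>\<omega>. indicator S (f (B \<omega>) (V \<omega>))) \<omega> = ?k (B \<omega>)"
    proof (rule A.real_cond_exp_charact[OF _ ii gi gm])
      fix Q assume "Q \<in> sets ?A"
      then obtain C where C: "C \<in> sets F" "Q = B -` C \<inter> space M" by (auto simp: sets_vimage_algebra2[OF Bs])
      let ?h = "\<lambda>(\<beta>, v). indicator C \<beta> * indicator S (f \<beta> v) :: real"
      have h1: "(\<lambda>z. indicator S (f (fst z) (snd z)) :: real) \<in> borel_measurable (F \<Otimes>\<^sub>M G)"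
        by (rule measurable_compose[OF f[unfolded case_prod_beta']]) (use S in simp)
      have h2: "(\<lambda>z. indicator C (fst z) :: real) \<in> borel_measurable (F \<Otimes>\<^sub>M G)"
        by (rule measurable_compose[OF measurable_fst]) (use C in simp)
      have hm: "?h \<in> borel_measurable (F \<Otimes>\<^sub>M G)"
        unfolding case_prod_beta' using h1 h2 by measurable
      have hi: "integrable (?L \<Otimes>\<^sub>M ?m) ?h"
      proof (rule P.integrable_const_bound[where B = 1])
        show "?h \<in> borel_measurable (?L \<Otimes>\<^sub>M ?m)" using hm by simp
      qed (auto simp: indicator_def)
      have "(\<integral>\<omega>\<in>Q. indicator S (f (B \<omega>) (V \<omega>)) \<partial>M) = (\<integral>\<omega>. ?h (B \<omega>, V \<omega>) \<partial>M)"
        unfolding set_lebesgue_integral_def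
        by (rule Bochner_Integration.integral_cong) (auto simp: C indicator_def)
      also have "\<dots> = (\<integral>z. ?h z \<partial>(?L \<Otimes>\<^sub>M ?m))"
        unfolding joint by (rule integral_distr[symmetric, OF measurable_Pair[OF B V] hm])
      also have "\<dots> = (\<integral>\<beta>. \<integral>v. ?h (\<beta>, v) \<partial>?m \<partial>?L)" by (rule P.integral_fst'[symmetric, OF hi])
      also have "\<dots> = (\<integral>\<beta>. indicator C \<beta> * ?k \<beta> \<partial>?L)"
      proof (rule Bochner_Integration.integral_cong[OF refl])
        fix \<beta> assume "\<beta> \<in> space ?L"
        then have f\<beta>: "f \<beta> \<in> measurable ?m E" using measurable_compose[OF measurable_Pair1'[of \<beta> F] f] by simp
        have "(\<integral>v. indicator S (f \<beta> v) \<partial>?m) = (\<integral>x. (indicator S x :: real) \<partial>distr ?m E (f \<beta>))"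
          using integral_distr[OF f\<beta>, of "indicator S :: _ \<Rightarrow> real"] S by simp
        also have "\<dots> = ?k \<beta>" using S sets.sets_into_space[OF S] by (simp add: Int_absorb2)
        finally show "(\<integral>v. ?h (\<beta>, v) \<partial>?m) = indicator C \<beta> * ?k \<beta>" by simp
      qed
      also have "\<dots> = (\<integral>\<omega>. indicator C (B \<omega>) * ?k (B \<omega>) \<partial>M)"
        by (rule integral_distr[OF B]) (use km C in measurable)
      also have "\<dots> = (\<integral>\<omega>\<in>Q. ?k (B \<omega>) \<partial>M)"
        unfolding set_lebesgue_integral_def
        by (rule Bochner_Integration.integral_cong) (auto simp: C indicator_def)
      finally show "(\<integral>\<omega>\<in>Q. indicator S (f (B \<omega>) (V \<omega>)) \<partial>M) = (\<integral>\<omega>\<in>Q. ?k (B \<omega>) \<partial>M)" .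
    qed
    then show ?thesis by (rule AE_mp) (auto intro!: AE_I2)
  qed
  with k show ?thesis by (simp add: regular_conditional_law_def)
qed

section \<open>Constant paths and the law of the driving path\<close>

lemma measurable_const_bcontfun:
  "const_bcontfun \<in> measurable borel (path_borel T :: ('d::finite) path measure)"
proof (rule measurable_path_borelI)
  have "dist (const_bcontfun x :: 'd path) (const_bcontfun y) \<le> 1 * dist x y" for x y
    by (rule dist_bound) (simp add: const_bcontfun.rep_eq)
  then have "1-lipschitz_on UNIV (const_bcontfun :: real ^ 'd \<Rightarrow> 'd path)" by (intro lipschitz_onI) auto
  then show "(const_bcontfun :: real ^ 'd \<Rightarrow> 'd path) \<in> borel_measurable borel"
    by (intro borel_measurable_continuous_onI lipschitz_on_continuous_on)
qed simp

lemma Lq_const_bcontfun: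
  fixes Z :: "'w \<Rightarrow> real ^ ('d::finite)"
  assumes Z: "Z \<in> Lq_space M q borel" and q: "0 \<le> q"
  shows "(\<lambda>\<omega>. const_bcontfun (Z \<omega>)) \<in> Lq_space M q (path_borel T)"
proof -
  have m: "(\<lambda>\<omega>. const_bcontfun (Z \<omega>)) \<in> measurable M (path_borel T)"
    using Z by (auto simp: Lq_space_def intro: measurable_compose[OF _ measurable_const_bcontfun])
  have le: "norm (const_bcontfun x :: 'd path) \<le> norm x" for x
    by (rule norm_bound) (simp add: const_bcontfun.rep_eq)
  have "integrable M (\<lambda>\<omega>. norm (Z \<omega>) powr q)" using Z by (simp add: Lq_space_def)
  from integrable_powr_le[OF this measurable_path_norm[OF m] q _ le]
  have "integrable M (\<lambda>\<omega>. norm (const_bcontfun (Z \<omega>) :: 'd path) powr q)" by simp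
  with m show ?thesis by (simp add: Lq_space_def)
qed

text \<open>The joint law of an independent pair is the product of its marginals, so the law of the
  sum depends on the two laws only. This gives all \<open>V i\<close> and \<open>Vbar\<close> one
  common law.\<close>

lemma (in prob_space) distr_add_indep_cong:
  fixes X X' Y Y' :: "'a \<Rightarrow> ('d::finite) path"
  assumes T: "T > 0" and ind: "indep_var (path_borel T) X (path_borel T) Y"
      "indep_var (path_borel T) X' (path_borel T) Y'"
    and X: "distr M (path_borel T) X = distr M (path_borel T) X'"
    and Y: "distr M (path_borel T) Y = distr M (path_borel T) Y'"
  shows "distr M (path_borel T) (\<lambda>\<omega>. X \<omega> + Y \<omega>) = distr M (path_borel T) (\<lambda>\<omega>. X' \<omega> + Y' \<omega>)"
proof -
  let ?P = "path_borel T :: 'd path measure"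
  have add: "(\<lambda>z. fst z + snd z) \<in> measurable (?P \<Otimes>\<^sub>M ?P) ?P"
    by (rule measurable_path_add[OF T]) auto
  have *: "distr M ?P (\<lambda>\<omega>. X \<omega> + Y \<omega>) = distr (distr M ?P X \<Otimes>\<^sub>M distr M ?P Y) ?P (\<lambda>z. fst z + snd z)"
    if i: "indep_var ?P X ?P Y" for X Y :: "'a \<Rightarrow> 'd path"
  proof -
    have m: "X \<in> measurable M ?P" "Y \<in> measurable M ?P"
      and j: "distr M ?P X \<Otimes>\<^sub>M distr M ?P Y = distr M (?P \<Otimes>\<^sub>M ?P) (\<lambda>x. (X x, Y x))"
      using i unfolding indep_var_distribution_eq by auto
    show ?thesis unfolding j by (subst distr_distr[OF add measurable_Pair[OF m]]) (simp add: comp_def)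
  qed
  show ?thesis unfolding *[OF ind(1)] *[OF ind(2)] X Y ..
qed

text \<open>Conditional laws are determined only almost surely, so a version \<open>\<kappa>\<close>
  is a witness, and one and the same version appears in the equation and in the limit.\<close>

theorem corollary26:
  fixes T p p' K :: real
    and b :: "real \<Rightarrow> real ^ ('d::finite) \<Rightarrow> (real ^ 'd) measure \<Rightarrow> real ^ 'd"
    and M :: "'w measure"
    and \<zeta> :: "nat \<Rightarrow> 'w \<Rightarrow> real ^ 'd" and W :: "nat \<Rightarrow> 'w \<Rightarrow> 'd path"
    and \<zeta>bar :: "'w \<Rightarrow> real ^ 'd" and Wbar :: "'w \<Rightarrow> 'd path" and B :: "'w \<Rightarrow> 'd path"
  assumes "T > 0" and "1 \<le> p" and "p < p'"
    and b_measurable: "(\<lambda>(t, x, \<mu>). b t x \<mu>) \<in> borel_measurable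
          (restrict_space borel {0..T} \<Otimes>\<^sub>M borel \<Otimes>\<^sub>M wasserstein_borel p borel)"
    and b_lipschitz: "\<And>t x x' \<mu> \<mu>'.
          t \<in> {0..T} \<Longrightarrow> \<mu> \<in> prob_moment p borel \<Longrightarrow> \<mu>' \<in> prob_moment p borel \<Longrightarrow>
          norm (b t x \<mu> - b t x' \<mu>') powr p
            \<le> K * (norm (x - x') powr p + enn2real (wasserstein p \<mu> \<mu>') powr p)"
    and b_integrable: "set_integrable lborel {0..T} (\<lambda>t. b t 0 (return borel 0))"
    and "prob_space M"
    and \<zeta>_Lp': "\<And>i. i \<ge> 1 \<Longrightarrow> \<zeta> i \<in> Lq_space M p' borel"
    and W_Lp': "\<And>i. i \<ge> 1 \<Longrightarrow> W i \<in> Lq_space M p' (path_borel T)"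
    and \<zeta>_indep: "prob_space.indep_vars M (\<lambda>_. borel) \<zeta> {1..}"
    and W_indep: "prob_space.indep_vars M (\<lambda>_. path_borel T) W {1..}"
    and \<zeta>_ident: "\<And>i. i \<ge> 1 \<Longrightarrow> distr M borel (\<zeta> i) = distr M borel (\<zeta> 1)"
    and W_ident: "\<And>i. i \<ge> 1 \<Longrightarrow> distr M (path_borel T) (W i) = distr M (path_borel T) (W 1)"
    and \<zeta>_W_indep: "indep_rv M
          (PiM {1..} (\<lambda>_. borel)) (\<lambda>\<omega>. \<lambda>i\<in>{1..}. \<zeta> i \<omega>)
          (PiM {1..} (\<lambda>_. path_borel T)) (\<lambda>\<omega>. \<lambda>i\<in>{1..}. W i \<omega>)"
    and "\<zeta>bar \<in> borel_measurable M"
    and "distr M borel \<zeta>bar = distr M borel (\<zeta> 1)"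
    and "Wbar \<in> measurable M (path_borel T)"
    and "distr M (path_borel T) Wbar = distr M (path_borel T) (W 1)"
    and \<zeta>bar_Wbar_indep: "indep_rv M borel \<zeta>bar (path_borel T) Wbar"
    and B_Lp: "B \<in> Lq_space M p (path_borel T)"
    and B_indep: "indep_rv M
          (path_borel T) B
          (PiM {1..} (\<lambda>_. borel) \<Otimes>\<^sub>M PiM {1..} (\<lambda>_. path_borel T) \<Otimes>\<^sub>M borel \<Otimes>\<^sub>M path_borel T)
          (\<lambda>\<omega>. (\<lambda>i\<in>{1..}. \<zeta> i \<omega>, \<lambda>i\<in>{1..}. W i \<omega>, \<zeta>bar \<omega>, Wbar \<omega>))"
  shows "\<exists>(X :: nat \<Rightarrow> nat \<Rightarrow> 'w \<Rightarrow> 'd path) (Xbar :: 'w \<Rightarrow> 'd path) (\<kappa> :: 'w \<Rightarrow> 'd path measure).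
      (\<forall>N\<ge>1. (\<forall>i\<in>{1..N}. X N i \<in> Lq_space M p (path_borel T)) \<and>
              particle_solution M T b \<zeta> W B N (X N)) \<and>
      Xbar \<in> Lq_space M p (path_borel T) \<and>
      regular_conditional_law M (path_borel T) Xbar (path_borel T) B \<kappa> \<and>
      mean_field_solution M T b \<zeta>bar Wbar B \<kappa> Xbar \<and>
      (AE \<omega> in M.
        (\<lambda>N. wasserstein p (empirical_measure (path_borel T) N (\<lambda>i. X N i \<omega>)) (\<kappa> \<omega>))
          \<longlonglongrightarrow> 0)"
proof -
  interpret prob_space M by fact
  let ?PB = "path_borel T :: 'd path measure" and ?PS = "path_space T :: 'd path set"
  note T = \<open>T > 0\<close> and p = \<open>1 \<le> p\<close> and pp' = \<open>p < p'\<close>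
  \<comment> \<open>The factor \<open>2\<close> comes from
    \<open>x powr p + y powr p \<le> 2 * (x + y) powr p\<close>, and the maximum keeps
    \<open>L\<close> positive.\<close>
  define L where "L = (2 * max K 1) powr (1 / p)"
  have L0: "L > 0" by (simp add: L_def)
  have Lp: "L powr p = 2 * max K 1" using p by (simp add: L_def powr_powr)
  interpret mean_field_drift T p L b
  proof
    fix t :: real and x x' :: "real ^ 'd" and \<mu> \<mu>' :: "(real ^ 'd) measure"
    assume t: "t \<in> {0..T}" and \<mu>: "\<mu> \<in> prob_moment p borel" "\<mu>' \<in> prob_moment p borel"
    define w where "w = enn2real (wasserstein p \<mu> \<mu>')"
    have w: "0 \<le> w" by (simp add: w_def)
    have "norm (b t x \<mu> - b t x' \<mu>') powr p \<le> K * (norm (x - x') powr p + w powr p)"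
      unfolding w_def by (rule b_lipschitz[OF t \<mu>])
    also have "\<dots> \<le> max K 1 * (norm (x - x') powr p + w powr p)" by (intro mult_right_mono) auto
    also have "\<dots> \<le> max K 1 * (2 * (norm (x - x') + w) powr p)"
    proof (rule mult_left_mono)
      have "norm (x - x') powr p \<le> (norm (x - x') + w) powr p" "w powr p \<le> (norm (x - x') + w) powr p"
        using w p by (intro powr_mono2; simp)+
      then show "norm (x - x') powr p + w powr p \<le> 2 * (norm (x - x') + w) powr p" by linarith
    qed simp
    also have "\<dots> = (L * (norm (x - x') + w)) powr p" using L0 w by (simp add: powr_mult Lp)
    finally have "norm (b t x \<mu> - b t x' \<mu>') \<le> ((L * (norm (x - x') + w)) powr p) powr (1 / p)"
      using p by (intro le_powr_inverseI) auto
    also have "\<dots> = L * (norm (x - x') + w)" using L0 w p by (simp add: powr_powr)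
    finally show "norm (b t x \<mu> - b t x' \<mu>') \<le> L * (norm (x - x') + enn2real (wasserstein p \<mu> \<mu>'))"
      by (simp add: w_def)
  qed (use T p L0 b_measurable b_integrable in auto)
  have fin: "finite_measure M" by (rule finite_measure_axioms)
  have nPB: "norm \<in> borel_measurable PB" using measurable_path_norm[of "\<lambda>x. x" PB T] by simp
  have \<zeta>m: "\<zeta> i \<in> borel_measurable M" and Wm: "W i \<in> measurable M PB" if "i \<ge> 1" for i
    using \<zeta>_Lp'[OF that] W_Lp'[OF that] by (auto simp: Lq_space_def)
  have Bm: "B \<in> measurable M PB" using B_Lp by (simp add: Lq_space_def)
  have Wbm: "Wbar \<in> measurable M PB" and \<zeta>bm: "\<zeta>bar \<in> borel_measurable M" by fact+
  \<comment> \<open>\<open>B\<close> is left out, so that the sequence is i.i.d.; it comes back as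
    the translation in \<open>msol\<close>.\<close>
  define V where "V i \<omega> = const_bcontfun (\<zeta> i \<omega>) + W i \<omega>" for i \<omega>
  define Vbar where "Vbar \<omega> = const_bcontfun (\<zeta>bar \<omega>) + Wbar \<omega>" for \<omega>
  define m where "m = distr M PB (V 1)"
  have V': "V i \<in> Lq_space M p' PB" if "i \<ge> 1" for i
    unfolding V_def[abs_def] using p pp' that
    by (intro Lq_path_add[OF T] Lq_const_bcontfun \<zeta>_Lp' W_Lp') auto
  have VL: "V i \<in> Lq_space M p PB" if "i \<ge> 1" for i
    by (rule Lq_space_lower[OF V'[OF that] nPB]) (use p pp' fin in auto)
  have Vm: "V i \<in> measurable M PB" if "i \<ge> 1" for i using VL[OF that] by (simp add: Lq_space_def)
  have mP: "m \<in> prob_moment p PB"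
    unfolding m_def by (rule Lq_prob_moment[OF prob_space_axioms VL]) simp
  have mom: "integrable m (\<lambda>x. norm x powr p')"
  proof -
    have "(\<lambda>x. norm x powr p') \<in> borel_measurable PB" using nPB by measurable
    then show ?thesis
      unfolding m_def using V'[of 1] by (subst integrable_distr_eq[OF Vm]) (auto simp: Lq_space_def)
  qed
  have cm: "const_bcontfun \<in> measurable borel PB" by (rule measurable_const_bcontfun)
  have idPB: "(\<lambda>x. x) \<in> measurable PB PB" by simp
  have indep1: "indep_var PB (\<lambda>\<omega>. const_bcontfun (\<zeta> i \<omega>)) PB (W i)" if i: "i \<ge> 1" for i
  proof -
    have r: "(\<lambda>\<omega>. \<lambda>i\<in>{1..}. \<zeta> i \<omega>) \<in> measurable M (PiM {1..} (\<lambda>_. borel))"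
      "(\<lambda>\<omega>. \<lambda>i\<in>{1..}. W i \<omega>) \<in> measurable M (PiM {1..} (\<lambda>_. PB))"
      using \<zeta>m Wm by (auto intro!: measurable_restrict)
    have "(\<lambda>x. x i) \<in> measurable (PiM {1..} (\<lambda>_. borel :: (real ^ 'd) measure)) borel"
      by (rule measurable_component_singleton) (use i in simp)
    from measurable_compose[OF this cm]
    have c1: "(\<lambda>x. const_bcontfun (x i)) \<in> measurable (PiM {1..} (\<lambda>_. borel)) PB" .
    have c2: "(\<lambda>x. x i) \<in> measurable (PiM {1..} (\<lambda>_. PB)) PB"
      by (rule measurable_component_singleton) (use i in simp)
    from indep_var_of_indep_rv[OF \<zeta>_W_indep r c1 c2] i show ?thesis by simp
  qed
  have indepb: "indep_var PB (\<lambda>\<omega>. const_bcontfun (\<zeta>bar \<omega>)) PB Wbar"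
    by (rule indep_var_of_indep_rv[OF \<zeta>bar_Wbar_indep \<zeta>bm Wbm cm idPB])
  have cd: "distr M PB (\<lambda>\<omega>. const_bcontfun (Z \<omega>)) = distr M PB (\<lambda>\<omega>. const_bcontfun (\<zeta> 1 \<omega>))"
    if "Z \<in> borel_measurable M" "distr M borel Z = distr M borel (\<zeta> 1)" for Z
    using distr_distr[OF cm that(1)] distr_distr[OF cm \<zeta>m[of 1]] that(2) by (simp add: comp_def)
  have law: "distr M PB (V i) = m" if i: "i \<ge> 1" for i
    unfolding m_def V_def[abs_def]
    by (rule distr_add_indep_cong[OF T indep1[OF i] indep1[of 1] cd[OF \<zeta>m[OF i] \<zeta>_ident[OF i]] W_ident[OF i]]) simp
  have lawb: "distr M PB Vbar = m"
    unfolding m_def V_def[abs_def] Vbar_def[abs_def]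
    by (rule distr_add_indep_cong[OF T indepb indep1[of 1] cd[OF \<zeta>bm]]) (simp, fact+)
  have iid: "iid_sequence M PB V m"
  proof
    have "(\<lambda>(x, y). const_bcontfun x + y) \<in> measurable (borel \<Otimes>\<^sub>M PB) PB"
      unfolding case_prod_beta'
      by (rule measurable_path_add[OF T measurable_compose[OF measurable_fst cm] measurable_snd])
    from indep_vars_pair[OF \<zeta>_indep W_indep \<zeta>_W_indep this]
    show "indep_vars (\<lambda>_. PB) V {1..}" unfolding V_def[abs_def] .
  qed (rule law)
  have Vbm: "Vbar \<in> measurable M PB"
    unfolding Vbar_def[abs_def] by (rule measurable_path_add[OF T measurable_compose[OF \<zeta>bm cm] Wbm])
  have VbL: "Vbar \<in> Lq_space M p PB"
  proof -
    have n: "(\<lambda>x. norm x powr p) \<in> borel_measurable PB" using nPB by measurable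
    have "integrable M (\<lambda>\<omega>. norm (Vbar \<omega>) powr p)"
      using prob_momentD(5)[OF mP] integrable_distr_eq[OF Vbm n] by (simp add: lawb)
    with Vbm show ?thesis by (simp add: Lq_space_def)
  qed
  \<comment> \<open>\<open>Vbar\<close> is a function of the last two components of the tuple from
    which \<open>B\<close> is independent.\<close>
  have BV: "indep_var PB B PB Vbar"
  proof -
    let ?N = "PiM {1..} (\<lambda>_. borel) \<Otimes>\<^sub>M PiM {1..} (\<lambda>_. PB) \<Otimes>\<^sub>M borel \<Otimes>\<^sub>M PB
      :: ((nat \<Rightarrow> real ^ 'd) \<times> (nat \<Rightarrow> 'd path) \<times> (real ^ 'd) \<times> 'd path) measure"
    have r: "(\<lambda>\<omega>. \<lambda>i\<in>{1..}. \<zeta> i \<omega>) \<in> measurable M (PiM {1..} (\<lambda>_. borel))"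
      "(\<lambda>\<omega>. \<lambda>i\<in>{1..}. W i \<omega>) \<in> measurable M (PiM {1..} (\<lambda>_. PB))"
      using \<zeta>m Wm by (auto intro!: measurable_restrict)
    have t: "(\<lambda>\<omega>. (\<lambda>i\<in>{1..}. \<zeta> i \<omega>, \<lambda>i\<in>{1..}. W i \<omega>, \<zeta>bar \<omega>, Wbar \<omega>)) \<in> measurable M ?N"
      by (intro measurable_Pair r \<zeta>bm Wbm)
    have c: "(\<lambda>z. const_bcontfun (fst (snd (snd z))) + snd (snd (snd z))) \<in> measurable ?N PB"
    proof (rule measurable_path_add[OF T])
      show "(\<lambda>z. const_bcontfun (fst (snd (snd z)))) \<in> measurable ?N PB"
        by (rule measurable_compose[OF _ cm]) measurable
      show "(\<lambda>z. snd (snd (snd z))) \<in> measurable ?N PB" by measurable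
    qed
    from indep_var_of_indep_rv[OF B_indep Bm t idPB c] show ?thesis by (simp add: Vbar_def[abs_def])
  qed
  define X where "X N i \<omega> = particle N (\<lambda>j. V j \<omega>) (B \<omega>) i" for N i \<omega>
  define Xbar where "Xbar \<omega> = msol m (B \<omega>) (Vbar \<omega>)" for \<omega>
  define \<kappa> where "\<kappa> \<omega> = distr m PB (msol m (B \<omega>))" for \<omega>
  have BS: "B \<omega> \<in> PS" and WbS: "Wbar \<omega> \<in> PS" if "\<omega> \<in> space M" for \<omega>
    using measurable_space[OF Bm that] measurable_space[OF Wbm that] by auto
  have WS: "W i \<omega> \<in> PS" and VS: "V i \<omega> \<in> PS" if "i \<in> {1..N}" "\<omega> \<in> space M" for i N \<omega>
    using measurable_space[OF Wm that(2), of i] measurable_space[OF Vm that(2), of i] that(1) by auto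
  have particles: "X N i \<in> Lq_space M p PB" if "N \<ge> 1" "i \<in> {1..N}" for N i
    unfolding X_def[abs_def] by (rule particle_Lq[OF fin that(1) VL B_Lp that(2)]) simp
  have particle_sol: "particle_solution M T b \<zeta> W B N (X N)" if N: "N \<ge> 1" for N
    unfolding particle_solution_def
  proof (intro AE_I2 ballI)
    fix \<omega> i assume \<omega>: "\<omega> \<in> space M" and i: "i \<in> {1..N}"
    show "integral_equation T
        (\<lambda>s. b s (apply_bcontfun (X N i \<omega>) s) (empirical_measure borel N (\<lambda>j. apply_bcontfun (X N j \<omega>) s)))
        (\<zeta> i \<omega>) (W i \<omega> + B \<omega>) (X N i \<omega>)"
      unfolding X_def
      by (rule particle_integral_equation[OF N _ BS[OF \<omega>] i]) (use WS[OF _ \<omega>] in \<open>auto simp: V_def\<close>)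
  qed
  have Xbar: "Xbar \<in> Lq_space M p PB"
    unfolding Xbar_def[abs_def] by (rule msol_compose_Lq[OF mP fin B_Lp VbL])
  have cond: "regular_conditional_law M PB Xbar PB B \<kappa>"
  proof -
    have "(\<lambda>(\<beta>, v). msol m \<beta> v) \<in> measurable (PB \<Otimes>\<^sub>M PB) PB"
      unfolding case_prod_beta' by (rule msol_compose_measurable[OF mP]) auto
    from regular_conditional_law_indep[OF BV this] show ?thesis
      by (simp add: lawb Xbar_def[abs_def] \<kappa>_def[abs_def])
  qed
  have mean_field: "mean_field_solution M T b \<zeta>bar Wbar B \<kappa> Xbar"
    unfolding mean_field_solution_def
  proof (rule AE_I2)
    fix \<omega> assume \<omega>: "\<omega> \<in> space M"
    show "integral_equation T
        (\<lambda>s. b s (apply_bcontfun (Xbar \<omega>) s) (distr (\<kappa> \<omega>) borel (\<lambda>f. apply_bcontfun f s)))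
        (\<zeta>bar \<omega>) (Wbar \<omega> + B \<omega>) (Xbar \<omega>)"
      unfolding \<kappa>_def by (rule msol_integral_equation[OF mP BS[OF \<omega>] WbS[OF \<omega>]]) (simp add: Xbar_def Vbar_def)
  qed
  have conv: "AE \<omega> in M. (\<lambda>N. wasserstein p (empirical_measure PB N (\<lambda>i. X N i \<omega>)) (\<kappa> \<omega>)) \<longlonglongrightarrow> 0"
    using wasserstein_LLN_couplings[OF iid T p pp' mom] AE_space
  proof eventually_elim
    case (elim \<omega>)
    let ?emp = "\<lambda>N. distr (uniform_count_measure {1..N}) PB (\<lambda>i. V i \<omega>)" and ?E = "exp (8 * L * T) * 8"
    show ?case
    proof (rule order_tendstoI)
      fix a :: ennreal assume "0 < a"
      \<comment> \<open>\<open>a\<close> may be infinite; a smaller positive \<open>a'\<close> is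
        finite and gives a real bound.\<close>
      then obtain a' where a': "0 < a'" "a' < a" using dense by blast
      define e where "e = enn2real a'"
      have "a' < \<top>" using a'(2) top_greatest by (rule less_le_trans)
      then have e: "0 < e" "ennreal e < a" using a' by (auto simp: e_def enn2real_positive_iff)
      \<comment> \<open>Solves \<open>?E * \<epsilon> powr (1 / p) = e\<close>, the bound on the
        distance for a coupling of cost \<open>\<epsilon>\<close>.\<close>
      define \<epsilon> where "\<epsilon> = (e / ?E) powr p"
      have "\<epsilon> > 0" using e by (simp add: \<epsilon>_def)
      with elim(1) have "eventually (\<lambda>N. \<exists>\<gamma>\<in>couplings (?emp N) m. (\<integral>(x, y). dist x y powr p \<partial>\<gamma>) \<le> \<epsilon>) sequentially"
        by blast
      then show "eventually (\<lambda>N. wasserstein p (empirical_measure PB N (\<lambda>i. X N i \<omega>)) (\<kappa> \<omega>) < a) sequentially"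
        using eventually_ge_at_top[of 1]
      proof eventually_elim
        case (elim N)
        \<comment> \<open>The coupling may depend on \<open>\<omega>\<close> and \<open>N\<close> in
          any way, since it only bounds an infimum at fixed \<open>\<omega>\<close> and
          \<open>N\<close>.\<close>
        then obtain \<gamma> where \<gamma>: "\<gamma> \<in> couplings (?emp N) m" "(\<integral>(x, y). dist x y powr p \<partial>\<gamma>) \<le> \<epsilon>" by blast
        have N: "N \<ge> 1" by fact
        have vs: "V i \<omega> \<in> PS" if "i \<in> {1..N}" for i by (rule VS[OF that]) fact
        have \<beta>: "B \<omega> \<in> PS" by (rule BS) fact
        have emp: "empirical_measure PB N (\<lambda>i. X N i \<omega>) = distr (?emp N) PB (msol (?emp N) (B \<omega>))"
          using empirical_particle[of N "\<lambda>i. V i \<omega>" "B \<omega>", OF N vs \<beta>] by (simp add: X_def)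
        have "wasserstein p (empirical_measure PB N (\<lambda>i. X N i \<omega>)) (\<kappa> \<omega>)
            \<le> ennreal (?E * (\<integral>(x, y). dist x y powr p \<partial>\<gamma>) powr (1 / p))"
          unfolding emp \<kappa>_def
          by (rule wasserstein_msol_le[OF uniform_prob_moment[OF N vs] mP \<beta> \<gamma>(1)])
        also have "\<dots> \<le> ennreal e"
        proof (rule ennreal_leI)
          have "(\<integral>(x, y). dist x y powr p \<partial>\<gamma>) powr (1 / p) \<le> e / ?E"
            using \<gamma>(2) e p by (intro powr_inverse_le) (auto simp: \<epsilon>_def intro!: Bochner_Integration.integral_nonneg)
          then show "?E * (\<integral>(x, y). dist x y powr p \<partial>\<gamma>) powr (1 / p) \<le> e"
            by (simp add: pos_le_divide_eq mult.commute)
        qed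
        also have "\<dots> < a" by (rule e(2))
        finally show ?case .
      qed
    qed simp
  qed
  show ?thesis
    using particles particle_sol Xbar cond mean_field conv by blast
qed

end
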